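(* Let $(M^m,g_M)$ and $(N^n,g_N)$ be Riemannian manifolds and let $\lambda$ be a smooth function on $M$. The Riemannian submersion $$\phi:(M^m\times N^n,\ g_M+e^{2\lambda}g_N)\to(M^m,g_M),\qquad \phi(x,y)=x,$$ defined by the projection of the warped product onto its first factor, is biharmonic if and only if $$\mathrm{grad}\,\Delta\lambda+2\,\mathrm{Ricci}^M(\mathrm{grad}\,\lambda)+\frac n2\,\mathrm{grad}\,|\mathrm{grad}\,\lambda|^2=0,$$ where $\mathrm{grad}$ and $\Delta$ are the gradient and the Laplace operators on $(M^m,g_M)$.
   Context: A map $\phi:(P,g)\to(Q,h)$ between Riemannian manifolds is biharmonic if its bitension field $\tau_2(\phi)=\mathrm{Trace}_g(\nabla^\phi\nabla^\phi-\nabla^\phi_{\nabla^P})\tau(\phi)-\mathrm{Trace}_gR^Q(\mathrm d\phi,\tau(\phi))\mathrm d\phi$ vanishes, where $\tau(\phi)=\mathrm{Trace}_g\nabla\mathrm d\phi$ is the tension field, $\nabla^\phi$ is the pull-back connection on $\phi^{-1}TQ$, and $R^Q(X,Y)Z=[\nabla^Q_X,\nabla^Q_Y]Z-\nabla^Q_{[X,Y]}Z$. On $(M,g_M)$, $\Delta\lambda$ is the trace of the Hessian of $\lambda$, and $\mathrm{Ricci}^M$ is the Ricci operator, i.e. $g_M(\mathrm{Ricci}^M(X),Y)$ is the Ricci tensor of $(M,g_M)$. *)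

theory Defs
  imports "HOL-Analysis.Analysis"
begin

section \<open>Smooth functions on open subsets of Euclidean space\<close>

text \<open>
  The class $C^k$ through iterated partial derivatives. The definition is meant for
  open \<open>S\<close>.
\<close>

primrec Ck_on :: "nat \<Rightarrow> (real^'k) set \<Rightarrow> (real^'k \<Rightarrow> 'b::real_normed_vector) \<Rightarrow> bool" where
  "Ck_on 0 S f \<longleftrightarrow> continuous_on S f"
| "Ck_on (Suc r) S f \<longleftrightarrow> (\<forall>x\<in>S. f differentiable (at x)) \<and>
     (\<forall>i. Ck_on r S (\<lambda>x. frechet_derivative f (at x) (axis i 1)))"

definition smooth_on :: "(real^'k) set \<Rightarrow> (real^'k \<Rightarrow> 'b::real_normed_vector) \<Rightarrow> bool" where
  "smooth_on S f \<longleftrightarrow> (\<forall>r. Ck_on r S f)"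


section \<open>Riemannian geometry on open subsets of Euclidean space\<close>

text \<open>
  A vector field on an open subset of \<open>real^'k\<close> is a function \<open>real^'k \<Rightarrow> real^'k\<close>, and a
  Riemannian metric there is a function \<open>G\<close> with values in the symmetric positive definite
  matrices. Only the values on the open set under consideration matter, because all operators
  below depend only on germs of functions. The constant fields \<open>\<lambda>_. axis i 1\<close> form the coordinate frame.
\<close>

type_synonym 'k vfield = "real^'k \<Rightarrow> real^'k"
type_synonym 'k metric = "real^'k \<Rightarrow> real^'k^'k"

abbreviation ddir :: "(real^'k \<Rightarrow> 'b::real_normed_vector) \<Rightarrow> 'k vfield \<Rightarrow> real^'k \<Rightarrow> 'b" where
  "ddir f X x \<equiv> frechet_derivative f (at x) (X x)"

abbreviation frame :: "'k \<Rightarrow> 'k::finite vfield" where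
  "frame i \<equiv> (\<lambda>_. axis i 1)"

definition christoffel :: "'k::finite metric \<Rightarrow> real^'k \<Rightarrow> 'k \<Rightarrow> 'k \<Rightarrow> 'k \<Rightarrow> real" where
  "christoffel G x k i j = (\<Sum>l\<in>UNIV. matrix_inv (G x) $ k $ l *
     (ddir (\<lambda>y. G y $ j $ l) (frame i) x + ddir (\<lambda>y. G y $ i $ l) (frame j) x
        - ddir (\<lambda>y. G y $ i $ j) (frame l) x)) / 2"

definition christoffel_form :: "'k::finite metric \<Rightarrow> real^'k \<Rightarrow> real^'k \<Rightarrow> real^'k \<Rightarrow> real^'k" where
  "christoffel_form G x u v =
     (\<chi> k. \<Sum>i\<in>UNIV. \<Sum>j\<in>UNIV. christoffel G x k i j * u $ i * v $ j)"

text \<open>The Levi-Civita connection of \<open>G\<close>, and the connection which it induces on vector fields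
  \<open>V\<close> along a map \<open>f\<close>, i.e. on sections of the pull-back $f^{-1}TQ$.\<close>

definition loc_nabla :: "'k::finite metric \<Rightarrow> 'k vfield \<Rightarrow> 'k vfield \<Rightarrow> 'k vfield" where
  "loc_nabla G X Y x = ddir Y X x + christoffel_form G x (X x) (Y x)"

definition loc_nabla_along :: "'q::finite metric \<Rightarrow> (real^'p \<Rightarrow> real^'q) \<Rightarrow> 'p::finite vfield
    \<Rightarrow> (real^'p \<Rightarrow> real^'q) \<Rightarrow> real^'p \<Rightarrow> real^'q" where
  "loc_nabla_along H f X V x = ddir V X x + christoffel_form H (f x) (ddir f X x) (V x)"

definition loc_bracket :: "'k::finite vfield \<Rightarrow> 'k vfield \<Rightarrow> 'k vfield" where
  "loc_bracket X Y x = ddir Y X x - ddir X Y x"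

definition loc_curv :: "'k::finite metric \<Rightarrow> 'k vfield \<Rightarrow> 'k vfield \<Rightarrow> 'k vfield \<Rightarrow> 'k vfield" where
  "loc_curv G X Y Z x = loc_nabla G X (loc_nabla G Y Z) x - loc_nabla G Y (loc_nabla G X Z) x
     - loc_nabla G (loc_bracket X Y) Z x"

text \<open>The curvature tensor at a point: as \<open>loc_curv\<close> is tensorial, vectors may be extended to
  vector fields arbitrarily, here as fields with constant coefficients.\<close>

definition loc_curv_at :: "'k::finite metric \<Rightarrow> real^'k \<Rightarrow> real^'k \<Rightarrow> real^'k \<Rightarrow> real^'k \<Rightarrow> real^'k" where
  "loc_curv_at G x u v w = loc_curv G (\<lambda>_. u) (\<lambda>_. v) (\<lambda>_. w) x"

text \<open>The metric trace $\sum_{i,j} g^{ij} B(\partial_i, \partial_j)$.\<close>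

definition loc_trace :: "'k::finite metric
    \<Rightarrow> ('k vfield \<Rightarrow> 'k vfield \<Rightarrow> real^'k \<Rightarrow> 'b::real_vector) \<Rightarrow> real^'k \<Rightarrow> 'b" where
  "loc_trace G T x =
     (\<Sum>i\<in>UNIV. \<Sum>j\<in>UNIV. (matrix_inv (G x) $ i $ j) *\<^sub>R T (frame i) (frame j) x)"

definition loc_grad :: "'k::finite metric \<Rightarrow> (real^'k \<Rightarrow> real) \<Rightarrow> 'k vfield" where
  "loc_grad G f x = matrix_inv (G x) *v (\<chi> j. ddir f (frame j) x)"

definition loc_hessian :: "'k::finite metric \<Rightarrow> (real^'k \<Rightarrow> real) \<Rightarrow> 'k vfield \<Rightarrow> 'k vfield
    \<Rightarrow> real^'k \<Rightarrow> real" where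
  "loc_hessian G f X Y x = ddir (ddir f Y) X x - ddir f (loc_nabla G X Y) x"

definition loc_laplacian :: "'k::finite metric \<Rightarrow> (real^'k \<Rightarrow> real) \<Rightarrow> real^'k \<Rightarrow> real" where
  "loc_laplacian G f = loc_trace G (loc_hessian G f)"

text \<open>The Ricci tensor $\mathrm{Ric}(u,v) = \mathrm{tr}(w \mapsto R(w,u)v)$; the Ricci operator
  is obtained from it by raising an index.\<close>

definition loc_ricci :: "'k::finite metric \<Rightarrow> real^'k \<Rightarrow> real^'k \<Rightarrow> real^'k \<Rightarrow> real" where
  "loc_ricci G x u v = (\<Sum>k\<in>UNIV. loc_curv_at G x (axis k 1) u v $ k)"

definition loc_ricci_op :: "'k::finite metric \<Rightarrow> real^'k \<Rightarrow> real^'k \<Rightarrow> real^'k" where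
  "loc_ricci_op G x u = matrix_inv (G x) *v (\<chi> j. loc_ricci G x u (axis j 1))"

definition loc_tension :: "'p::finite metric \<Rightarrow> 'q::finite metric \<Rightarrow> (real^'p \<Rightarrow> real^'q)
    \<Rightarrow> real^'p \<Rightarrow> real^'q" where
  "loc_tension G H f =
     loc_trace G (\<lambda>X Y x. loc_nabla_along H f X (ddir f Y) x - ddir f (loc_nabla G X Y) x)"

definition loc_bitension :: "'p::finite metric \<Rightarrow> 'q::finite metric \<Rightarrow> (real^'p \<Rightarrow> real^'q)
    \<Rightarrow> real^'p \<Rightarrow> real^'q" where
  "loc_bitension G H f x = (let \<tau> = loc_tension G H f in
     loc_trace G (\<lambda>X Y y. loc_nabla_along H f X (loc_nabla_along H f Y \<tau>) y
       - loc_nabla_along H f (loc_nabla G X Y) \<tau> y) x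
     - loc_trace G (\<lambda>X Y y. loc_curv_at H (f y) (ddir f X y) (\<tau> y) (ddir f Y y)) x)"


section \<open>Manifolds\<close>

text \<open>
  The underlying space of a manifold is a (nonempty) Hausdorff second countable type; its smooth
  structure is given by a smooth atlas, which need not be maximal. A chart is a coordinate domain
  together with the coordinate map, whose values off the domain are irrelevant.
\<close>

type_synonym ('a, 'k) chart = "'a set \<times> ('a \<Rightarrow> real^'k)"

abbreviation cdom :: "('a, 'k::finite) chart \<Rightarrow> 'a set" where
  "cdom C \<equiv> fst C"

abbreviation cmap :: "('a, 'k::finite) chart \<Rightarrow> 'a \<Rightarrow> real^'k" where
  "cmap C \<equiv> snd C"

definition cinv :: "('a, 'k::finite) chart \<Rightarrow> real^'k \<Rightarrow> 'a" where
  "cinv C = inv_into (cdom C) (cmap C)"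

definition smooth_atlas ::
    "('a::{t2_space,second_countable_topology}, 'k::finite) chart set \<Rightarrow> bool" where
  "smooth_atlas A \<longleftrightarrow>
     (\<Union>C\<in>A. cdom C) = UNIV \<and>
     (\<forall>C\<in>A. open (cdom C) \<and> open (cmap C ` cdom C) \<and>
        homeomorphism (cdom C) (cmap C ` cdom C) (cmap C) (cinv C)) \<and>
     (\<forall>C\<in>A. \<forall>D\<in>A. smooth_on (cmap C ` (cdom C \<inter> cdom D)) (cmap D \<circ> cinv C))"

definition smooth_function ::
    "('a, 'k::finite) chart set \<Rightarrow> ('a \<Rightarrow> real) \<Rightarrow> bool" where
  "smooth_function A f \<longleftrightarrow> (\<forall>C\<in>A. smooth_on (cmap C ` cdom C) (f \<circ> cinv C))"

definition smooth_map :: "('a::topological_space, 'p::finite) chart set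
    \<Rightarrow> ('b::topological_space, 'q::finite) chart set \<Rightarrow> ('a \<Rightarrow> 'b) \<Rightarrow> bool" where
  "smooth_map P Q \<phi> \<longleftrightarrow> continuous_on UNIV \<phi> \<and>
     (\<forall>C\<in>P. \<forall>D\<in>Q. smooth_on (cmap C ` (cdom C \<inter> \<phi> -` cdom D)) (cmap D \<circ> \<phi> \<circ> cinv C))"

definition charts_at :: "('a, 'k::finite) chart set \<Rightarrow> 'a \<Rightarrow> ('a, 'k) chart set" where
  "charts_at A p = {C \<in> A. p \<in> cdom C}"

definition chart_at :: "('a, 'k::finite) chart set \<Rightarrow> 'a \<Rightarrow> ('a, 'k) chart" where
  "chart_at A p = (SOME C. C \<in> charts_at A p)"

text \<open>
  A tangent vector at \<open>p\<close> is a family of coordinate vectors, one for each chart around \<open>p\<close>, which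
  transforms with the Jacobians of the coordinate changes. For charts not around \<open>p\<close> the entry is
  fixed to be 0, so that equality of tangent vectors is equality of families.
\<close>

type_synonym ('a, 'k) tvec = "('a, 'k) chart \<Rightarrow> real^'k"

definition tangent_space :: "('a, 'k::finite) chart set \<Rightarrow> 'a \<Rightarrow> ('a, 'k) tvec set" where
  "tangent_space A p = {v.
     (\<forall>C\<in>charts_at A p. \<forall>D\<in>charts_at A p.
        v D = frechet_derivative (cmap D \<circ> cinv C) (at (cmap C p)) (v C)) \<and>
     (\<forall>C. C \<notin> charts_at A p \<longrightarrow> v C = 0)}"

text \<open>The coordinate vector $\partial_i$ of the chart \<open>C\<close> at \<open>p\<close>.\<close>

definition coord_vec :: "('a, 'k::finite) chart set \<Rightarrow> ('a, 'k) chart \<Rightarrow> 'a \<Rightarrow> 'k \<Rightarrow> ('a, 'k) tvec" where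
  "coord_vec A C p i = (\<lambda>D. if D \<in> charts_at A p
     then frechet_derivative (cmap D \<circ> cinv C) (at (cmap C p)) (axis i 1) else 0)"

text \<open>The differential of a smooth map. By the chain rule, the choice of the chart around \<open>p\<close>
  is immaterial.\<close>

definition differential :: "('a, 'p::finite) chart set \<Rightarrow> ('b, 'q::finite) chart set \<Rightarrow> ('a \<Rightarrow> 'b)
    \<Rightarrow> 'a \<Rightarrow> ('a, 'p) tvec \<Rightarrow> ('b, 'q) tvec" where
  "differential P Q \<phi> p v = (\<lambda>D. if D \<in> charts_at Q (\<phi> p)
     then let C = chart_at P p
          in frechet_derivative (cmap D \<circ> \<phi> \<circ> cinv C) (at (cmap C p)) (v C)
     else 0)"


section \<open>Riemannian manifolds\<close>

type_synonym ('a, 'k) rmetric = "'a \<Rightarrow> ('a, 'k) tvec \<Rightarrow> ('a, 'k) tvec \<Rightarrow> real"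

definition metric_in :: "('a, 'k::finite) chart set \<Rightarrow> ('a, 'k) rmetric \<Rightarrow> ('a, 'k) chart \<Rightarrow> 'k metric" where
  "metric_in A g C x =
     (\<chi> i j. g (cinv C x) (coord_vec A C (cinv C x) i) (coord_vec A C (cinv C x) j))"

definition riemannian_metric :: "('a, 'k::finite) chart set \<Rightarrow> ('a, 'k) rmetric \<Rightarrow> bool" where
  "riemannian_metric A g \<longleftrightarrow>
     (\<forall>p. \<forall>u\<in>tangent_space A p. \<forall>v\<in>tangent_space A p. \<forall>w\<in>tangent_space A p. \<forall>a b.
        g p u v = g p v u \<and>
        g p (\<lambda>C. a *\<^sub>R u C + b *\<^sub>R v C) w = a * g p u w + b * g p v w) \<and>
     (\<forall>p. \<forall>v\<in>tangent_space A p. v \<noteq> (\<lambda>_. 0) \<longrightarrow> g p v v > 0) \<and>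
     (\<forall>C\<in>A. smooth_on (cmap C ` cdom C) (metric_in A g C))"

definition riemannian_manifold ::
    "('a::{t2_space,second_countable_topology}, 'k::finite) chart set \<Rightarrow> ('a, 'k) rmetric \<Rightarrow> bool" where
  "riemannian_manifold A g \<longleftrightarrow> smooth_atlas A \<and> riemannian_metric A g"

text \<open>
  The operators of Riemannian geometry. Those whose value is a tangent vector are given by their
  components in each chart; where a chart has to be chosen, the result does not depend on the
  choice, because the expressions in coordinates are invariant under coordinate changes.
\<close>

definition grad :: "('a, 'k::finite) chart set \<Rightarrow> ('a, 'k) rmetric \<Rightarrow> ('a \<Rightarrow> real)
    \<Rightarrow> 'a \<Rightarrow> ('a, 'k) tvec" where
  "grad A g f p = (\<lambda>C. if C \<in> charts_at A p
     then loc_grad (metric_in A g C) (f \<circ> cinv C) (cmap C p) else 0)"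

definition laplacian :: "('a, 'k::finite) chart set \<Rightarrow> ('a, 'k) rmetric \<Rightarrow> ('a \<Rightarrow> real) \<Rightarrow> 'a \<Rightarrow> real" where
  "laplacian A g f p = (let C = chart_at A p
     in loc_laplacian (metric_in A g C) (f \<circ> cinv C) (cmap C p))"

definition ricci_op :: "('a, 'k::finite) chart set \<Rightarrow> ('a, 'k) rmetric \<Rightarrow> 'a
    \<Rightarrow> ('a, 'k) tvec \<Rightarrow> ('a, 'k) tvec" where
  "ricci_op A g p v = (\<lambda>C. if C \<in> charts_at A p
     then loc_ricci_op (metric_in A g C) (cmap C p) (v C) else 0)"

text \<open>The bitension field of a map, with values in the tangent spaces of the target: on the
  domain of a chart around \<open>p\<close> it is computed in the coordinate frame of that chart.\<close>

definition bitension_field :: "('a, 'p::finite) chart set \<Rightarrow> ('a, 'p) rmetric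
    \<Rightarrow> ('b, 'q::finite) chart set \<Rightarrow> ('b, 'q) rmetric \<Rightarrow> ('a \<Rightarrow> 'b) \<Rightarrow> 'a \<Rightarrow> ('b, 'q) tvec" where
  "bitension_field P g Q h \<phi> p = (\<lambda>D. if D \<in> charts_at Q (\<phi> p)
     then let C = chart_at P p
          in loc_bitension (metric_in P g C) (metric_in Q h D) (cmap D \<circ> \<phi> \<circ> cinv C) (cmap C p)
     else 0)"

definition biharmonic :: "('a::topological_space, 'p::finite) chart set \<Rightarrow> ('a, 'p) rmetric
    \<Rightarrow> ('b::topological_space, 'q::finite) chart set \<Rightarrow> ('b, 'q) rmetric \<Rightarrow> ('a \<Rightarrow> 'b) \<Rightarrow> bool" where
  "biharmonic P g Q h \<phi> \<longleftrightarrow>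
     smooth_map P Q \<phi> \<and> (\<forall>p. bitension_field P g Q h \<phi> p = (\<lambda>_. 0))"


section \<open>Warped products\<close>

definition prod_chart :: "('a, 'm::finite) chart \<Rightarrow> ('b, 'n::finite) chart \<Rightarrow> ('a \<times> 'b, 'm + 'n) chart" where
  "prod_chart C D = (cdom C \<times> cdom D,
     \<lambda>(x, y). \<chi> k. case k of Inl i \<Rightarrow> cmap C x $ i | Inr j \<Rightarrow> cmap D y $ j)"

definition prod_atlas :: "('a, 'm::finite) chart set \<Rightarrow> ('b, 'n::finite) chart set
    \<Rightarrow> ('a \<times> 'b, 'm + 'n) chart set" where
  "prod_atlas A B = {prod_chart C D | C D. C \<in> A \<and> D \<in> B}"

text \<open>The warped product metric $g + e^{2\lambda} h$; both summands are pulled back by the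
  projections.\<close>

definition warped_metric :: "('a, 'm::finite) chart set \<Rightarrow> ('a, 'm) rmetric
    \<Rightarrow> ('b, 'n::finite) chart set \<Rightarrow> ('b, 'n) rmetric \<Rightarrow> ('a \<Rightarrow> real) \<Rightarrow> ('a \<times> 'b, 'm + 'n) rmetric" where
  "warped_metric A g B h lam p u v =
     g (fst p) (differential (prod_atlas A B) A fst p u) (differential (prod_atlas A B) A fst p v)
     + exp (2 * lam (fst p)) *
       h (snd p) (differential (prod_atlas A B) B snd p u) (differential (prod_atlas A B) B snd p v)"

end

theory Submission
  imports Defs
begin

text \<open>
  The projection \<open>\<phi>\<close> of the warped product is a Riemannian submersion. The second fundamental form
  of its fibres gives $\tau(\phi) = n\,\mathrm{grad}\,\lambda \circ \phi$. For a Riemannian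
  submersion with $\tau(\phi) = V \circ \phi$ the chain rule yields
  $\tau_2(\phi) = (\mathrm{Trace}\,\nabla^2 V + \nabla_V V + \mathrm{Ricci}(V)) \circ \phi$. For
  $V = n\,\mathrm{grad}\,\lambda$ the Bochner formula
  $\mathrm{Trace}\,\nabla^2\,\mathrm{grad}\,\lambda = \mathrm{grad}\,\Delta\lambda + \mathrm{Ricci}(\mathrm{grad}\,\lambda)$
  and $\nabla_{\mathrm{grad}\,\lambda}\,\mathrm{grad}\,\lambda = \frac12\,\mathrm{grad}\,|\mathrm{grad}\,\lambda|^2$
  turn this into $n$ times the left-hand side of the asserted equation. In charts, \<open>\<phi>\<close> is a
  coordinate change \<open>\<psi>\<close> after the linear projection \<open>pr1\<close>, because the chart of the target need
  not be a factor of the chart of the product; computing in the coordinates of the target avoids the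
  transformation law of the curvature tensor.
\<close>

section \<open>Smooth functions\<close>

text \<open>No orthonormal frames occur. An identity of tangent vectors is tested against an
  arbitrary \<open>w\<close> with the inner product \<open>ip\<close> and cancelled by
  nondegeneracy, and \<open>koszul\<close> ties the index formula of the Christoffel symbols to this
  style. The two Ricci terms have different origins: one comes from commuting derivatives in the
  rough Laplacian of grad \<lambda>, the other is the curvature term of the bitension field. The
  term \<nabla>_V V arises from the second fundamental form of \<phi>, whose trace is V itself;
  being quadratic in V = n grad \<lambda>, it is the one that keeps a factor n after division by n,
  and this is the n/2 of the equation. The Laplacian, the differential and the source side of the
  bitension field are computed in an arbitrarily chosen chart. Removing the choice for the first two
  takes no more than the chain rule and the transformation law of the Christoffel symbols; for the
  third, the computation is done for any product chart and its result depends on the target chart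
  only. The final equivalence rests on n being nonzero.\<close>

lemma Ck_on_cong:
  assumes "open S" "\<And>x. x \<in> S \<Longrightarrow> f x = g x" "Ck_on r S f"
  shows "Ck_on r S g"
  using assms(2,3)
proof (induction r arbitrary: f g)
  case 0
  then show ?case using continuous_on_cong[of S S f g] by simp
next
  case (Suc r)
  have D: "frechet_derivative f (at x) = frechet_derivative g (at x)" if "x \<in> S" for x
    using Suc.prems that assms(1) by (intro frechet_derivative_transform_within_open[of f x S g]) auto
  have "g differentiable (at x)" if "x \<in> S" for x
    using Suc.prems that assms(1)
    by (meson Ck_on.simps(2) differentiable_def has_derivative_transform_within_open)
  moreover have "Ck_on r S (\<lambda>x. frechet_derivative g (at x) (axis i 1))" for i
    using Suc.IH[of "\<lambda>x. frechet_derivative f (at x) (axis i 1)"] Suc.prems(2) D by auto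
  ultimately show ?case by simp
qed

lemma Ck_on_Suc_imp: "Ck_on (Suc r) S f \<Longrightarrow> Ck_on r S f"
proof (induction r arbitrary: f)
  case 0
  then show ?case
    by (auto intro!: differentiable_imp_continuous_on simp: differentiable_on_def differentiable_at_withinI)
next
  case (Suc r)
  then show ?case by (metis Ck_on.simps(2))
qed

lemma Ck_on_subset: "Ck_on r S f \<Longrightarrow> T \<subseteq> S \<Longrightarrow> Ck_on r T f"
  by (induction r arbitrary: f) (auto intro: continuous_on_subset)

lemma Ck_on_const [simp]: "Ck_on r S (\<lambda>x. c)"
  by (induction r arbitrary: c) auto

text \<open>Carries the closure proofs below: an explicit derivative formula can be differentiated
  again by known rules, and since it agrees with \<open>frechet_derivative\<close> on the open set,
  \<open>Ck_on_cong\<close> transfers the regularity.\<close>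

lemma Ck_on_SucI:
  assumes "open S" "\<And>x. x \<in> S \<Longrightarrow> (f has_derivative f' x) (at x)"
    "\<And>i. Ck_on r S (\<lambda>x. f' x (axis i 1))"
  shows "Ck_on (Suc r) S f"
proof -
  have "frechet_derivative f (at x) = f' x" if "x \<in> S" for x
    using assms(2)[OF that] frechet_derivative_at by metis
  then have "Ck_on r S (\<lambda>x. frechet_derivative f (at x) (axis i 1))" for i
    using Ck_on_cong[OF assms(1) _ assms(3)[of i]] by auto
  moreover have "f differentiable (at x)" if "x \<in> S" for x
    using assms(2)[OF that] differentiableI by blast
  ultimately show ?thesis by simp
qed

lemma Ck_on_has_derivative:
  "Ck_on (Suc r) S f \<Longrightarrow> x \<in> S \<Longrightarrow> (f has_derivative frechet_derivative f (at x)) (at x)"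
  by (simp add: frechet_derivative_works)

lemma Ck_on_linear:
  assumes "open S" "bounded_linear L"
  shows "Ck_on r S L"
proof (cases r)
  case 0
  then show ?thesis using assms(2) by (simp add: linear_continuous_on)
next
  case (Suc q)
  show ?thesis
    unfolding Suc by (rule Ck_on_SucI[where f' = "\<lambda>_. L"])
      (use assms in \<open>auto intro: bounded_linear_imp_has_derivative\<close>)
qed

lemma Ck_on_bounded_linear:
  assumes "open S" "bounded_linear L" "Ck_on r S f"
  shows "Ck_on r S (\<lambda>x. L (f x))"
  using assms(3)
proof (induction r arbitrary: f)
  case 0
  then show ?case using assms(2) by (simp add: bounded_linear.continuous_on)
next
  case (Suc r)
  show ?case
  proof (rule Ck_on_SucI[OF assms(1)])
    show "((\<lambda>x. L (f x)) has_derivative (\<lambda>h. L (frechet_derivative f (at x) h))) (at x)" if "x \<in> S" for x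
      by (rule bounded_linear.has_derivative[OF assms(2) Ck_on_has_derivative[OF Suc.prems that]])
    show "Ck_on r S (\<lambda>x. L (frechet_derivative f (at x) (axis i 1)))" for i
      using Suc by simp
  qed
qed

lemma Ck_on_add:
  assumes "open S" "Ck_on r S f" "Ck_on r S g"
  shows "Ck_on r S (\<lambda>x. f x + g x)"
  using assms(2,3)
proof (induction r arbitrary: f g)
  case 0
  then show ?case by (simp add: continuous_on_add)
next
  case (Suc r)
  show ?case
  proof (rule Ck_on_SucI[OF assms(1)])
    show "((\<lambda>x. f x + g x) has_derivative
        (\<lambda>h. frechet_derivative f (at x) h + frechet_derivative g (at x) h)) (at x)" if "x \<in> S" for x
      by (intro has_derivative_add Ck_on_has_derivative[OF Suc.prems(1) that] Ck_on_has_derivative[OF Suc.prems(2) that])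
  qed (use Suc in auto)
qed

lemma Ck_on_bilinear:
  assumes "open S" "bounded_bilinear B" "Ck_on r S f" "Ck_on r S g"
  shows "Ck_on r S (\<lambda>x. B (f x) (g x))"
  using assms(3,4)
proof (induction r arbitrary: f g)
  case 0
  then show ?case using assms(2) by (simp add: bounded_bilinear.continuous_on)
next
  case (Suc r)
  show ?case
  proof (rule Ck_on_SucI[OF assms(1)])
    show "((\<lambda>x. B (f x) (g x)) has_derivative
        (\<lambda>h. B (f x) (frechet_derivative g (at x) h) + B (frechet_derivative f (at x) h) (g x))) (at x)"
      if "x \<in> S" for x
      using bounded_bilinear.FDERIV[OF assms(2) Ck_on_has_derivative[OF Suc.prems(1) that]
          Ck_on_has_derivative[OF Suc.prems(2) that]] .
    show "Ck_on r S (\<lambda>x. B (f x) (frechet_derivative g (at x) (axis i 1)) +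
        B (frechet_derivative f (at x) (axis i 1)) (g x))" for i
      using Suc.prems Ck_on_Suc_imp[OF Suc.prems(1)] Ck_on_Suc_imp[OF Suc.prems(2)]
      by (intro Ck_on_add assms(1) Suc.IH) auto
  qed
qed

lemma Ck_on_sum:
  assumes "open S" "\<And>i. i \<in> I \<Longrightarrow> Ck_on r S (f i)"
  shows "Ck_on r S (\<lambda>x. \<Sum>i\<in>I. f i x)"
  using assms(2)
  by (induction I rule: infinite_finite_induct) (auto intro!: Ck_on_add assms(1))

lemma linear_eq_sum_axis:
  fixes L :: "real^'k \<Rightarrow> 'b::real_vector"
  assumes "linear L"
  shows "L v = (\<Sum>k\<in>UNIV. v $ k *\<^sub>R L (axis k 1))"
proof -
  have "v = (\<Sum>k\<in>UNIV. v $ k *\<^sub>R axis k 1)"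
    by (simp add: basis_expansion[where 'a=real, unfolded scalar_mult_eq_scaleR, symmetric])
  then have "L v = L (\<Sum>k\<in>UNIV. v $ k *\<^sub>R axis k 1)" by (rule arg_cong)
  also have "\<dots> = (\<Sum>k\<in>UNIV. v $ k *\<^sub>R L (axis k 1))"
    by (simp add: assms linear_sum linear_scale)
  finally show ?thesis .
qed

text \<open>The chain rule is written as a sum over partial derivatives of \<open>g\<close>, because
  the induction hypothesis applies to \<open>g\<close> differentiated along a fixed axis and then
  composed with \<open>f\<close>; hence the induction varies \<open>g\<close> and keeps
  \<open>f\<close>.\<close>

lemma Ck_on_compose:
  assumes "open S" "open T" "f ` S \<subseteq> T" "Ck_on r T g" "Ck_on r S f"
  shows "Ck_on r S (\<lambda>x. g (f x))"
  using assms(4,5)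
proof (induction r arbitrary: g)
  case 0
  then show ?case using assms(3) by (auto intro: continuous_on_compose2)
next
  case (Suc r)
  have dg: "g differentiable (at (f x))" if "x \<in> S" for x
    using Suc.prems that assms(3) by auto
  show ?case
  proof (rule Ck_on_SucI[OF assms(1)])
    show "((\<lambda>x. g (f x)) has_derivative
        (\<lambda>h. \<Sum>k\<in>UNIV. (frechet_derivative f (at x) h $ k) *\<^sub>R frechet_derivative g (at (f x)) (axis k 1))) (at x)"
      if "x \<in> S" for x
    proof -
      have "((g \<circ> f) has_derivative (frechet_derivative g (at (f x)) \<circ> frechet_derivative f (at x))) (at x)"
        by (intro diff_chain_at Ck_on_has_derivative[OF Suc.prems(2) that]
            dg[OF that, unfolded frechet_derivative_works])
      moreover have "frechet_derivative g (at (f x)) \<circ> frechet_derivative f (at x) =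
        (\<lambda>h. \<Sum>k\<in>UNIV. (frechet_derivative f (at x) h $ k) *\<^sub>R frechet_derivative g (at (f x)) (axis k 1))"
        by (rule ext) (simp add: linear_eq_sum_axis[OF linear_frechet_derivative[OF dg[OF that]], symmetric])
      ultimately show ?thesis by (simp add: o_def)
    qed
    have "Ck_on r S (\<lambda>x. frechet_derivative g (at (f x)) (axis k 1))" for k
      using Suc.IH[of "\<lambda>y. frechet_derivative g (at y) (axis k 1)"] Suc.prems Ck_on_Suc_imp by auto
    moreover have "Ck_on r S (\<lambda>x. frechet_derivative f (at x) (axis i 1) $ k)" for i k
      using Suc.prems by (intro Ck_on_bounded_linear[OF assms(1) bounded_linear_vec_nth]) auto
    ultimately show "Ck_on r S (\<lambda>x. \<Sum>k\<in>UNIV. (frechet_derivative f (at x) (axis i 1) $ k) *\<^sub>R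
        frechet_derivative g (at (f x)) (axis k 1))" for i
      by (intro Ck_on_sum Ck_on_bilinear[OF assms(1) bounded_bilinear_scaleR] assms(1))
  qed
qed

text \<open>The derivative of 1/f contains 1/f again, which is of class C^r by the induction
  hypothesis. The exponential follows the same pattern.\<close>

lemma Ck_on_inverse:
  fixes f :: "real^'k \<Rightarrow> real"
  assumes "open S" "\<And>x. x \<in> S \<Longrightarrow> f x \<noteq> 0" "Ck_on r S f"
  shows "Ck_on r S (\<lambda>x. inverse (f x))"
  using assms(3)
proof (induction r)
  case 0
  then show ?case using assms(2) by (simp add: continuous_on_inverse)
next
  case (Suc r)
  then have IH: "Ck_on r S (\<lambda>x. inverse (f x))" using Ck_on_Suc_imp by blast
  show ?case
  proof (rule Ck_on_SucI[OF assms(1)])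
    show "((\<lambda>x. inverse (f x)) has_derivative
        (\<lambda>h. - (inverse (f x) * frechet_derivative f (at x) h * inverse (f x)))) (at x)" if "x \<in> S" for x
      by (rule Deriv.has_derivative_inverse[OF assms(2)[OF that] Ck_on_has_derivative[OF Suc.prems that]])
    show "Ck_on r S (\<lambda>x. - (inverse (f x) * frechet_derivative f (at x) (axis i 1) * inverse (f x)))" for i
      using Suc.prems IH
      by (intro Ck_on_bounded_linear[OF assms(1), where L = uminus] Ck_on_bilinear[OF assms(1) bounded_bilinear_mult]
          bounded_linear_minus bounded_linear_ident) auto
  qed
qed

lemma Ck_on_exp:
  fixes f :: "real^'k \<Rightarrow> real"
  assumes "open S" "Ck_on r S f"
  shows "Ck_on r S (\<lambda>x. exp (f x))"
  using assms(2)
proof (induction r)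
  case 0
  then show ?case by (simp add: continuous_on_exp)
next
  case (Suc r)
  then have IH: "Ck_on r S (\<lambda>x. exp (f x))" using Ck_on_Suc_imp by blast
  show ?case
  proof (rule Ck_on_SucI[OF assms(1)])
    show "((\<lambda>x. exp (f x)) has_derivative (\<lambda>h. exp (f x) * frechet_derivative f (at x) h)) (at x)"
      if "x \<in> S" for x
      using has_derivative_exp[OF Ck_on_has_derivative[OF Suc.prems that]] by (simp add: mult.commute)
    show "Ck_on r S (\<lambda>x. exp (f x) * frechet_derivative f (at x) (axis i 1))" for i
      using Suc.prems IH by (intro Ck_on_bilinear[OF assms(1) bounded_bilinear_mult]) auto
  qed
qed

section \<open>Closure rules for smooth functions\<close>

named_theorems smooth_intros

lemma smooth_on_cong:
  "open S \<Longrightarrow> (\<And>x. x \<in> S \<Longrightarrow> f x = g x) \<Longrightarrow> smooth_on S f \<Longrightarrow> smooth_on S g"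
  unfolding smooth_on_def using Ck_on_cong by metis

lemma smooth_on_subset: "smooth_on S f \<Longrightarrow> T \<subseteq> S \<Longrightarrow> smooth_on T f"
  unfolding smooth_on_def using Ck_on_subset by metis

lemma smooth_on_const [smooth_intros]: "smooth_on S (\<lambda>x. c)"
  by (simp add: smooth_on_def)

lemma smooth_on_linear: "open S \<Longrightarrow> bounded_linear L \<Longrightarrow> smooth_on S L"
  by (simp add: smooth_on_def Ck_on_linear)

lemma smooth_on_ident [smooth_intros]: "open S \<Longrightarrow> smooth_on S (\<lambda>x. x)"
  by (simp add: smooth_on_linear)

lemma smooth_on_bounded_linear:
  "open S \<Longrightarrow> bounded_linear L \<Longrightarrow> smooth_on S f \<Longrightarrow> smooth_on S (\<lambda>x. L (f x))"
  by (simp add: smooth_on_def Ck_on_bounded_linear)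

lemma smooth_on_bilinear:
  "open S \<Longrightarrow> bounded_bilinear B \<Longrightarrow> smooth_on S f \<Longrightarrow> smooth_on S g \<Longrightarrow> smooth_on S (\<lambda>x. B (f x) (g x))"
  by (simp add: smooth_on_def Ck_on_bilinear)

lemma smooth_on_add [smooth_intros]:
  "open S \<Longrightarrow> smooth_on S f \<Longrightarrow> smooth_on S g \<Longrightarrow> smooth_on S (\<lambda>x. f x + g x)"
  by (simp add: smooth_on_def Ck_on_add)

lemma smooth_on_minus [smooth_intros]: "open S \<Longrightarrow> smooth_on S f \<Longrightarrow> smooth_on S (\<lambda>x. - f x)"
  by (rule smooth_on_bounded_linear[where L = uminus]) (auto intro: bounded_linear_minus bounded_linear_ident)

lemma smooth_on_diff [smooth_intros]:
  "open S \<Longrightarrow> smooth_on S f \<Longrightarrow> smooth_on S g \<Longrightarrow> smooth_on S (\<lambda>x. f x - g x)"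
  using smooth_on_add[of S f "\<lambda>x. - g x"] smooth_on_minus by fastforce

lemma smooth_on_sum [smooth_intros]:
  "open S \<Longrightarrow> (\<And>i. i \<in> I \<Longrightarrow> smooth_on S (f i)) \<Longrightarrow> smooth_on S (\<lambda>x. \<Sum>i\<in>I. f i x)"
  by (simp add: smooth_on_def Ck_on_sum)

lemmas smooth_on_mult [smooth_intros] = smooth_on_bilinear[OF _ bounded_bilinear_mult]
lemmas smooth_on_scaleR [smooth_intros] = smooth_on_bilinear[OF _ bounded_bilinear_scaleR]
lemmas smooth_on_inner [smooth_intros] = smooth_on_bilinear[OF _ bounded_bilinear_inner]
lemmas smooth_on_nth [smooth_intros] = smooth_on_bounded_linear[OF _ bounded_linear_vec_nth]

lemma smooth_on_vec_iff:
  fixes f :: "real^'k \<Rightarrow> 'b::real_normed_vector^'n"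
  assumes "open S"
  shows "smooth_on S f \<longleftrightarrow> (\<forall>i. smooth_on S (\<lambda>x. f x $ i))"
proof (intro iffI allI)
  show "smooth_on S (\<lambda>x. f x $ i)" if "smooth_on S f" for i using that assms smooth_on_nth by blast
  assume *: "\<forall>i. smooth_on S (\<lambda>x. f x $ i)"
  have "bounded_linear (\<lambda>v::'b. axis i v :: 'b^'n)" for i
    by (rule bounded_linear_intro[where K = 1])
      (auto simp: axis_def vec_eq_iff norm_vec_def L2_set_def if_distrib[of norm] if_distrib[of "\<lambda>x. x ^ 2"] cong: if_cong)
  then have "smooth_on S (\<lambda>x. \<Sum>i\<in>UNIV. axis i (f x $ i))"
    using * by (intro smooth_on_sum assms smooth_on_bounded_linear[where L = "axis _"]) auto
  moreover have "(\<Sum>i\<in>UNIV. axis i (f x $ i)) = f x" for x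
    by (simp add: vec_eq_iff axis_def if_distrib cong: if_cong)
  ultimately show "smooth_on S f" by simp
qed

lemma smooth_on_vec_lambda [smooth_intros]:
  "open S \<Longrightarrow> (\<And>i. smooth_on S (\<lambda>x. f x i)) \<Longrightarrow> smooth_on S (\<lambda>x. \<chi> i. f x i)"
  by (subst smooth_on_vec_iff) auto

lemma smooth_on_matrix_vector_mult [smooth_intros]:
  fixes M :: "real^'k \<Rightarrow> real^'n^'m"
  shows "open S \<Longrightarrow> smooth_on S M \<Longrightarrow> smooth_on S v \<Longrightarrow> smooth_on S (\<lambda>x. M x *v v x)"
  unfolding matrix_vector_mult_def by (intro smooth_intros) auto

lemma smooth_on_compose:
  "open S \<Longrightarrow> open T \<Longrightarrow> f ` S \<subseteq> T \<Longrightarrow> smooth_on T g \<Longrightarrow> smooth_on S f \<Longrightarrow> smooth_on S (\<lambda>x. g (f x))"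
  unfolding smooth_on_def using Ck_on_compose by blast

lemma smooth_on_inverse [smooth_intros]:
  fixes f :: "real^'k \<Rightarrow> real"
  shows "open S \<Longrightarrow> (\<And>x. x \<in> S \<Longrightarrow> f x \<noteq> 0) \<Longrightarrow> smooth_on S f \<Longrightarrow> smooth_on S (\<lambda>x. inverse (f x))"
  by (simp add: smooth_on_def Ck_on_inverse)

lemma smooth_on_exp [smooth_intros]:
  fixes f :: "real^'k \<Rightarrow> real"
  shows "open S \<Longrightarrow> smooth_on S f \<Longrightarrow> smooth_on S (\<lambda>x. exp (f x))"
  by (simp add: smooth_on_def Ck_on_exp)

lemma smooth_on_prod [smooth_intros]:
  fixes f :: "'i \<Rightarrow> real^'k \<Rightarrow> real"
  shows "open S \<Longrightarrow> (\<And>i. i \<in> I \<Longrightarrow> smooth_on S (f i)) \<Longrightarrow> smooth_on S (\<lambda>x. \<Prod>i\<in>I. f i x)"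
  by (induction I rule: infinite_finite_induct) (auto intro!: smooth_intros)

lemma smooth_on_has_derivative:
  "smooth_on S f \<Longrightarrow> x \<in> S \<Longrightarrow> (f has_derivative frechet_derivative f (at x)) (at x)"
  unfolding smooth_on_def using Ck_on_has_derivative by blast

lemma smooth_on_differentiable: "smooth_on S f \<Longrightarrow> x \<in> S \<Longrightarrow> f differentiable (at x)"
  using smooth_on_has_derivative differentiableI by blast

lemma smooth_on_linear_derivative: "smooth_on S f \<Longrightarrow> x \<in> S \<Longrightarrow> linear (frechet_derivative f (at x))"
  using smooth_on_differentiable linear_frechet_derivative by blast

lemma smooth_on_continuous_on: "smooth_on S f \<Longrightarrow> continuous_on S f"
  unfolding smooth_on_def by (metis Ck_on.simps(1))

text \<open>\<open>Ck_on\<close> speaks only of the axis directions; linearity of the derivative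
  expands the field \<open>X\<close> in them. With constant \<open>X\<close>, repeated use covers
  iterated directional derivatives.\<close>

lemma smooth_on_derivative [smooth_intros]:
  assumes "open S" "smooth_on S f" "smooth_on S X"
  shows "smooth_on S (\<lambda>x. frechet_derivative f (at x) (X x))"
proof -
  have "smooth_on S (\<lambda>x. frechet_derivative f (at x) (axis i 1))" for i
    unfolding smooth_on_def
  proof
    fix r
    have "Ck_on (Suc r) S f" using assms(2) unfolding smooth_on_def by blast
    then show "Ck_on r S (\<lambda>x. frechet_derivative f (at x) (axis i 1))" by simp
  qed
  then have "smooth_on S (\<lambda>x. \<Sum>i\<in>UNIV. X x $ i *\<^sub>R frechet_derivative f (at x) (axis i 1))"
    using assms by (intro smooth_intros) auto
  then show ?thesis
    by (rule smooth_on_cong[OF assms(1), rotated])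
      (rule linear_eq_sum_axis[OF smooth_on_linear_derivative[OF assms(2)], symmetric])
qed

lemma smooth_on_det:
  fixes M :: "real^'k \<Rightarrow> real^'n^'n"
  shows "open S \<Longrightarrow> smooth_on S M \<Longrightarrow> smooth_on S (\<lambda>x. det (M x))"
  unfolding det_def by (intro smooth_intros) auto

lemma matrix_inv_mult:
  fixes M :: "real^'n^'n"
  assumes "invertible M"
  shows "M ** matrix_inv M = mat 1" "matrix_inv M ** M = mat 1"
  using someI_ex[OF assms[unfolded invertible_def]] unfolding matrix_inv_def by auto

text \<open>Cramer's rule makes the entries of the inverse rational in the entries of
  \<open>M\<close>, which gives smoothness of the inverse metric.\<close>

lemma matrix_inv_cramer:
  fixes M :: "real^'n^'n"
  assumes "invertible M"
  shows "matrix_inv M $ k $ l = det (\<chi> i j. if j = k then axis l 1 $ i else M $ i $ j) * inverse (det M)"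
proof -
  have "M *v (matrix_inv M *v axis l 1) = axis l 1"
    using assms by (simp add: matrix_vector_mul_assoc matrix_inv_mult(1))
  moreover have "det M \<noteq> 0" using assms by (simp add: invertible_det_nz)
  ultimately have "matrix_inv M *v axis l 1 = (\<chi> k. det(\<chi> i j. if j=k then axis l 1 $ i else M$i$j) / det M)"
    by (simp add: cramer)
  then have "(matrix_inv M *v axis l 1) $ k = det(\<chi> i j. if j=k then axis l 1 $ i else M$i$j) / det M"
    by simp
  then show ?thesis by (simp add: matrix_vector_mult_basis column_def divide_inverse)
qed

lemma smooth_on_matrix_inv [smooth_intros]:
  fixes M :: "real^'k \<Rightarrow> real^'n^'n"
  assumes "open S" "\<And>x. x \<in> S \<Longrightarrow> invertible (M x)" "smooth_on S M"
  shows "smooth_on S (\<lambda>x. matrix_inv (M x))"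
proof (subst smooth_on_vec_iff[OF assms(1)], intro allI, subst smooth_on_vec_iff[OF assms(1)], intro allI)
  fix k l
  have 1: "smooth_on S (\<lambda>x. \<chi> i j. if j = k then axis l 1 $ i else M x $ i $ j)"
    using assms
  proof (intro smooth_on_vec_lambda)
    show "smooth_on S (\<lambda>x. if j = k then axis l 1 $ i else M x $ i $ j)" for i j
      using assms by (cases "j = k") (auto intro!: smooth_intros)
  qed auto
  have "smooth_on S (\<lambda>x. det (\<chi> i j. if j = k then axis l 1 $ i else M x $ i $ j) * inverse (det (M x)))"
    by (intro smooth_intros smooth_on_det assms 1) (use assms(2) invertible_det_nz in auto)
  then show "smooth_on S (\<lambda>x. matrix_inv (M x) $ k $ l)"
    by (rule smooth_on_cong[OF assms(1), rotated]) (simp add: matrix_inv_cramer assms(2))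
qed

text \<open>The mean value theorem is applied to $s \mapsto f(x+sv+hw) - f(x+sv)$ and then in the
  direction of $w$.\<close>

lemma second_difference_mvt:
  fixes f :: "real^'k \<Rightarrow> real"
  assumes sm: "smooth_on S f" and op: "open S"
    and h: "h > 0" and sub: "\<And>s t. 0 \<le> s \<Longrightarrow> s \<le> h \<Longrightarrow> 0 \<le> t \<Longrightarrow> t \<le> h \<Longrightarrow> x + s *\<^sub>R v + t *\<^sub>R w \<in> S"
  shows "\<exists>s t. 0 < s \<and> s < h \<and> 0 < t \<and> t < h \<and>
    f (x + h *\<^sub>R v + h *\<^sub>R w) - f (x + h *\<^sub>R v) - f (x + h *\<^sub>R w) + f x =
    h * (h * frechet_derivative (\<lambda>y. frechet_derivative f (at y) v) (at (x + s *\<^sub>R v + t *\<^sub>R w)) w)"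
proof -
  define F where "F = (\<lambda>y. frechet_derivative f (at y) v)"
  have smF: "smooth_on S F" unfolding F_def by (intro smooth_intros op sm)
  have d1: "((\<lambda>s. f (x + s *\<^sub>R v + t *\<^sub>R w)) has_derivative (\<lambda>d. d * F (x + s *\<^sub>R v + t *\<^sub>R w))) (at s)"
    if "0 \<le> s" "s \<le> h" "0 \<le> t" "t \<le> h" for s t
  proof -
    have "((\<lambda>s. x + s *\<^sub>R v + t *\<^sub>R w) has_derivative (\<lambda>d. d *\<^sub>R v)) (at s)"
      by (auto intro!: derivative_eq_intros)
    from diff_chain_at[OF this smooth_on_has_derivative[OF sm sub[OF that]]]
    show ?thesis
      using linear_cmul[OF smooth_on_linear_derivative[OF sm sub[OF that]]]
      by (simp add: o_def F_def)
  qed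
  have d2: "((\<lambda>t. F (x + s *\<^sub>R v + t *\<^sub>R w)) has_derivative
      (\<lambda>d. d * frechet_derivative F (at (x + s *\<^sub>R v + t *\<^sub>R w)) w)) (at t)"
    if "0 \<le> s" "s \<le> h" "0 \<le> t" "t \<le> h" for s t
  proof -
    have "((\<lambda>t. x + s *\<^sub>R v + t *\<^sub>R w) has_derivative (\<lambda>d. d *\<^sub>R w)) (at t)"
      by (auto intro!: derivative_eq_intros)
    from diff_chain_at[OF this smooth_on_has_derivative[OF smF sub[OF that]]]
    show ?thesis
      using linear_cmul[OF smooth_on_linear_derivative[OF smF sub[OF that]]]
      by (simp add: o_def)
  qed
  \<comment> \<open>The vanishing summand with coefficient 0 is kept so that both terms are
    instances of \<open>d1\<close>, for \<open>t = h\<close> and \<open>t = 0\<close>.\<close>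
  let ?g = "\<lambda>s. f (x + s *\<^sub>R v + h *\<^sub>R w) - f (x + s *\<^sub>R v + 0 *\<^sub>R w)"
  have "\<exists>s\<in>{0<..<h}. ?g h - ?g 0 = (\<lambda>s d. d * (F (x + s *\<^sub>R v + h *\<^sub>R w) - F (x + s *\<^sub>R v + 0 *\<^sub>R w))) s (h - 0)"
  proof (rule mvt[OF h])
    show D: "(?g has_derivative (\<lambda>d. d * (F (x + s *\<^sub>R v + h *\<^sub>R w) - F (x + s *\<^sub>R v + 0 *\<^sub>R w)))) (at s)"
      if "0 < s" "s < h" for s
      using has_derivative_diff[OF d1[of s h] d1[of s 0]] that h by (simp add: right_diff_distrib)
    show "continuous_on {0..h} ?g"
    proof (rule continuous_at_imp_continuous_on, intro ballI)
      fix s assume "s \<in> {0..h}"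
      then show "isCont ?g s"
        using has_derivative_diff[OF d1[of s h] d1[of s 0]] h
        by (intro has_derivative_continuous) auto
    qed
  qed (rule bexI, assumption, simp)
  then obtain s where s: "0 < s" "s < h"
    "?g h - ?g 0 = h * (F (x + s *\<^sub>R v + h *\<^sub>R w) - F (x + s *\<^sub>R v + 0 *\<^sub>R w))" by auto
  have "\<exists>t\<in>{0<..<h}. F (x + s *\<^sub>R v + h *\<^sub>R w) - F (x + s *\<^sub>R v + 0 *\<^sub>R w) =
     (\<lambda>t d. d * frechet_derivative F (at (x + s *\<^sub>R v + t *\<^sub>R w)) w) t (h - 0)"
  proof (rule mvt[OF h])
    show "continuous_on {0..h} (\<lambda>t. F (x + s *\<^sub>R v + t *\<^sub>R w))"
    proof (rule continuous_at_imp_continuous_on, intro ballI)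
      fix t assume "t \<in> {0..h}"
      then show "isCont (\<lambda>t. F (x + s *\<^sub>R v + t *\<^sub>R w)) t"
        using d2[of s t] s(1,2) by (intro has_derivative_continuous) auto
    qed
    show "((\<lambda>t. F (x + s *\<^sub>R v + t *\<^sub>R w)) has_derivative
      (\<lambda>d. d * frechet_derivative F (at (x + s *\<^sub>R v + t *\<^sub>R w)) w)) (at t)" if "0 < t" "t < h" for t
      using d2[of s t] s(1,2) that by simp
  qed (rule bexI, assumption, simp)
  then obtain t where t: "0 < t" "t < h" "F (x + s *\<^sub>R v + h *\<^sub>R w) - F (x + s *\<^sub>R v + 0 *\<^sub>R w) =
     h * frechet_derivative F (at (x + s *\<^sub>R v + t *\<^sub>R w)) w" by auto
  show ?thesis
    using s t by (intro exI[of _ s] exI[of _ t]) (simp add: F_def)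
qed

text \<open>The second difference \<open>D\<close> is symmetric in \<open>v\<close> and
  \<open>w\<close>. By \<open>second_difference_mvt\<close> it equals h^2 times either mixed
  derivative, each at some point near \<open>x\<close>; continuity of both at \<open>x\<close>
  finishes as h tends to 0.\<close>

lemma second_derivative_symmetric_real:
  fixes f :: "real^'k \<Rightarrow> real"
  assumes sm: "smooth_on S f" and op: "open S" and x: "x \<in> S"
  shows "frechet_derivative (\<lambda>y. frechet_derivative f (at y) v) (at x) w =
         frechet_derivative (\<lambda>y. frechet_derivative f (at y) w) (at x) v"
proof -
  define H where "H = (\<lambda>v w y. frechet_derivative (\<lambda>y. frechet_derivative f (at y) v) (at y) w)"
  obtain e where e: "e > 0" "ball x e \<subseteq> S" using op x openE by blast
  \<comment> \<open>Parallelograms with steps below \<open>c\<close> stay in the ball of radius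
    \<open>e\<close>; the summand 1 guards against \<open>v = w = 0\<close>.\<close>
  define c where "c = e / (norm v + norm w + 1)"
  have c: "c > 0" unfolding c_def using e by (simp add: add_nonneg_pos)
  \<comment> \<open>Only the sum of the two norms is prescribed, so that the fact serves both orders
    of \<open>v\<close> and \<open>w\<close>.\<close>
  have sub: "x + s *\<^sub>R v' + t *\<^sub>R w' \<in> S"
    if "0 \<le> s" "s < c" "0 \<le> t" "t < c" "norm v' + norm w' = norm v + norm w" for s t v' w'
  proof -
    have "norm (s *\<^sub>R v' + t *\<^sub>R w') \<le> s * norm v' + t * norm w'"
      using that norm_triangle_ineq[of "s *\<^sub>R v'" "t *\<^sub>R w'"] by simp
    also have "\<dots> \<le> c * norm v' + c * norm w'"
      using that by (intro add_mono mult_right_mono) auto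
    also have "\<dots> = c * (norm v + norm w)"
      using that by (simp add: distrib_left[symmetric])
    also have "\<dots> < c * (norm v + norm w + 1)" using c by simp
    also have "\<dots> = e" unfolding c_def by (simp add: add_nonneg_pos less_imp_neq[symmetric])
    finally have "dist (x + (s *\<^sub>R v' + t *\<^sub>R w')) x < e" by (simp add: dist_norm)
    then show ?thesis using e(2) by (auto simp: add.assoc dist_commute)
  qed
  have cont: "isCont (H v w) x" for v w
    unfolding H_def
    by (rule continuous_on_interior[of S])
      (use op x in \<open>auto intro!: smooth_on_continuous_on smooth_intros sm simp: interior_open\<close>)
  \<comment> \<open>The shift by 2 keeps \<open>h n\<close> strictly below \<open>c\<close> already
    for \<open>n = 0\<close>.\<close>
  define h where "h = (\<lambda>n. c / real (n + 2))"
  have h: "h n > 0" "h n < c" for n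
    unfolding h_def using c by (simp_all add: divide_simps)
  have h0: "h \<longlonglongrightarrow> 0"
    unfolding h_def
    using LIMSEQ_ignore_initial_segment[OF lim_const_over_n[of c], of 2] by simp
  define D where "D = (\<lambda>h. f (x + h *\<^sub>R v + h *\<^sub>R w) - f (x + h *\<^sub>R v) - f (x + h *\<^sub>R w) + f x)"
  have "\<exists>s t. 0 < s \<and> s < h n \<and> 0 < t \<and> t < h n \<and> D (h n) = h n * (h n * H v w (x + s *\<^sub>R v + t *\<^sub>R w))" for n
    unfolding D_def H_def
    by (rule second_difference_mvt[OF sm op h(1)]) (use h(2) in \<open>auto intro!: sub intro: order.strict_trans1\<close>)
  then obtain s t where st: "\<And>n. 0 < s n \<and> s n < h n \<and> 0 < t n \<and> t n < h n \<and>
      D (h n) = h n * (h n * H v w (x + s n *\<^sub>R v + t n *\<^sub>R w))" by metis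
  have "\<exists>s t. 0 < s \<and> s < h n \<and> 0 < t \<and> t < h n \<and>
      D (h n) = h n * (h n * H w v (x + s *\<^sub>R w + t *\<^sub>R v))" for n
  proof -
    have "\<exists>s t. 0 < s \<and> s < h n \<and> 0 < t \<and> t < h n \<and>
      f (x + h n *\<^sub>R w + h n *\<^sub>R v) - f (x + h n *\<^sub>R w) - f (x + h n *\<^sub>R v) + f x
       = h n * (h n * H w v (x + s *\<^sub>R w + t *\<^sub>R v))"
      unfolding H_def
      by (rule second_difference_mvt[OF sm op h(1)]) (use h(2) in \<open>auto intro!: sub intro: order.strict_trans1\<close>)
    moreover have "f (x + h n *\<^sub>R w + h n *\<^sub>R v) - f (x + h n *\<^sub>R w) - f (x + h n *\<^sub>R v) + f x = D (h n)"
      unfolding D_def by (simp add: add.commute add.left_commute)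
    ultimately show ?thesis by simp
  qed
  then obtain s' t' where st': "\<And>n. 0 < s' n \<and> s' n < h n \<and> 0 < t' n \<and> t' n < h n \<and>
      D (h n) = h n * (h n * H w v (x + s' n *\<^sub>R w + t' n *\<^sub>R v))" by metis
  have lim0: "u \<longlonglongrightarrow> 0" if "\<And>n. 0 < u n \<and> u n < h n" for u
    by (rule tendsto_sandwich[OF _ _ tendsto_const h0]) (use that in \<open>auto intro!: always_eventually less_imp_le\<close>)
  have lim: "(\<lambda>n. x + u n *\<^sub>R a + u' n *\<^sub>R b) \<longlonglongrightarrow> x" if "u \<longlonglongrightarrow> 0" "u' \<longlonglongrightarrow> 0" for u u' a b
    using that by (auto intro!: tendsto_eq_intros)
  have "(\<lambda>n. H v w (x + s n *\<^sub>R v + t n *\<^sub>R w)) \<longlonglongrightarrow> H v w x"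
    using st by (intro isCont_tendsto_compose[OF cont] lim lim0) blast+
  moreover have "(\<lambda>n. H w v (x + s' n *\<^sub>R w + t' n *\<^sub>R v)) \<longlonglongrightarrow> H w v x"
    using st' by (intro isCont_tendsto_compose[OF cont] lim lim0) blast+
  moreover have "H v w (x + s n *\<^sub>R v + t n *\<^sub>R w) = H w v (x + s' n *\<^sub>R w + t' n *\<^sub>R v)" for n
    using st[of n] st'[of n] h(1)[of n] by simp
  ultimately show ?thesis unfolding H_def using LIMSEQ_unique by simp
qed

lemma frechet_derivative_bounded_linear:
  "bounded_linear L \<Longrightarrow> f differentiable (at x) \<Longrightarrow>
   frechet_derivative (\<lambda>y. L (f y)) (at x) v = L (frechet_derivative f (at x) v)"
  by (metis bounded_linear.has_derivative frechet_derivative_at frechet_derivative_works)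

text \<open>Reduces to the scalar case by pairing with basis vectors. The vector-valued form is
  needed for vector fields and for coordinate changes.\<close>

lemma second_derivative_symmetric:
  fixes f :: "real^'k \<Rightarrow> 'b::euclidean_space"
  assumes sm: "smooth_on S f" and op: "open S" and x: "x \<in> S"
  shows "frechet_derivative (\<lambda>y. frechet_derivative f (at y) v) (at x) w =
         frechet_derivative (\<lambda>y. frechet_derivative f (at y) w) (at x) v"
proof (rule euclidean_eqI)
  fix b :: 'b
  have bl: "bounded_linear (\<lambda>z. z \<bullet> b)" by (rule bounded_linear_inner_left)
  have smb: "smooth_on S (\<lambda>y. f y \<bullet> b)" by (intro smooth_intros op sm)
  have "frechet_derivative (\<lambda>y. frechet_derivative f (at y) v) (at x) w \<bullet> b =
        frechet_derivative (\<lambda>y. frechet_derivative (\<lambda>y. f y \<bullet> b) (at y) v) (at x) w" for v w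
  proof -
    have "frechet_derivative (\<lambda>y. frechet_derivative f (at y) v \<bullet> b) (at x) =
       frechet_derivative (\<lambda>y. frechet_derivative (\<lambda>y. f y \<bullet> b) (at y) v) (at x)"
    proof (rule frechet_derivative_transform_within_open[OF _ op x])
      show "(\<lambda>y. frechet_derivative f (at y) v \<bullet> b) differentiable at x"
        by (rule smooth_on_differentiable[OF _ x]) (intro smooth_intros op sm)
      show "frechet_derivative f (at y) v \<bullet> b = frechet_derivative (\<lambda>y. f y \<bullet> b) (at y) v" if "y \<in> S" for y
        using frechet_derivative_bounded_linear[OF bl smooth_on_differentiable[OF sm that]] by simp
    qed
    moreover have "(\<lambda>y. frechet_derivative f (at y) v) differentiable at x"
      by (rule smooth_on_differentiable[OF _ x]) (intro smooth_intros op sm)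
    ultimately show ?thesis using frechet_derivative_bounded_linear[OF bl] by metis
  qed
  then show "frechet_derivative (\<lambda>y. frechet_derivative f (at y) v) (at x) w \<bullet> b =
         frechet_derivative (\<lambda>y. frechet_derivative f (at y) w) (at x) v \<bullet> b"
    using second_derivative_symmetric_real[OF smb op x, of v w] by simp
qed

section \<open>Local Riemannian geometry\<close>

abbreviation Der :: "('a::real_normed_vector \<Rightarrow> 'b::real_normed_vector) \<Rightarrow> 'a \<Rightarrow> 'a \<Rightarrow> 'b" where
  "Der f x v \<equiv> frechet_derivative f (at x) v"

lemma Der_eqI: "(f has_derivative f') (at x) \<Longrightarrow> Der f x v = f' v"
  by (metis frechet_derivative_at)

lemma Der_add:
  "f differentiable (at x) \<Longrightarrow> g differentiable (at x) \<Longrightarrow> Der (\<lambda>y. f y + g y) x v = Der f x v + Der g x v"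
  by (rule Der_eqI) (auto intro!: derivative_intros simp: frechet_derivative_works)

lemma Der_sum:
  "(\<And>i. i \<in> I \<Longrightarrow> f i differentiable (at x)) \<Longrightarrow> Der (\<lambda>y. \<Sum>i\<in>I. f i y) x v = (\<Sum>i\<in>I. Der (f i) x v)"
  by (rule Der_eqI) (auto intro!: has_derivative_sum simp: frechet_derivative_works)

lemma Der_bilinear:
  "bounded_bilinear B \<Longrightarrow> f differentiable (at x) \<Longrightarrow> g differentiable (at x) \<Longrightarrow>
   Der (\<lambda>y. B (f y) (g y)) x v = B (f x) (Der g x v) + B (Der f x v) (g x)"
  by (rule Der_eqI) (auto intro: bounded_bilinear.FDERIV simp: frechet_derivative_works)

lemmas Der_scaleR = Der_bilinear[OF bounded_bilinear_scaleR]
lemmas Der_inner = Der_bilinear[OF bounded_bilinear_inner]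
lemmas Der_nth = frechet_derivative_bounded_linear[OF bounded_linear_vec_nth]

lemma Der_compose:
  "f differentiable (at x) \<Longrightarrow> g differentiable (at (f x)) \<Longrightarrow> Der (\<lambda>y. g (f y)) x v = Der g (f x) (Der f x v)"
  using frechet_derivative_compose[of f x g] by (simp add: o_def fun_eq_iff)

text \<open>Holds without differentiability: if \<open>f\<close> has no derivative at
  \<open>x\<close>, the choice behind \<open>frechet_derivative\<close> is still made from the same
  candidates for \<open>f\<close> and \<open>g\<close>.\<close>

lemma Der_cong_open:
  assumes "open S" "x \<in> S" "\<And>y. y \<in> S \<Longrightarrow> f y = g y"
  shows "Der f x v = Der g x v"
proof (cases "f differentiable (at x)")
  case True
  then show ?thesis using frechet_derivative_transform_within_open[of f x S g] assms by simp
next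
  case False
  have "(f has_derivative f') (at x) \<longleftrightarrow> (g has_derivative f') (at x)" for f'
    using has_derivative_transform_within_open[of f f' x UNIV S g]
      has_derivative_transform_within_open[of g f' x UNIV S f] assms by auto
  then show ?thesis by (simp add: frechet_derivative_def)
qed

lemma bounded_bilinear_matrix_vector_mult:
  "bounded_bilinear (\<lambda>(M::real^'n^'m) v. M *v v)"
proof -
  have "bilinear (\<lambda>(M::real^'n^'m) v. M *v v)"
    by (auto simp: bilinear_def linear_iff matrix_vector_right_distrib matrix_vector_mult_add_rdistrib
      matrix_vector_mult_scaleR scaleR_matrix_vector_assoc)
  then show ?thesis by (simp add: bilinear_conv_bounded_bilinear)
qed

lemmas Der_matrix_vector_mult = Der_bilinear[OF bounded_bilinear_matrix_vector_mult]

lemma bilinear_eq_sum_axis: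
  fixes B :: "real^'k \<Rightarrow> real^'l \<Rightarrow> 'b::real_vector"
  assumes "bilinear B"
  shows "B u v = (\<Sum>i\<in>UNIV. \<Sum>j\<in>UNIV. (u $ i * v $ j) *\<^sub>R B (axis i 1) (axis j 1))"
proof -
  have "B u v = (\<Sum>i\<in>UNIV. u $ i *\<^sub>R B (axis i 1) v)"
    by (rule linear_eq_sum_axis[of "\<lambda>u. B u v"]) (use assms in \<open>simp add: bilinear_def\<close>)
  also have "\<dots> = (\<Sum>i\<in>UNIV. u $ i *\<^sub>R (\<Sum>j\<in>UNIV. v $ j *\<^sub>R B (axis i 1) (axis j 1)))"
    by (intro sum.cong refl arg_cong[where f = "scaleR _"] linear_eq_sum_axis)
      (use assms in \<open>simp add: bilinear_def\<close>)
  finally show ?thesis by (simp add: scaleR_sum_right)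
qed

text \<open>A product rule for a linear map that depends on a point. Smoothness is asked only of
  \<open>L z w\<close> for fixed \<open>w\<close>, so no topology on spaces of linear maps enters;
  expanding \<open>A\<close> along the axes reduces everything to such terms. The instances are the
  Christoffel form, the covariant derivative and the differential of a function.\<close>

lemma Der_linear_family:
  fixes f :: "real^'p \<Rightarrow> real^'q" and A :: "real^'p \<Rightarrow> real^'l"
    and L :: "real^'q \<Rightarrow> real^'l \<Rightarrow> 'b::real_normed_vector"
  assumes U: "open U" and V: "open V" and f: "smooth_on U f" "f ` U \<subseteq> V" and A: "smooth_on U A"
    and x: "x \<in> U" and lin: "\<And>z. z \<in> V \<Longrightarrow> linear (L z)" and L: "\<And>w. smooth_on V (\<lambda>z. L z w)"
  shows "Der (\<lambda>y. L (f y) (A y)) x u = Der (\<lambda>z. L z (A x)) (f x) (Der f x u) + L (f x) (Der A x u)"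
proof -
  have fx: "f x \<in> V" using f x by auto
  have dL: "(\<lambda>z. L z w) differentiable (at (f x))" for w
    by (rule smooth_on_differentiable[OF L fx])
  have df: "f differentiable (at x)" "A differentiable (at x)"
    using smooth_on_differentiable f A x by blast+
  have dA: "(\<lambda>y. A y $ k) differentiable (at x)" for k
    by (rule smooth_on_differentiable[OF _ x]) (intro smooth_intros U A)
  have dLf: "(\<lambda>y. L (f y) w) differentiable (at x)" for w
    by (rule smooth_on_differentiable[OF smooth_on_compose[OF U V f(2) L f(1)] x])
  have dp: "(\<lambda>y. A y $ k *\<^sub>R L (f y) (axis k 1)) differentiable (at x)" for k
    by (rule smooth_on_differentiable[OF _ x]) (intro smooth_intros U A smooth_on_compose[OF U V f(2) L f(1)])
  have "Der (\<lambda>y. L (f y) (A y)) x u = Der (\<lambda>y. \<Sum>k\<in>UNIV. A y $ k *\<^sub>R L (f y) (axis k 1)) x u"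
    by (rule Der_cong_open[OF U x], rule linear_eq_sum_axis, rule lin) (use f in auto)
  also have "\<dots> = (\<Sum>k\<in>UNIV. A x $ k *\<^sub>R Der (\<lambda>y. L (f y) (axis k 1)) x u)
      + (\<Sum>k\<in>UNIV. Der A x u $ k *\<^sub>R L (f x) (axis k 1))"
    by (simp add: Der_sum dp Der_scaleR dA dLf Der_nth[OF df(2)] sum.distrib)
  also have "(\<Sum>k\<in>UNIV. A x $ k *\<^sub>R Der (\<lambda>y. L (f y) (axis k 1)) x u) =
      Der (\<lambda>z. \<Sum>k\<in>UNIV. A x $ k *\<^sub>R L z (axis k 1)) (f x) (Der f x u)"
    by (simp add: Der_sum Der_scaleR dL Der_compose[OF df(1) dL])
  also have "\<dots> = Der (\<lambda>z. L z (A x)) (f x) (Der f x u)"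
    by (rule Der_cong_open[OF V fx], rule linear_eq_sum_axis[symmetric], rule lin)
  finally show ?thesis by (simp add: linear_eq_sum_axis[OF lin[OF fx], symmetric])
qed

lemma smooth_on_divide_const [smooth_intros]:
  fixes f :: "real^'k \<Rightarrow> real"
  shows "open S \<Longrightarrow> smooth_on S f \<Longrightarrow> smooth_on S (\<lambda>x. f x / c)"
  unfolding divide_inverse by (intro smooth_intros)

section \<open>Metric, trace and covariant derivative at a point\<close>

definition ip :: "'k::finite metric \<Rightarrow> real^'k \<Rightarrow> real^'k \<Rightarrow> real^'k \<Rightarrow> real" where
  "ip G x u v = u \<bullet> (G x *v v)"

text \<open>The pointwise form of \<open>loc_trace\<close>: it takes a form on vectors instead of an
  operator on fields, so that bilinear algebra applies directly.\<close>

definition mtr :: "'k::finite metric \<Rightarrow> real^'k \<Rightarrow> (real^'k \<Rightarrow> real^'k \<Rightarrow> 'b::real_vector) \<Rightarrow> 'b" where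
  "mtr G x B = (\<Sum>i\<in>UNIV. \<Sum>j\<in>UNIV. (matrix_inv (G x) $ i $ j) *\<^sub>R B (axis i 1) (axis j 1))"

lemma loc_trace_eq_mtr: "loc_trace G T x = mtr G x (\<lambda>u v. T (\<lambda>_. u) (\<lambda>_. v) x)"
  by (simp add: loc_trace_def mtr_def)

lemma bilinear_ip: "bilinear (ip G x)"
  by (auto simp: bilinear_def linear_iff ip_def matrix_vector_right_distrib inner_add_left
    inner_add_right matrix_vector_mult_scaleR)

lemmas ip_simps = bilinear_ladd[OF bilinear_ip] bilinear_radd[OF bilinear_ip]
  bilinear_lsub[OF bilinear_ip] bilinear_rsub[OF bilinear_ip] bilinear_lmul[OF bilinear_ip]
  bilinear_rmul[OF bilinear_ip] bilinear_lneg[OF bilinear_ip] bilinear_rneg[OF bilinear_ip]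

lemma bilinear_christoffel_form: "bilinear (christoffel_form G x)"
  by (auto simp: bilinear_def linear_iff christoffel_form_def vec_eq_iff sum.distrib[symmetric]
    sum_distrib_left algebra_simps)

lemmas christoffel_form_simps = bilinear_ladd[OF bilinear_christoffel_form]
  bilinear_radd[OF bilinear_christoffel_form] bilinear_lsub[OF bilinear_christoffel_form]
  bilinear_rsub[OF bilinear_christoffel_form] bilinear_lmul[OF bilinear_christoffel_form]
  bilinear_rmul[OF bilinear_christoffel_form] bilinear_lneg[OF bilinear_christoffel_form]
  bilinear_rneg[OF bilinear_christoffel_form] bilinear_lzero[OF bilinear_christoffel_form]
  bilinear_rzero[OF bilinear_christoffel_form]

lemma mtr_add: "mtr G x (\<lambda>u v. B u v + C u v) = mtr G x B + mtr G x C"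
  by (simp add: mtr_def scaleR_add_right sum.distrib)

lemma mtr_sum: "mtr G x (\<lambda>u v. \<Sum>i\<in>I. B i u v) = (\<Sum>i\<in>I. mtr G x (B i))"
  by (induction I rule: infinite_finite_induct) (simp_all add: mtr_add, simp_all add: mtr_def)

lemma mtr_linear: "linear L \<Longrightarrow> L (mtr G x B) = mtr G x (\<lambda>u v. L (B u v))"
  by (simp add: mtr_def linear_sum linear_scale)

text \<open>Unlike in \<open>loc_nabla\<close>, the direction is a vector and comes last, so that
  \<open>cov G X x\<close> is the endomorphism \<nabla>X of the tangent space at
  \<open>x\<close>.\<close>

definition cov :: "'k::finite metric \<Rightarrow> 'k vfield \<Rightarrow> real^'k \<Rightarrow> real^'k \<Rightarrow> real^'k" where
  "cov G X x u = Der X x u + christoffel_form G x u (X x)"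

text \<open>The second covariant derivative $\nabla^2_{u,v} X$.\<close>

definition cov2 :: "'k::finite metric \<Rightarrow> 'k vfield \<Rightarrow> real^'k \<Rightarrow> real^'k \<Rightarrow> real^'k \<Rightarrow> real^'k" where
  "cov2 G X x u v = cov G (\<lambda>y. cov G X y v) x u - cov G X x (christoffel_form G x u v)"

lemma loc_nabla_eq_cov: "loc_nabla G X Y x = cov G Y x (X x)"
  by (simp add: loc_nabla_def cov_def)

text \<open>Constant fields commute, so the bracket term vanishes, and the covariant derivative of
  one along another is just the Christoffel form.\<close>

lemma loc_curv_at_eq:
  "loc_curv_at G x u v w =
   cov G (\<lambda>y. christoffel_form G y v w) x u - cov G (\<lambda>y. christoffel_form G y u w) x v"
proof -
  have "loc_nabla G (\<lambda>_. a) (\<lambda>_. b) = (\<lambda>y. christoffel_form G y a b)" for a b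
    by (simp add: loc_nabla_def fun_eq_iff)
  then show ?thesis
    by (simp add: loc_curv_at_def loc_curv_def loc_nabla_eq_cov loc_bracket_def)
      (simp add: cov_def christoffel_form_simps)
qed

text \<open>Used in \<open>bochner\<close>, where the trace of a commutator with a Christoffel
  endomorphism has to vanish.\<close>

lemma trace_commute:
  fixes L M :: "real^'n \<Rightarrow> real^'n"
  assumes "linear L" "linear M"
  shows "(\<Sum>k\<in>UNIV. L (M (axis k 1)) $ k) = (\<Sum>k\<in>UNIV. M (L (axis k 1)) $ k)"
proof -
  have e: "L (M (axis k 1)) $ k = (\<Sum>j\<in>UNIV. M (axis k 1) $ j * L (axis j 1) $ k)"
    "M (L (axis k 1)) $ k = (\<Sum>j\<in>UNIV. L (axis k 1) $ j * M (axis j 1) $ k)" for k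
    by (simp_all add: linear_eq_sum_axis[OF assms(1), of "M (axis k 1)"] linear_eq_sum_axis[OF assms(2), of "L (axis k 1)"])
  show ?thesis unfolding e by (subst sum.swap) (simp add: mult.commute)
qed

text \<open>A metric is recorded by symmetry and invertibility, the form in which it is used:
  vectors are identified by their inner products, and indices are raised by the inverse
  matrix.\<close>

locale local_metric =
  fixes S :: "(real^'k) set" and G :: "'k::finite metric"
  assumes op: "open S" and smooth_G: "smooth_on S G"
    and sym_G: "x \<in> S \<Longrightarrow> transpose (G x) = G x"
    and inv_G: "x \<in> S \<Longrightarrow> invertible (G x)"
begin

abbreviation \<Gamma> where "\<Gamma> \<equiv> christoffel_form G"
abbreviation R where "R \<equiv> loc_curv_at G"
abbreviation dG where "dG x u v w \<equiv> v \<bullet> (Der G x u *v w)"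

lemma diff_G: "x \<in> S \<Longrightarrow> G differentiable (at x)"
  using smooth_G smooth_on_differentiable by blast

lemma ip_sym: "x \<in> S \<Longrightarrow> ip G x u v = ip G x v u"
  unfolding ip_def by (metis dot_lmul_matrix inner_commute sym_G transpose_matrix_vector)

lemma ip_nondegenerate:
  assumes "x \<in> S" "\<And>w. ip G x u w = ip G x v w"
  shows "u = v"
proof -
  have "(u - v) \<bullet> (G x *v (matrix_inv (G x) *v (u - v))) = 0"
    using assms(2) by (simp add: ip_def inner_diff_left)
  then have "(u - v) \<bullet> (u - v) = 0"
    by (simp add: matrix_vector_mul_assoc matrix_inv_mult inv_G assms(1))
  then show ?thesis by simp
qed

lemma ip_matrix_inv: "x \<in> S \<Longrightarrow> ip G x w (matrix_inv (G x) *v v) = w \<bullet> v"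
  by (simp add: ip_def matrix_vector_mul_assoc matrix_inv_mult inv_G)

lemma smooth_on_ip [smooth_intros]:
  "smooth_on S X \<Longrightarrow> smooth_on S Y \<Longrightarrow> smooth_on S (\<lambda>x. ip G x (X x) (Y x))"
  unfolding ip_def by (intro smooth_intros op smooth_G)

lemma dG_sym: "x \<in> S \<Longrightarrow> dG x u v w = dG x u w v"
proof -
  assume x: "x \<in> S"
  have "bounded_linear (transpose :: real^'k^'k \<Rightarrow> _)"
    by (rule linear_conv_bounded_linear[THEN iffD1]) (auto simp: linear_iff transpose_def vec_eq_iff)
  then have "Der (\<lambda>y. transpose (G y)) x u = transpose (Der G x u)"
    using frechet_derivative_bounded_linear diff_G x by blast
  moreover have "Der (\<lambda>y. transpose (G y)) x u = Der G x u"
    by (rule Der_cong_open[OF op x]) (simp add: sym_G)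
  ultimately have "transpose (Der G x u) = Der G x u" by simp
  then show ?thesis by (metis dot_lmul_matrix inner_commute transpose_matrix_vector)
qed

lemma Der_G_entry: "x \<in> S \<Longrightarrow> Der (\<lambda>y. G y $ i $ j) x u = dG x u (axis i 1) (axis j 1)"
proof -
  assume x: "x \<in> S"
  have "Der (\<lambda>y. G y $ i $ j) x u = Der G x u $ i $ j"
    using frechet_derivative_bounded_linear[OF
        bounded_linear_compose[OF bounded_linear_vec_nth bounded_linear_vec_nth] diff_G[OF x]] .
  also have "\<dots> = dG x u (axis i 1) (axis j 1)"
    by (simp add: inner_axis' matrix_vector_mult_basis column_def)
  finally show ?thesis .
qed

lemma linear_Der_G: "x \<in> S \<Longrightarrow> linear (Der G x)"
  using smooth_G smooth_on_linear_derivative by blast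

lemma dG_linear:
  assumes x: "x \<in> S"
  shows "linear (\<lambda>u. dG x u v w)" "linear (\<lambda>v. dG x u v w)" "linear (\<lambda>w. dG x u v w)"
  using linear_add[OF linear_Der_G[OF x]] linear_scale[OF linear_Der_G[OF x]]
  by (auto simp: linear_iff inner_add_left inner_add_right matrix_vector_mult_add_rdistrib
    matrix_vector_right_distrib matrix_vector_mult_scaleR scaleR_matrix_vector_assoc[symmetric])

text \<open>Replaces the index sum of \<open>christoffel\<close> by an identity for arbitrary
  vectors. From here on only the smoothness of \<open>\<Gamma>\<close> goes back to the index
  formula.\<close>

lemma koszul:
  assumes x: "x \<in> S"
  shows "2 * ip G x (\<Gamma> x u v) w = dG x u v w + dG x v u w - dG x w u v"
proof -
  \<comment> \<open>\<open>K u v\<close> is half of the Koszul expression as a covector in the third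
    argument; \<open>B\<close> raises its index. Both are bilinear, so it suffices that
    \<open>B\<close> has the Christoffel symbols as its values on the axes.\<close>
  define K where "K = (\<lambda>u v. \<chi> l. (dG x u v (axis l 1) + dG x v u (axis l 1) - dG x (axis l 1) u v) / 2)"
  define B where "B = (\<lambda>u v. matrix_inv (G x) *v K u v)"
  have "bilinear K"
    using linear_add[OF dG_linear(1)[OF x]] linear_add[OF dG_linear(2)[OF x]] linear_add[OF dG_linear(3)[OF x]]
      linear_scale[OF dG_linear(1)[OF x]] linear_scale[OF dG_linear(2)[OF x]] linear_scale[OF dG_linear(3)[OF x]]
    by (auto simp: bilinear_def linear_iff K_def vec_eq_iff add_divide_distrib diff_divide_distrib algebra_simps)
  then have "bilinear B"
    unfolding B_def by (auto simp: bilinear_def linear_iff matrix_vector_right_distrib matrix_vector_mult_scaleR)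
  have "christoffel G x k i j = B (axis i 1) (axis j 1) $ k" for k i j
    unfolding christoffel_def B_def K_def using x
    by (simp add: Der_G_entry matrix_vector_mult_def sum_divide_distrib)
  then have "\<Gamma> x u v = (\<Sum>i\<in>UNIV. \<Sum>j\<in>UNIV. (u $ i * v $ j) *\<^sub>R B (axis i 1) (axis j 1))"
    by (simp add: christoffel_form_def vec_eq_iff mult_ac)
  then have "\<Gamma> x u v = B u v"
    using bilinear_eq_sum_axis[OF \<open>bilinear B\<close>, of u v] by simp
  then have "ip G x (\<Gamma> x u v) w = w \<bullet> K u v"
    using ip_matrix_inv[OF x] ip_sym[OF x] by (simp add: B_def)
  also have "\<dots> = (\<Sum>l\<in>UNIV. w $ l * ((dG x u v (axis l 1) + dG x v u (axis l 1) - dG x (axis l 1) u v) / 2))"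
    by (simp add: K_def inner_vec_def)
  finally have "2 * ip G x (\<Gamma> x u v) w =
      (\<Sum>l\<in>UNIV. w $ l *\<^sub>R dG x u v (axis l 1)) + (\<Sum>l\<in>UNIV. w $ l *\<^sub>R dG x v u (axis l 1))
       - (\<Sum>l\<in>UNIV. w $ l *\<^sub>R dG x (axis l 1) u v)"
    by (simp add: sum_distrib_left sum.distrib[symmetric] sum_subtractf[symmetric] sum_divide_distrib algebra_simps add_divide_distrib diff_divide_distrib)
  also have "\<dots> = dG x u v w + dG x v u w - dG x w u v"
    using linear_eq_sum_axis[OF dG_linear(3)[OF x], of u v w]
      linear_eq_sum_axis[OF dG_linear(3)[OF x], of v u w]
      linear_eq_sum_axis[OF dG_linear(1)[OF x], of u w v] by presburger
  finally show ?thesis .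
qed

lemma \<Gamma>_sym: "x \<in> S \<Longrightarrow> \<Gamma> x u v = \<Gamma> x v u"
proof (rule ip_nondegenerate)
  assume "x \<in> S"
  then show "ip G x (\<Gamma> x u v) w = ip G x (\<Gamma> x v u) w" for w
    using koszul[of x u v w] koszul[of x v u w] dG_sym[of x u w v] by simp
qed

lemma smooth_on_\<Gamma> [smooth_intros]:
  assumes "smooth_on S X" "smooth_on S Y"
  shows "smooth_on S (\<lambda>x. \<Gamma> x (X x) (Y x))"
  unfolding christoffel_form_def christoffel_def
  by (intro smooth_intros op smooth_G assms inv_G)

lemma smooth_on_cov [smooth_intros]:
  "smooth_on S X \<Longrightarrow> smooth_on S Y \<Longrightarrow> smooth_on S (\<lambda>x. cov G X x (Y x))"
  unfolding cov_def by (intro smooth_intros op)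

lemma linear_cov: "smooth_on S X \<Longrightarrow> x \<in> S \<Longrightarrow> linear (cov G X x)"
  using linear_add[OF smooth_on_linear_derivative] linear_scale[OF smooth_on_linear_derivative]
  by (auto simp: linear_iff cov_def christoffel_form_simps scaleR_add_right)

lemma metric_compat:
  assumes "smooth_on S X" "smooth_on S Y" and x: "x \<in> S"
  shows "Der (\<lambda>y. ip G y (X y) (Y y)) x u = ip G x (cov G X x u) (Y x) + ip G x (X x) (cov G Y x u)"
proof -
  have d: "X differentiable (at x)" "Y differentiable (at x)"
    using assms smooth_on_differentiable by blast+
  have "(\<lambda>y. G y *v Y y) differentiable (at x)"
    by (rule smooth_on_differentiable[OF _ x]) (intro smooth_intros op smooth_G assms)
  then have "Der (\<lambda>y. ip G y (X y) (Y y)) x u =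
      X x \<bullet> (G x *v Der Y x u + Der G x u *v Y x) + Der X x u \<bullet> (G x *v Y x)"
    unfolding ip_def using d x by (simp add: Der_inner Der_matrix_vector_mult diff_G)
  also have "\<dots> = dG x u (X x) (Y x) + ip G x (Der X x u) (Y x) + ip G x (X x) (Der Y x u)"
    by (simp add: ip_def inner_add_right)
  \<comment> \<open>In the sum of the Koszul identities for \<open>\<Gamma> x u (X x)\<close>
    against \<open>Y x\<close> and \<open>\<Gamma> x u (Y x)\<close> against \<open>X x\<close>, the
    derivatives of the metric along \<open>X x\<close> and \<open>Y x\<close> cancel.\<close>
  also have "dG x u (X x) (Y x) = ip G x (\<Gamma> x u (X x)) (Y x) + ip G x (X x) (\<Gamma> x u (Y x))"
    using koszul[OF x, of u "X x" "Y x"] koszul[OF x, of u "Y x" "X x"] ip_sym[OF x, of "X x" "\<Gamma> x u (Y x)"]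
      dG_sym[OF x, of u "X x" "Y x"] dG_sym[OF x, of "X x" u "Y x"] dG_sym[OF x, of "Y x" u "X x"]
    by linarith
  finally show ?thesis by (simp add: cov_def ip_simps)
qed

lemma Der_\<Gamma>:
  assumes X: "smooth_on S X" and x: "x \<in> S"
  shows "Der (\<lambda>y. \<Gamma> y v (X y)) x u = Der (\<lambda>y. \<Gamma> y v (X x)) x u + \<Gamma> x v (Der X x u)"
proof -
  have "linear (\<Gamma> z v)" for z
    using bilinear_christoffel_form[of G z] by (simp add: bilinear_def)
  moreover have "smooth_on S (\<lambda>z. \<Gamma> z v w)" for w by (intro smooth_intros)
  ultimately show ?thesis
    using Der_linear_family[OF op op smooth_on_ident[OF op] _ X x, of "\<lambda>z. \<Gamma> z v"] by simp
qed

text \<open>After expansion, the second derivatives of \<open>X\<close>, the mixed terms in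
  \<open>\<Gamma>\<close> and the first derivative of \<open>X\<close>, and the term along
  \<open>\<Gamma> x u v\<close> are symmetric in \<open>u\<close> and \<open>v\<close> and drop out.
  What is left involves only the value \<open>X x\<close> and is the curvature computed with
  constant fields.\<close>

lemma ricci_identity:
  assumes X: "smooth_on S X" and x: "x \<in> S"
  shows "cov2 G X x u v - cov2 G X x v u = R x u v (X x)"
proof -
  have dD: "(\<lambda>y. Der X y v) differentiable (at x)" for v
    by (rule smooth_on_differentiable[OF _ x]) (intro smooth_intros op X)
  have dk: "(\<lambda>y. \<Gamma> y v (X y)) differentiable (at x)" for v
    by (rule smooth_on_differentiable[OF _ x]) (intro smooth_intros X)
  have D: "Der (\<lambda>y. cov G X y v) x u = Der (\<lambda>y. Der X y v) x u + Der (\<lambda>y. \<Gamma> y v (X x)) x u + \<Gamma> x v (Der X x u)"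
    for u v
    unfolding cov_def by (simp add: Der_add dD dk Der_\<Gamma>[OF X x])
  show ?thesis
    unfolding cov2_def loc_curv_at_eq cov_def[of G "\<lambda>y. cov G X y _"] D
    using second_derivative_symmetric[OF X op x, of u v] \<Gamma>_sym[OF x, of u v]
    by (simp add: cov_def christoffel_form_simps)
qed

section \<open>Symmetries of the curvature tensor\<close>

lemma R_antisym: "R x u v w = - R x v u w"
  by (simp add: loc_curv_at_eq)

lemma linear_R:
  assumes x: "x \<in> S"
  shows "linear (\<lambda>u. R x u v w)" "linear (\<lambda>w. R x u v w)"
proof -
  have dk: "(\<lambda>y. \<Gamma> y a b) differentiable (at x)" for a b
    by (rule smooth_on_differentiable[OF _ x]) (intro smooth_intros)
  have lin: "linear (Der (\<lambda>y. \<Gamma> y a b) x)" for a b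
    using linear_frechet_derivative[OF dk] .
  show "linear (\<lambda>u. R x u v w)" "linear (\<lambda>w. R x u v w)"
    by (auto simp: linear_iff loc_curv_at_eq cov_def christoffel_form_simps Der_add Der_scaleR dk linear_add[OF lin]
      linear_scale[OF lin] scaleR_add_right scaleR_diff_right)
qed

text \<open>For constant \<open>w\<close> and \<open>z\<close> the second derivatives of
  \<open>ip G y w z\<close> commute. When both orders are expanded by metric compatibility, the
  products of two Christoffel terms are symmetric in \<open>u\<close> and \<open>v\<close> and
  cancel.\<close>

lemma R_skew:
  assumes x: "x \<in> S"
  shows "ip G x (R x u v w) z = - ip G x w (R x u v z)"
proof -
  have sm: "smooth_on S (\<lambda>y. \<Gamma> y a b)" for a b by (intro smooth_intros)
  have D1: "Der (\<lambda>y. ip G y w z) y v = ip G y (\<Gamma> y v w) z + ip G y w (\<Gamma> y v z)" if "y \<in> S" for y v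
    using metric_compat[OF smooth_on_const smooth_on_const that, of w z v] by (simp add: cov_def)
  have D2: "Der (\<lambda>y. Der (\<lambda>y. ip G y w z) y v) x u =
     ip G x (cov G (\<lambda>y. \<Gamma> y v w) x u) z + ip G x (\<Gamma> x v w) (\<Gamma> x u z)
     + (ip G x (\<Gamma> x u w) (\<Gamma> x v z) + ip G x w (cov G (\<lambda>y. \<Gamma> y v z) x u))" for u v
  proof -
    have "Der (\<lambda>y. Der (\<lambda>y. ip G y w z) y v) x u = Der (\<lambda>y. ip G y (\<Gamma> y v w) z + ip G y w (\<Gamma> y v z)) x u"
      by (rule Der_cong_open[OF op x D1])
    also have "\<dots> = Der (\<lambda>y. ip G y (\<Gamma> y v w) z) x u + Der (\<lambda>y. ip G y w (\<Gamma> y v z)) x u"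
      by (intro Der_add smooth_on_differentiable[OF _ x]) (intro smooth_intros)+
    finally show ?thesis
      using metric_compat[OF sm smooth_on_const x, of v w z u] metric_compat[OF smooth_on_const sm x, of w v z u]
      by (simp add: cov_def)
  qed
  have "Der (\<lambda>y. Der (\<lambda>y. ip G y w z) y v) x u = Der (\<lambda>y. Der (\<lambda>y. ip G y w z) y u) x v"
    by (rule second_derivative_symmetric[OF _ op x]) (intro smooth_intros)
  then show ?thesis unfolding D2 loc_curv_at_eq by (simp add: ip_simps)
qed

text \<open>By symmetry of \<open>\<Gamma>\<close>, each covariant derivative of a Christoffel term
  occurs twice in the cyclic sum, with opposite signs.\<close>

lemma R_bianchi:
  assumes x: "x \<in> S"
  shows "R x u v w + R x v w u + R x w u v = 0"
proof -
  have "cov G (\<lambda>y. \<Gamma> y a b) x c = cov G (\<lambda>y. \<Gamma> y b a) x c" for a b c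
    unfolding cov_def using Der_cong_open[OF op x, of "\<lambda>y. \<Gamma> y a b" "\<lambda>y. \<Gamma> y b a" c] \<Gamma>_sym x by simp
  from this[of v w u] this[of u w v] this[of v u w] show ?thesis
    unfolding loc_curv_at_eq by simp
qed

text \<open>The octahedron argument: six curvature values enter four Bianchi sums, each value in two
  of them. The first plus the fourth minus the second and the third leaves twice the difference of
  the two sides.\<close>

lemma R_pair_symmetry:
  assumes x: "x \<in> S"
  shows "ip G x (R x u v w) z = ip G x (R x w z u) v"
proof -
  define Q where "Q = (\<lambda>a b c d. ip G x (R x a b c) d)"
  have 1: "Q a b c d = - Q b a c d" for a b c d unfolding Q_def by (subst R_antisym) (simp add: ip_simps)
  have 2: "Q a b c d = - Q a b d c" for a b c d
    unfolding Q_def using R_skew[OF x, of a b c d] ip_sym[OF x] by simp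
  have 3: "Q a b c d + Q b c a d + Q c a b d = 0" for a b c d
    unfolding Q_def using R_bianchi[OF x, of a b c] by (simp add: ip_simps(1)[symmetric] bilinear_lzero[OF bilinear_ip])
  have "Q u v w z + Q v w u z + Q w u v z = 0" by (rule 3)
  moreover have "Q v w u z + Q w z u v + Q v z w u = 0"
    using 3[of v w z u] 2[of v w z u] 2[of w z v u] 1[of z v w u] by simp
  moreover have "Q w z u v + Q u z v w + Q w u v z = 0"
    using 3[of w z u v] 1[of z u w v] 2[of u z w v] 1[of u w z v] 2[of w u z v] by simp
  moreover have "Q u z v w + Q u v w z + Q v z w u = 0"
    using 3[of z u v w] 1[of z u v w] 2[of u v z w] 2[of v z u w] by simp
  ultimately have "Q u v w z = Q w z u v" by linarith
  then show ?thesis by (simp add: Q_def)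
qed

section \<open>Metric traces, gradient and Ricci tensor\<close>

lemma matrix_inv_sym: "x \<in> S \<Longrightarrow> matrix_inv (G x) $ i $ j = matrix_inv (G x) $ j $ i"
proof -
  assume x: "x \<in> S"
  have "axis i 1 \<bullet> (matrix_inv (G x) *v axis j 1) = ip G x (matrix_inv (G x) *v axis i 1) (matrix_inv (G x) *v axis j 1)" for i j
    using ip_matrix_inv[OF x, of "matrix_inv (G x) *v axis j 1" "axis i 1"] ip_sym[OF x] by (simp add: inner_commute)
  then have "axis i 1 \<bullet> (matrix_inv (G x) *v axis j 1) = axis j 1 \<bullet> (matrix_inv (G x) *v axis i 1)"
    using ip_sym[OF x] by metis
  then show ?thesis by (simp add: inner_axis' matrix_vector_mult_basis column_def)
qed

lemma mtr_swap: "x \<in> S \<Longrightarrow> mtr G x (\<lambda>u v. B v u) = mtr G x B"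
  unfolding mtr_def by (subst sum.swap) (simp add: matrix_inv_sym)

text \<open>The bridge between metric traces and traces of endomorphisms: contracting with the
  inverse metric undoes the lowering of an index. It serves the Laplacian, the Ricci tensor and the
  dimension count in \<open>tension_f\<close>.\<close>

lemma mtr_ip: "x \<in> S \<Longrightarrow> mtr G x (\<lambda>u v. ip G x (L u) v) = (\<Sum>k\<in>UNIV. L (axis k 1) $ k)"
proof -
  assume x: "x \<in> S"
  have "(\<Sum>j\<in>UNIV. matrix_inv (G x) $ i $ j * ip G x (L (axis i 1)) (axis j 1)) = L (axis i 1) $ i" for i
  proof -
    have "(\<Sum>j\<in>UNIV. matrix_inv (G x) $ i $ j * ip G x (L (axis i 1)) (axis j 1)) =
        (\<Sum>j\<in>UNIV. (matrix_inv (G x) *v axis i 1) $ j *\<^sub>R ip G x (L (axis i 1)) (axis j 1))"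
      by (simp add: matrix_vector_mult_basis column_def matrix_inv_sym[OF x, of i])
    also have "\<dots> = ip G x (L (axis i 1)) (matrix_inv (G x) *v axis i 1)"
      by (rule linear_eq_sum_axis[symmetric]) (use bilinear_ip[of G x] in \<open>simp add: bilinear_def\<close>)
    finally show ?thesis using ip_matrix_inv[OF x] by (simp add: inner_axis)
  qed
  then show ?thesis by (simp add: mtr_def)
qed

lemma ip_mtr: "ip G x (mtr G x B) v = mtr G x (\<lambda>a b. ip G x (B a b) v)"
  by (rule mtr_linear) (use bilinear_ip[of G x] in \<open>simp add: bilinear_def\<close>)

lemma ip_grad: "x \<in> S \<Longrightarrow> f differentiable (at x) \<Longrightarrow> ip G x (loc_grad G f x) w = Der f x w"
proof -
  assume x: "x \<in> S" and f: "f differentiable (at x)"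
  have "ip G x (loc_grad G f x) w = w \<bullet> (\<chi> j. Der f x (axis j 1))"
    unfolding loc_grad_def using ip_matrix_inv ip_sym x by simp
  also have "\<dots> = Der f x w"
    by (simp add: inner_vec_def linear_eq_sum_axis[OF linear_frechet_derivative[OF f], of w])
  finally show ?thesis .
qed

lemma smooth_on_grad [smooth_intros]: "smooth_on S f \<Longrightarrow> smooth_on S (loc_grad G f)"
  unfolding loc_grad_def by (intro smooth_intros op smooth_G inv_G)

lemma ip_ricci_op:
  assumes x: "x \<in> S"
  shows "ip G x (loc_ricci_op G x u) v = loc_ricci G x u v"
proof -
  have "linear (loc_ricci G x u)"
    using linear_add[OF linear_R(2)[OF x]] linear_scale[OF linear_R(2)[OF x]]
    by (simp add: linear_iff loc_ricci_def sum.distrib sum_distrib_left)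
  then show ?thesis
    using ip_sym[OF x] ip_matrix_inv[OF x]
    by (simp add: loc_ricci_op_def inner_vec_def linear_eq_sum_axis[of "loc_ricci G x u" v])
qed

lemma ricci_eq_mtr:
  assumes x: "x \<in> S"
  shows "loc_ricci G x u v = mtr G x (\<lambda>a b. ip G x (R x a u v) b)"
  unfolding loc_ricci_def using mtr_ip[OF x, of "\<lambda>a. R x a u v"] by simp

text \<open>Pair symmetry together with the skew symmetries exchanges \<open>u\<close> and
  \<open>v\<close> while swapping the two trace slots, which the symmetric trace does not
  see.\<close>

lemma ricci_sym:
  assumes x: "x \<in> S"
  shows "loc_ricci G x u v = loc_ricci G x v u"
proof -
  have "ip G x (R x a u v) b = ip G x (R x b v u) a" for a b
    using R_pair_symmetry[OF x, of a u v b] R_antisym[of x v b a] R_skew[OF x, of b v u a]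
      ip_sym[OF x] by (simp add: ip_simps)
  then have "loc_ricci G x u v = mtr G x (\<lambda>a b. ip G x (R x b v u) a)"
    using ricci_eq_mtr[OF x] by simp
  also have "\<dots> = loc_ricci G x v u"
    using ricci_eq_mtr[OF x] mtr_swap[OF x, of "\<lambda>b a. ip G x (R x b v u) a"] by simp
  finally show ?thesis .
qed

text \<open>This is the trace in the curvature term of the bitension field. Skewness in the last two
  slots produces the minus sign, which that term's own sign turns into a second positive Ricci
  contribution.\<close>

lemma mtr_curvature:
  assumes x: "x \<in> S"
  shows "mtr G x (\<lambda>a b. R x a u b) = - loc_ricci_op G x u"
proof (rule ip_nondegenerate[OF x])
  fix w
  have "ip G x (mtr G x (\<lambda>a b. R x a u b)) w = mtr G x (\<lambda>a b. - ip G x (R x a u w) b)"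
    unfolding ip_mtr using R_skew[OF x] ip_sym[OF x] by (metis (no_types, lifting))
  also have "\<dots> = - loc_ricci G x u w"
    unfolding ricci_eq_mtr[OF x] using mtr_linear[of uminus G x "\<lambda>a. ip G x (R x a u w)"] by (simp add: linear_iff)
  finally show "ip G x (mtr G x (\<lambda>a b. R x a u b)) w = ip G x (- loc_ricci_op G x u) w"
    by (simp add: ip_simps ip_ricci_op[OF x])
qed

section \<open>Gradient fields: Hessian and Bochner formula\<close>

context
  fixes f :: "real^'k \<Rightarrow> real" assumes f: "smooth_on S f"
begin

abbreviation gradf where "gradf \<equiv> loc_grad G f"

lemma smooth_gradf: "smooth_on S gradf" using f by (rule smooth_on_grad)

text \<open>Differentiating \<open>Der f y w = ip G y (gradf y) w\<close> by metric compatibility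
  leaves a term along \<open>\<Gamma> x u w\<close>, which is exactly the correction in the Hessian
  of constant fields.\<close>

lemma hessian_eq:
  assumes x: "x \<in> S"
  shows "loc_hessian G f (\<lambda>_. u) (\<lambda>_. w) x = ip G x (cov G gradf x u) w"
proof -
  have "Der (\<lambda>y. Der f y w) x u = Der (\<lambda>y. ip G y (gradf y) w) x u"
    by (rule Der_cong_open[OF op x]) (simp add: ip_grad smooth_on_differentiable[OF f])
  also have "\<dots> = ip G x (cov G gradf x u) w + Der f x (\<Gamma> x u w)"
    using metric_compat[OF smooth_gradf smooth_on_const x]
    by (simp add: cov_def ip_grad[OF x smooth_on_differentiable[OF f x]])
  finally show ?thesis by (simp add: loc_hessian_def loc_nabla_eq_cov cov_def)
qed

lemma cov_grad_sym:
  assumes x: "x \<in> S"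
  shows "ip G x (cov G gradf x u) w = ip G x (cov G gradf x w) u"
  unfolding hessian_eq[OF x, symmetric] loc_hessian_def loc_nabla_eq_cov
  using second_derivative_symmetric[OF f op x, of u w] \<Gamma>_sym[OF x, of u w] by (simp add: cov_def)

lemma laplacian_eq: "x \<in> S \<Longrightarrow> loc_laplacian G f x = (\<Sum>k\<in>UNIV. cov G gradf x (axis k 1) $ k)"
  unfolding loc_laplacian_def loc_trace_eq_mtr by (simp add: hessian_eq mtr_ip)

text \<open>Differentiate the symmetric Hessian along \<open>u\<close>: the derivative is symmetric
  in \<open>v\<close> and \<open>w\<close>, and so is the sum of the two Christoffel
  corrections.\<close>

lemma cov2_grad_sym:
  assumes x: "x \<in> S"
  shows "ip G x (cov2 G gradf x u v) w = ip G x (cov2 G gradf x u w) v"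
proof -
  have sm: "smooth_on S (\<lambda>y. cov G gradf y v)" for v by (intro smooth_intros smooth_gradf)
  have "ip G x (cov2 G gradf x u v) w = Der (\<lambda>y. ip G y (cov G gradf y v) w) x u
     - ip G x (cov G gradf x v) (\<Gamma> x u w) - ip G x (cov G gradf x w) (\<Gamma> x u v)" for v w
    using metric_compat[OF sm smooth_on_const x, of v w u]
      cov_grad_sym[OF x, of "\<Gamma> x u v" w]
    by (simp add: cov2_def ip_simps cov_def[of G "\<lambda>_. w"])
  moreover have "Der (\<lambda>y. ip G y (cov G gradf y v) w) x u = Der (\<lambda>y. ip G y (cov G gradf y w) v) x u"
    by (rule Der_cong_open[OF op x]) (rule cov_grad_sym)
  ultimately show ?thesis by simp
qed

text \<open>The Laplacian is the divergence of the gradient field \<open>gradf\<close>; exchanging the two covariant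
  derivatives in $\sum_k (\nabla^2_{v,k}\,\mathrm{grad} f)^k$ produces the Ricci term.\<close>

lemma bochner:
  assumes x: "x \<in> S"
  shows "ip G x (mtr G x (cov2 G gradf x)) v = Der (loc_laplacian G f) x v + loc_ricci G x (gradf x) v"
proof -
  have "Der (loc_laplacian G f) x v = Der (\<lambda>y. \<Sum>k\<in>UNIV. cov G gradf y (axis k 1) $ k) x v"
    by (rule Der_cong_open[OF op x laplacian_eq])
  also have "\<dots> = (\<Sum>k\<in>UNIV. Der (\<lambda>y. cov G gradf y (axis k 1) $ k) x v)"
    by (intro Der_sum smooth_on_differentiable[OF _ x]) (intro smooth_intros smooth_gradf op)
  also have "\<dots> = (\<Sum>k\<in>UNIV. Der (\<lambda>y. cov G gradf y (axis k 1)) x v $ k)"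
    by (intro sum.cong refl Der_nth smooth_on_differentiable[OF _ x]) (intro smooth_intros smooth_gradf op)
  also have "\<dots> = (\<Sum>k\<in>UNIV. cov2 G gradf x v (axis k 1) $ k)"
  proof -
    \<comment> \<open>The two Christoffel corrections in \<nabla>^2 are the two products of the
      endomorphisms \<nabla> grad f and \<open>\<Gamma> x v\<close>; their traces agree, so
      differentiating the divergence needs no correction.\<close>
    have "(\<Sum>k\<in>UNIV. cov G gradf x (\<Gamma> x v (axis k 1)) $ k) = (\<Sum>k\<in>UNIV. \<Gamma> x v (cov G gradf x (axis k 1)) $ k)"
      by (rule trace_commute[OF linear_cov[OF smooth_gradf x]])
        (use bilinear_christoffel_form[of G x] in \<open>simp add: bilinear_def\<close>)
    then show ?thesis
      by (simp add: cov2_def cov_def[of G "\<lambda>y. cov G gradf y _"] sum.distrib sum_subtractf)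
  qed
  also have "\<dots> = (\<Sum>k\<in>UNIV. cov2 G gradf x (axis k 1) v $ k) - loc_ricci G x v (gradf x)"
  proof -
    have "cov2 G gradf x v (axis k 1) $ k = cov2 G gradf x (axis k 1) v $ k - R x (axis k 1) v (gradf x) $ k" for k
      using ricci_identity[OF smooth_gradf x, of "axis k 1" v] by (metis add_diff_cancel_left' diff_add_cancel vector_minus_component)
    then show ?thesis by (simp add: loc_ricci_def sum_subtractf)
  qed
  also have "(\<Sum>k\<in>UNIV. cov2 G gradf x (axis k 1) v $ k) = mtr G x (\<lambda>a b. ip G x (cov2 G gradf x a v) b)"
    by (rule mtr_ip[OF x, symmetric])
  \<comment> \<open>Symmetry in the last two slots moves \<open>v\<close> out of the trace.\<close>
  also have "\<dots> = ip G x (mtr G x (cov2 G gradf x)) v"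
    unfolding ip_mtr using cov2_grad_sym[OF x, of _ v] by simp
  finally show ?thesis using ricci_sym[OF x, of v "gradf x"] by simp
qed

lemma rough_laplacian_grad:
  assumes x: "x \<in> S"
  shows "mtr G x (cov2 G gradf x) = loc_grad G (loc_laplacian G f) x + loc_ricci_op G x (gradf x)"
proof (rule ip_nondegenerate[OF x])
  have "smooth_on S (\<lambda>y. \<Sum>k\<in>UNIV. cov G gradf y (axis k 1) $ k)"
    by (intro smooth_intros smooth_gradf op)
  then have "smooth_on S (loc_laplacian G f)"
    by (rule smooth_on_cong[OF op, rotated]) (simp add: laplacian_eq)
  then show "ip G x (mtr G x (cov2 G gradf x)) w = ip G x (loc_grad G (loc_laplacian G f) x + loc_ricci_op G x (gradf x)) w" for w
    using bochner[OF x] by (simp add: ip_simps ip_ricci_op[OF x] ip_grad[OF x] smooth_on_differentiable x)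
qed

text \<open>The derivative of the squared length along \<open>w\<close> is twice the product of
  \<nabla>_w grad f with grad f, and symmetry of the Hessian moves \<open>w\<close> into the other
  slot.\<close>

lemma cov_grad_grad:
  assumes x: "x \<in> S"
  shows "cov G gradf x (gradf x) = (1/2) *\<^sub>R loc_grad G (\<lambda>y. ip G y (gradf y) (gradf y)) x"
proof (rule ip_nondegenerate[OF x])
  fix w
  have "(\<lambda>y. ip G y (gradf y) (gradf y)) differentiable (at x)"
    by (rule smooth_on_differentiable[OF _ x]) (intro smooth_intros smooth_gradf)
  then show "ip G x (cov G gradf x (gradf x)) w = ip G x ((1/2) *\<^sub>R loc_grad G (\<lambda>y. ip G y (gradf y) (gradf y)) x) w"
    using metric_compat[OF smooth_gradf smooth_gradf x, of w] cov_grad_sym[OF x, of w "gradf x"] ip_sym[OF x, of "gradf x" "cov G gradf x w"]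
    by (simp add: ip_simps ip_grad[OF x])
qed

end

end

section \<open>Riemannian submersions and isometries in coordinates\<close>

text \<open>Needed because traces are carried through a submersion for bilinear forms only. The
  second slot is the delicate one, since there the vector sits under a derivative.\<close>

lemma (in local_metric) bilinear_cov2:
  assumes X: "smooth_on S X" and x: "x \<in> S"
  shows "bilinear (cov2 G X x)"
proof -
  have sm: "smooth_on S (\<lambda>y. cov G X y v)" for v by (intro smooth_intros X)
  note d = smooth_on_differentiable[OF sm x]
  note lin = linear_cov[OF X]
  have add: "cov G (\<lambda>y. cov G X y (v + w)) x u = cov G (\<lambda>y. cov G X y v) x u + cov G (\<lambda>y. cov G X y w) x u" for u v w
  proof -
    have "Der (\<lambda>y. cov G X y (v + w)) x u = Der (\<lambda>y. cov G X y v + cov G X y w) x u"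
      by (rule Der_cong_open[OF op x]) (rule linear_add[OF lin])
    then show ?thesis
      unfolding cov_def[of G "\<lambda>y. cov G X y _"] by (simp add: Der_add d linear_add[OF lin[OF x]] christoffel_form_simps)
  qed
  have scale: "cov G (\<lambda>y. cov G X y (r *\<^sub>R v)) x u = r *\<^sub>R cov G (\<lambda>y. cov G X y v) x u" for u r v
  proof -
    have "Der (\<lambda>y. cov G X y (r *\<^sub>R v)) x u = Der (\<lambda>y. r *\<^sub>R cov G X y v) x u"
      by (rule Der_cong_open[OF op x]) (rule linear_scale[OF lin])
    then show ?thesis
      unfolding cov_def[of G "\<lambda>y. cov G X y _"]
      by (simp add: Der_scaleR d linear_scale[OF lin[OF x]] christoffel_form_simps scaleR_add_right)
  qed
  show ?thesis
    using linear_add[OF linear_cov[OF sm x]] linear_scale[OF linear_cov[OF sm x]]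
    by (auto simp: bilinear_def linear_iff cov2_def add scale christoffel_form_simps
      linear_add[OF lin[OF x]] linear_scale[OF lin[OF x]] scaleR_diff_right)
qed

lemma loc_tension_eq:
  "loc_tension G H f x = mtr G x (\<lambda>u v. Der (\<lambda>y. Der f y v) x u
     + christoffel_form H (f x) (Der f x u) (Der f x v) - Der f x (christoffel_form G x u v))"
  by (simp add: loc_tension_def loc_trace_eq_mtr loc_nabla_along_def loc_nabla_def)

text \<open>The hypothesis \<open>trace\<close> expresses that \<open>f\<close> is a Riemannian submersion.\<close>

lemma loc_bitension_submersion:
  fixes G :: "'p::finite metric" and H :: "'q::finite metric" and f :: "real^'p \<Rightarrow> real^'q"
  assumes H: "local_metric V H" and U: "open U" and f: "smooth_on U f" "f ` U \<subseteq> V"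
    and X: "smooth_on V X" and tens: "\<And>x. x \<in> U \<Longrightarrow> loc_tension G H f x = X (f x)"
    and trace: "\<And>x (B :: real^'q \<Rightarrow> real^'q \<Rightarrow> real^'q). x \<in> U \<Longrightarrow> bilinear B \<Longrightarrow>
      mtr G x (\<lambda>u v. B (Der f x u) (Der f x v)) = mtr H (f x) B"
    and x: "x \<in> U"
  shows "loc_bitension G H f x = mtr H (f x) (cov2 H X (f x)) + cov H X (f x) (X (f x))
    - mtr H (f x) (\<lambda>a b. loc_curv_at H (f x) a (X (f x)) b)"
proof -
  interpret local_metric V H by (rule H)
  have fx: "f x \<in> V" using f x by auto
  let ?\<tau> = "loc_tension G H f"
  \<comment> \<open>Since the tension field is \<open>X\<close> composed with \<open>f\<close>, the
    pull-back connection reduces to the connection of the target in the direction of the image under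
    the differential.\<close>
  have along: "loc_nabla_along H f Y ?\<tau> y = cov H X (f y) (Der f y (Y y))" if "y \<in> U" for y Y
  proof -
    have "Der ?\<tau> y (Y y) = Der (\<lambda>y. X (f y)) y (Y y)"
      by (rule Der_cong_open[OF U that tens])
    also have "\<dots> = Der X (f y) (Der f y (Y y))"
      using that f X by (intro Der_compose smooth_on_differentiable) auto
    finally show ?thesis by (simp add: loc_nabla_along_def cov_def tens that)
  qed
  have 2: "loc_nabla_along H f (\<lambda>_. u) (loc_nabla_along H f (\<lambda>_. v) ?\<tau>) x =
     cov H (\<lambda>z. cov H X z (Der f x v)) (f x) (Der f x u) + cov H X (f x) (Der (\<lambda>y. Der f y v) x u)" for u v
  proof -
    have "Der (loc_nabla_along H f (\<lambda>_. v) ?\<tau>) x u = Der (\<lambda>y. cov H X (f y) (Der f y v)) x u"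
      by (rule Der_cong_open[OF U x]) (rule along)
    also have "\<dots> = Der (\<lambda>z. cov H X z (Der f x v)) (f x) (Der f x u) + cov H X (f x) (Der (\<lambda>y. Der f y v) x u)"
      by (rule Der_linear_family[OF U op f _ x])
        (auto intro!: smooth_intros U op f X linear_cov)
    finally show ?thesis
      by (simp add: loc_nabla_along_def[of H f "\<lambda>_. u"] along x cov_def[of H "\<lambda>z. cov H X z _"])
  qed
  \<comment> \<open>The second fundamental form of \<open>f\<close>. It measures how far the second
    covariant derivative along \<open>f\<close> deviates from \<open>cov2 H X\<close> on image
    vectors; its trace is the tension field, that is \<open>X (f x)\<close>, which is how \<nabla>_X
    X appears.\<close>
  define T where "T = (\<lambda>u v. Der (\<lambda>y. Der f y v) x u
     + christoffel_form H (f x) (Der f x u) (Der f x v) - Der f x (christoffel_form G x u v))"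
  note lin = linear_cov[OF X fx]
  have "loc_nabla_along H f (\<lambda>_. u) (loc_nabla_along H f (\<lambda>_. v) ?\<tau>) x
      - loc_nabla_along H f (loc_nabla G (\<lambda>_. u) (\<lambda>_. v)) ?\<tau> x =
      cov2 H X (f x) (Der f x u) (Der f x v) + cov H X (f x) (T u v)" for u v
    by (simp add: 2 along x cov2_def T_def linear_add[OF lin] linear_diff[OF lin] loc_nabla_eq_cov cov_def[of G])
  then have "loc_bitension G H f x =
     mtr G x (\<lambda>u v. cov2 H X (f x) (Der f x u) (Der f x v) + cov H X (f x) (T u v))
     - mtr G x (\<lambda>u v. loc_curv_at H (f x) (Der f x u) (X (f x)) (Der f x v))"
    by (simp add: loc_bitension_def Let_def loc_trace_eq_mtr tens x)
  also have "mtr G x (\<lambda>u v. cov2 H X (f x) (Der f x u) (Der f x v) + cov H X (f x) (T u v)) =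
      mtr H (f x) (cov2 H X (f x)) + cov H X (f x) (X (f x))"
    unfolding mtr_add using trace[OF x bilinear_cov2[OF X fx]] mtr_linear[OF lin, of G x T]
      tens[OF x, unfolded loc_tension_eq] by (simp add: T_def)
  also have "mtr G x (\<lambda>u v. loc_curv_at H (f x) (Der f x u) (X (f x)) (Der f x v)) =
      mtr H (f x) (\<lambda>a b. loc_curv_at H (f x) a (X (f x)) b)"
    by (rule trace[OF x]) (simp add: bilinear_def linear_R[OF fx])
  finally show ?thesis .
qed

text \<open>The form belongs to the rank one endomorphism sending \<open>u\<close> to
  \<open>ip G x a u *\<^sub>R b\<close>, whose trace is the inner product.\<close>

lemma (in local_metric) mtr_rank_one:
  assumes x: "x \<in> S"
  shows "mtr G x (\<lambda>u v. ip G x a u * ip G x b v) = ip G x a b"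
proof -
  have "mtr G x (\<lambda>u v. ip G x (ip G x a u *\<^sub>R b) v) = (\<Sum>k\<in>UNIV. (ip G x a (axis k 1) *\<^sub>R b) $ k)"
    by (rule mtr_ip[OF x])
  also have "\<dots> = (\<Sum>k\<in>UNIV. b $ k *\<^sub>R ip G x a (axis k 1))" by (simp add: mult.commute)
  also have "\<dots> = ip G x a b"
    by (rule linear_eq_sum_axis[symmetric]) (use bilinear_ip[of G x] in \<open>simp add: bilinear_def\<close>)
  finally show ?thesis by (simp add: ip_simps)
qed

text \<open>By \<open>lift\<close>, every \<open>a\<close> has a horizontal lift: a preimage whose
  inner products are those of \<open>a\<close> with the images. The coordinates of
  \<open>L u\<close> are then inner products of \<open>u\<close> with lifts, and
  \<open>mtr_rank_one\<close> evaluates the trace coefficient by coefficient.\<close>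

lemma mtr_submersion:
  assumes G: "local_metric S G" "x \<in> S" and H: "local_metric V H" "y \<in> V" and B: "bilinear B"
    and lift: "\<And>a. \<exists>c. L c = a \<and> (\<forall>u. ip G x c u = ip H y a (L u))"
  shows "mtr G x (\<lambda>u v. B (L u) (L v)) = mtr H y B"
proof -
  obtain l where l: "\<And>a. L (l a) = a" "\<And>a u. ip G x (l a) u = ip H y a (L u)"
    using lift by metis
  have 1: "L u $ a = ip G x (l (matrix_inv (H y) *v axis a 1)) u" for u a
    using local_metric.ip_matrix_inv[OF H, of "L u" "axis a 1"] local_metric.ip_sym[OF H]
    by (simp add: l inner_axis)
  have 2: "mtr G x (\<lambda>u v. L u $ a * L v $ b) = matrix_inv (H y) $ a $ b" for a b
  proof -
    have "mtr G x (\<lambda>u v. L u $ a * L v $ b) =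
        ip G x (l (matrix_inv (H y) *v axis a 1)) (l (matrix_inv (H y) *v axis b 1))"
      unfolding 1 by (rule local_metric.mtr_rank_one[OF G])
    also have "\<dots> = (matrix_inv (H y) *v axis a 1) \<bullet> axis b 1"
      by (simp add: l local_metric.ip_matrix_inv[OF H])
    also have "\<dots> = matrix_inv (H y) $ a $ b"
      using local_metric.matrix_inv_sym[OF H, of a b] by (simp add: inner_axis matrix_vector_mult_basis column_def)
    finally show ?thesis .
  qed
  have "mtr G x (\<lambda>u v. B (L u) (L v)) =
      mtr G x (\<lambda>u v. \<Sum>a\<in>UNIV. \<Sum>b\<in>UNIV. (L u $ a * L v $ b) *\<^sub>R B (axis a 1) (axis b 1))"
    using bilinear_eq_sum_axis[OF B] by (intro arg_cong[where f = "mtr G x"]) blast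
  also have "\<dots> = (\<Sum>a\<in>UNIV. \<Sum>b\<in>UNIV. mtr G x (\<lambda>u v. L u $ a * L v $ b) *\<^sub>R B (axis a 1) (axis b 1))"
    unfolding mtr_sum using mtr_linear[of "\<lambda>r. r *\<^sub>R B (axis _ 1) (axis _ 1)" G x]
    by (simp add: linear_iff scaleR_add_left)
  also have "\<dots> = mtr H y B" by (simp add: 2 mtr_def[of H])
  finally show ?thesis .
qed

text \<open>Models a coordinate change of a Riemannian manifold, defined on the overlap
  \<open>S\<close> of two charts and mapping into the full range \<open>V\<close> of the second
  one.\<close>

locale local_isometry = M: local_metric S G + T: local_metric V H
  for S :: "(real^'k) set" and G :: "'k::finite metric" and V :: "(real^'k) set" and H :: "'k metric" +
  fixes \<psi> :: "real^'k \<Rightarrow> real^'k"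
  assumes smooth_\<psi>: "smooth_on S \<psi>" and \<psi>_into: "\<psi> ` S \<subseteq> V"
    and isometry: "x \<in> S \<Longrightarrow> ip H (\<psi> x) (Der \<psi> x u) (Der \<psi> x v) = ip G x u v"
begin

lemma linear_D\<psi>: "x \<in> S \<Longrightarrow> linear (Der \<psi> x)"
  using smooth_\<psi> smooth_on_linear_derivative by blast

text \<open>Preserving a nondegenerate product forces injectivity, hence surjectivity in equal
  dimensions. So every test vector on the target side may be taken as an image.\<close>

lemma surj_D\<psi>:
  assumes x: "x \<in> S" obtains u where "Der \<psi> x u = a"
proof -
  have "u = 0" if "Der \<psi> x u = 0" for u
    using isometry[OF x, of u] M.ip_nondegenerate[OF x, of u 0] that by (simp add: bilinear_lzero[OF bilinear_ip])
  then have "inj (Der \<psi> x)" using linear_injective_0[OF linear_D\<psi>[OF x]] by blast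
  then have "surj (Der \<psi> x)" using linear_D\<psi>[OF x] linear_injective_imp_surjective by blast
  then show ?thesis using that by (metis surjD)
qed

abbreviation D2\<psi> where "D2\<psi> x u v \<equiv> Der (\<lambda>y. Der \<psi> y v) x u"

text \<open>Differentiating the isometry condition expresses \<open>M.dG\<close> by
  \<open>T.dG\<close> and second derivatives of \<psi>. In the Koszul combination four of the six
  second derivative terms cancel in pairs by their symmetry, and the other two add up. Equivalently,
  \<psi> has vanishing second fundamental form.\<close>

lemma christoffel_transform:
  assumes x: "x \<in> S"
  shows "christoffel_form H (\<psi> x) (Der \<psi> x u) (Der \<psi> x v) + D2\<psi> x u v = Der \<psi> x (christoffel_form G x u v)"
proof (rule T.ip_nondegenerate)
  show y: "\<psi> x \<in> V" using \<psi>_into x by auto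
  fix w'
  obtain w where w: "w' = Der \<psi> x w" using surj_D\<psi>[OF x] by metis
  let ?h = "ip H (\<psi> x)"
  have D: "M.dG x a b c = ?h (D2\<psi> x a b) (Der \<psi> x c) + ?h (Der \<psi> x b) (D2\<psi> x a c)
      + T.dG (\<psi> x) (Der \<psi> x a) (Der \<psi> x b) (Der \<psi> x c)" for a b c
  proof -
    have d\<psi>: "(\<lambda>y. Der \<psi> y e) differentiable (at x)" for e
      by (rule smooth_on_differentiable[OF _ x]) (intro smooth_intros M.op smooth_\<psi>)
    have dH: "(\<lambda>y. H (\<psi> y)) differentiable (at x)"
      by (rule smooth_on_differentiable[OF smooth_on_compose[OF M.op T.op \<psi>_into T.smooth_G smooth_\<psi>] x])
    have d: "(\<lambda>y. H (\<psi> y) *v Der \<psi> y c) differentiable (at x)"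
      by (rule smooth_on_differentiable[OF _ x])
        (intro smooth_intros M.op smooth_\<psi> smooth_on_compose[OF M.op T.op \<psi>_into T.smooth_G smooth_\<psi>])
    have "M.dG x a b c = Der (\<lambda>y. b \<bullet> (G y *v c)) x a"
      by (simp add: Der_inner Der_matrix_vector_mult M.diff_G[OF x]
        bounded_bilinear.FDERIV differentiableI[OF bounded_bilinear.FDERIV[OF bounded_bilinear_matrix_vector_mult
           M.diff_G[OF x, unfolded frechet_derivative_works] has_derivative_const]])
    also have "\<dots> = Der (\<lambda>y. Der \<psi> y b \<bullet> (H (\<psi> y) *v Der \<psi> y c)) x a"
      by (rule Der_cong_open[OF M.op x]) (simp add: isometry[unfolded ip_def])
    also have "\<dots> = Der \<psi> x b \<bullet> (H (\<psi> x) *v D2\<psi> x a c + Der (\<lambda>y. H (\<psi> y)) x a *v Der \<psi> x c)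
        + D2\<psi> x a b \<bullet> (H (\<psi> x) *v Der \<psi> x c)"
      by (simp add: Der_inner d d\<psi> Der_matrix_vector_mult dH)
    also have "Der (\<lambda>y. H (\<psi> y)) x a = Der H (\<psi> x) (Der \<psi> x a)"
      by (rule Der_compose[OF smooth_on_differentiable[OF smooth_\<psi> x] T.diff_G[OF y]])
    finally show ?thesis by (simp add: ip_def inner_add_right)
  qed
  have s: "D2\<psi> x a b = D2\<psi> x b a" for a b
    by (rule second_derivative_symmetric[OF smooth_\<psi> M.op x])
  have "2 * ?h (Der \<psi> x (christoffel_form G x u v)) w' = 2 * ip G x (christoffel_form G x u v) w"
    by (simp add: w isometry x)
  also have "\<dots> = 2 * ?h (D2\<psi> x u v) w' + 2 * ?h (christoffel_form H (\<psi> x) (Der \<psi> x u) (Der \<psi> x v)) w'"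
    unfolding M.koszul[OF x] T.koszul[OF y] D w
    using s[of u v] s[of u w] s[of v w] T.ip_sym[OF y, of "Der \<psi> x v" "D2\<psi> x u w"]
      T.ip_sym[OF y, of "Der \<psi> x u" "D2\<psi> x v w"] by simp
  finally show "?h (christoffel_form H (\<psi> x) (Der \<psi> x u) (Der \<psi> x v) + D2\<psi> x u v) w' =
      ?h (Der \<psi> x (christoffel_form G x u v)) w'" by (simp add: ip_simps)
qed

lemma mtr_transform:
  assumes x: "x \<in> S" and B: "bilinear B"
  shows "mtr G x (\<lambda>u v. B (Der \<psi> x u) (Der \<psi> x v)) = mtr H (\<psi> x) B"
proof (rule mtr_submersion[OF M.local_metric_axioms x T.local_metric_axioms _ B])
  show "\<psi> x \<in> V" using \<psi>_into x by auto
  show "\<exists>c. Der \<psi> x c = a \<and> (\<forall>u. ip G x c u = ip H (\<psi> x) a (Der \<psi> x u))" for a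
    using surj_D\<psi>[OF x, of a] isometry[OF x] by metis
qed

lemma grad_transform:
  assumes x: "x \<in> S" and f: "f differentiable (at (\<psi> x))"
  shows "Der \<psi> x (loc_grad G (\<lambda>y. f (\<psi> y)) x) = loc_grad H f (\<psi> x)"
proof (rule T.ip_nondegenerate)
  show y: "\<psi> x \<in> V" using \<psi>_into x by auto
  fix w'
  obtain w where w: "w' = Der \<psi> x w" using surj_D\<psi>[OF x] by metis
  have d: "\<psi> differentiable (at x)" using smooth_on_differentiable[OF smooth_\<psi> x] .
  have "(\<lambda>y. f (\<psi> y)) differentiable (at x)"
    using differentiable_chain_at[OF d f] by (simp add: o_def)
  then show "ip H (\<psi> x) (Der \<psi> x (loc_grad G (\<lambda>y. f (\<psi> y)) x)) w' = ip H (\<psi> x) (loc_grad H f (\<psi> x)) w'"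
    by (simp add: w isometry x M.ip_grad T.ip_grad[OF y f] Der_compose d f)
qed

text \<open>The second derivative of \<psi> in the chain rule is absorbed by the inhomogeneous term
  of the Christoffel symbols, so the Hessian transforms as a tensor. This makes the chart chosen in
  \<open>laplacian\<close> immaterial.\<close>

lemma laplacian_transform:
  assumes x: "x \<in> S" and f: "smooth_on V f"
  shows "loc_laplacian G (\<lambda>y. f (\<psi> y)) x = loc_laplacian H f (\<psi> x)"
proof -
  have y: "\<psi> x \<in> V" using \<psi>_into x by auto
  have df: "f differentiable (at (\<psi> z))" if "z \<in> S" for z
    using smooth_on_differentiable[OF f] \<psi>_into that by auto
  have d\<psi>: "\<psi> differentiable (at z)" if "z \<in> S" for z
    using smooth_on_differentiable[OF smooth_\<psi> that] .
  have lin: "linear (Der f (\<psi> x))" using linear_frechet_derivative[OF df[OF x]] .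
  have hess: "loc_hessian G (\<lambda>y. f (\<psi> y)) (\<lambda>_. u) (\<lambda>_. v) x = loc_hessian H f (\<lambda>_. Der \<psi> x u) (\<lambda>_. Der \<psi> x v) (\<psi> x)" for u v
  proof -
    have "Der (\<lambda>y. Der (\<lambda>y. f (\<psi> y)) y v) x u = Der (\<lambda>y. Der f (\<psi> y) (Der \<psi> y v)) x u"
      by (rule Der_cong_open[OF M.op x]) (rule Der_compose[OF d\<psi> df])
    also have "\<dots> = Der (\<lambda>z. Der f z (Der \<psi> x v)) (\<psi> x) (Der \<psi> x u) + Der f (\<psi> x) (D2\<psi> x u v)"
      by (rule Der_linear_family[OF M.op T.op smooth_\<psi> \<psi>_into _ x])
        (auto intro!: smooth_intros M.op T.op smooth_\<psi> f smooth_on_linear_derivative[OF f])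
    finally show ?thesis
      using christoffel_transform[OF x, of u v]
      by (simp add: loc_hessian_def loc_nabla_def Der_compose[OF d\<psi>[OF x] df[OF x]] linear_add[OF lin, symmetric] linear_diff[OF lin, symmetric] algebra_simps)
  qed
  have "bilinear (\<lambda>u v. loc_hessian H f (\<lambda>_. u) (\<lambda>_. v) (\<psi> x))"
    using linear_add[OF T.linear_cov[OF T.smooth_on_grad[OF f] y]] linear_scale[OF T.linear_cov[OF T.smooth_on_grad[OF f] y]]
    unfolding T.hessian_eq[OF f y] by (auto simp: bilinear_def linear_iff ip_simps)
  from mtr_transform[OF x this] show ?thesis
    by (simp add: loc_laplacian_def loc_trace_eq_mtr hess)
qed

end

section \<open>Warped products in coordinates\<close>

lemma local_metricI:
  assumes "open S" "smooth_on S G" "\<And>x u v. x \<in> S \<Longrightarrow> ip G x u v = ip G x v u"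
    "\<And>x u. x \<in> S \<Longrightarrow> (\<And>v. ip G x u v = 0) \<Longrightarrow> u = 0"
  shows "local_metric S G"
proof
  fix x assume x: "x \<in> S"
  have e: "G x $ i $ j = ip G x (axis i 1) (axis j 1)" for i j
    by (simp add: ip_def inner_axis' matrix_vector_mult_basis column_def)
  show "transpose (G x) = G x"
    using assms(3)[OF x] by (simp add: vec_eq_iff transpose_def e)
  have "u = 0" if "G x *v u = 0" for u
    using that assms(3)[OF x, of u] by (intro assms(4)[OF x]) (simp add: ip_def)
  then obtain B where "B ** G x = mat 1" using matrix_left_invertible_ker by blast
  then show "invertible (G x)" unfolding invertible_def using matrix_left_right_inverse by blast
qed (use assms in auto)

definition pr1 :: "real^('m::finite + 'n::finite) \<Rightarrow> real^'m" where "pr1 z = (\<chi> i. z $ Inl i)"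
definition pr2 :: "real^('m::finite + 'n::finite) \<Rightarrow> real^'n" where "pr2 z = (\<chi> j. z $ Inr j)"
definition in1 :: "real^'m \<Rightarrow> real^('m::finite + 'n::finite)" where "in1 x = (\<chi> k. case k of Inl i \<Rightarrow> x $ i | Inr j \<Rightarrow> 0)"
definition in2 :: "real^'n \<Rightarrow> real^('m::finite + 'n::finite)" where "in2 y = (\<chi> k. case k of Inl i \<Rightarrow> 0 | Inr j \<Rightarrow> y $ j)"

lemma pr_in [simp]: "pr1 (in1 x) = x" "pr2 (in1 x) = 0" "pr1 (in2 y) = 0" "pr2 (in2 y) = y"
  by (simp_all add: pr1_def pr2_def in1_def in2_def vec_eq_iff)

lemma pr_eqI: "pr1 z = pr1 w \<Longrightarrow> pr2 z = pr2 w \<Longrightarrow> z = w"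
  by (simp add: pr1_def pr2_def vec_eq_iff) (metis sum.exhaust)

lemma bounded_linear_pr1: "bounded_linear (pr1 :: real^('m::finite + 'n::finite) \<Rightarrow> _)"
  and bounded_linear_pr2: "bounded_linear (pr2 :: real^('m::finite + 'n::finite) \<Rightarrow> _)"
  by (simp_all add: linear_conv_bounded_linear[symmetric] linear_iff pr1_def pr2_def vec_eq_iff)

lemmas smooth_on_pr1 = smooth_on_linear[OF _ bounded_linear_pr1]
lemmas smooth_on_pr2 = smooth_on_linear[OF _ bounded_linear_pr2]

lemma Der_pr [simp]: "Der pr1 z w = pr1 w" "Der pr2 z w = pr2 w"
  by (rule Der_eqI, rule bounded_linear_imp_has_derivative, rule bounded_linear_pr1)
    (rule Der_eqI, rule bounded_linear_imp_has_derivative, rule bounded_linear_pr2)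

lemma differentiable_pr: "pr1 differentiable (at z)" "pr2 differentiable (at z)"
  by (rule differentiableI, rule bounded_linear_imp_has_derivative, rule bounded_linear_pr1)
    (rule differentiableI, rule bounded_linear_imp_has_derivative, rule bounded_linear_pr2)

lemma sum_UNIV_Plus:
  fixes f :: "'m::finite + 'n::finite \<Rightarrow> 'b::comm_monoid_add"
  shows "(\<Sum>k\<in>UNIV. f k) = (\<Sum>i\<in>UNIV. f (Inl i)) + (\<Sum>j\<in>UNIV. f (Inr j))"
  using sum.Plus[of "UNIV :: 'm set" "UNIV :: 'n set" f] by simp

text \<open>\<open>S1\<close> and \<open>S2\<close> lie in the coordinates of a product chart, while
  \<open>V\<close> belongs to a possibly different chart of the first factor, reached by \<psi>. The
  warping function \<open>l\<close> is given in the target chart and enters the source metric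
  through \<psi>.\<close>

locale local_warped = I: local_isometry S1 G1 V H \<psi> + N: local_metric S2 G2
  for S1 :: "(real^'m) set" and G1 :: "'m::finite metric" and V :: "(real^'m) set" and H :: "'m metric"
    and \<psi> and S2 :: "(real^'n) set" and G2 :: "'n::finite metric" +
  fixes l :: "real^'m \<Rightarrow> real" and G :: "('m + 'n) metric" and W :: "(real^('m + 'n)) set"
  assumes smooth_l: "smooth_on V l"
    and W: "W = {z. pr1 z \<in> S1 \<and> pr2 z \<in> S2}"
    and ip_G: "z \<in> W \<Longrightarrow> ip G z u v = ip G1 (pr1 z) (pr1 u) (pr1 v)
       + exp (2 * l (\<psi> (pr1 z))) * ip G2 (pr2 z) (pr2 u) (pr2 v)"
begin

abbreviation l1 where "l1 \<equiv> \<lambda>x. l (\<psi> x)"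

lemma smooth_l1: "smooth_on S1 l1"
  by (rule smooth_on_compose[OF I.M.op I.T.op I.\<psi>_into smooth_l I.smooth_\<psi>])

lemma open_W: "open W"
proof -
  have "W = pr1 -` S1 \<inter> pr2 -` S2" using W by auto
  then show ?thesis
    using bounded_linear_pr1 bounded_linear_pr2 I.M.op N.op
    by (auto intro!: open_Int open_vimage linear_continuous_on simp: continuous_on_eq_continuous_at linear_continuous_at)
qed

lemma pr_W: "pr1 ` W \<subseteq> S1" "pr2 ` W \<subseteq> S2"
  using W by auto

lemma smooth_on_W:
  "smooth_on S1 f \<Longrightarrow> smooth_on W (\<lambda>z. f (pr1 z))" "smooth_on S2 h \<Longrightarrow> smooth_on W (\<lambda>z. h (pr2 z))"
  using smooth_on_compose[OF open_W I.M.op pr_W(1) _ smooth_on_pr1[OF open_W]]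
    smooth_on_compose[OF open_W N.op pr_W(2) _ smooth_on_pr2[OF open_W]] by auto

sublocale P: local_metric W G
proof (rule local_metricI[OF open_W])
  have e: "G z $ i $ j = ip G z (axis i 1) (axis j 1)" for i j z
    by (simp add: ip_def inner_axis' matrix_vector_mult_basis column_def)
  have "smooth_on W (\<lambda>z. ip G z u v)" for u v
  proof (rule smooth_on_cong[OF open_W])
    show "smooth_on W (\<lambda>z. ip G1 (pr1 z) (pr1 u) (pr1 v) + exp (2 * l1 (pr1 z)) * ip G2 (pr2 z) (pr2 u) (pr2 v))"
      by (intro smooth_intros open_W smooth_on_W(1)[where f = l1, OF smooth_l1]
          smooth_on_W(1)[where f = "\<lambda>x. ip G1 x _ _"] smooth_on_W(2)[where h = "\<lambda>x. ip G2 x _ _"])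
  qed (simp add: ip_G)
  then show "smooth_on W G" by (simp add: smooth_on_vec_iff[OF open_W] e)
  show "ip G z u v = ip G z v u" if "z \<in> W" for z u v
    using that W I.M.ip_sym N.ip_sym by (simp add: ip_G)
  show "u = 0" if z: "z \<in> W" and u: "\<And>v. ip G z u v = 0" for z u
  proof (rule pr_eqI)
    have "ip G1 (pr1 z) (pr1 u) v = 0" for v
      using u[of "in1 v"] by (simp add: ip_G z bilinear_rzero[OF bilinear_ip])
    then show "pr1 u = pr1 0"
      using I.M.ip_nondegenerate[of "pr1 z" "pr1 u" 0] z W
      by (simp add: bilinear_lzero[OF bilinear_ip] linear_0[OF bounded_linear.linear[OF bounded_linear_pr1]])
    have "ip G2 (pr2 z) (pr2 u) v = 0" for v
      using u[of "in2 v"] by (simp add: ip_G z bilinear_rzero[OF bilinear_ip])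
    then show "pr2 u = pr2 0"
      using N.ip_nondegenerate[of "pr2 z" "pr2 u" 0] z W
      by (simp add: bilinear_lzero[OF bilinear_ip] linear_0[OF bounded_linear.linear[OF bounded_linear_pr2]])
  qed
qed

text \<open>The base component of the connection. In the Koszul formula against a base vector, the
  fibre directions contribute only through the derivative of the warping factor, with a minus sign;
  the 2 from the exponent cancels the Koszul 2.\<close>

lemma christoffel_pr1:
  assumes z: "z \<in> W"
  shows "pr1 (christoffel_form G z u v) = christoffel_form G1 (pr1 z) (pr1 u) (pr1 v)
    - (exp (2 * l1 (pr1 z)) * ip G2 (pr2 z) (pr2 u) (pr2 v)) *\<^sub>R loc_grad G1 l1 (pr1 z)"
proof (rule I.M.ip_nondegenerate)
  show x: "pr1 z \<in> S1" using z W by auto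
  have y: "pr2 z \<in> S2" using z W by auto
  fix w
  let ?E = "\<lambda>x. exp (2 * l1 x)" and ?N = "\<lambda>b c y. ip G2 y (pr2 b) (pr2 c)"
  \<comment> \<open>Rewrites the derivative of a metric on constant vectors as that of a scalar
    function, so that sum and product rules apply to the warped formula.\<close>
  have const: "dG' = Der (\<lambda>y. b \<bullet> (K y *v c)) x a"
    if "K differentiable (at x)" "dG' = b \<bullet> (Der K x a *v c)" for K :: "'z::finite metric" and x a b c dG'
  proof -
    have "(\<lambda>y. K y *v c) differentiable (at x)"
      by (rule differentiableI, rule bounded_bilinear.FDERIV[OF bounded_bilinear_matrix_vector_mult
         that(1)[unfolded frechet_derivative_works] has_derivative_const])
    then show ?thesis using that by (simp add: Der_inner Der_matrix_vector_mult)
  qed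
  have dN: "?N b c differentiable (at (pr2 z))" for b c
    by (rule smooth_on_differentiable[OF _ y]) (intro smooth_intros)
  have dM: "(\<lambda>y. ip G1 y b c) differentiable (at (pr1 z))" for b c
    by (rule smooth_on_differentiable[OF _ x]) (intro smooth_intros)
  have dE: "?E differentiable (at (pr1 z))"
    by (rule smooth_on_differentiable[OF _ x]) (intro smooth_intros I.M.op smooth_l1)
  have dl: "l1 differentiable (at (pr1 z))" by (rule smooth_on_differentiable[OF smooth_l1 x])
  have DE: "Der ?E (pr1 z) a = 2 * Der l1 (pr1 z) a * ?E (pr1 z)" for a
  proof -
    have "(?E has_derivative (\<lambda>h. ?E (pr1 z) * (2 * Der l1 (pr1 z) h))) (at (pr1 z))"
      using dl[unfolded frechet_derivative_works] by (auto intro!: derivative_eq_intros)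
    then show ?thesis by (simp add: Der_eqI)
  qed
  have D: "P.dG z a b c = I.M.dG (pr1 z) (pr1 a) (pr1 b) (pr1 c)
    + (?E (pr1 z) * Der (?N b c) (pr2 z) (pr2 a) + 2 * Der l1 (pr1 z) (pr1 a) * ?E (pr1 z) * ?N b c (pr2 z))" for a b c
  proof -
    have dEz: "(\<lambda>z. ?E (pr1 z)) differentiable (at z)" "(\<lambda>z. ?N b c (pr2 z)) differentiable (at z)"
      "(\<lambda>z. ip G1 (pr1 z) (pr1 b) (pr1 c)) differentiable (at z)"
      by (rule smooth_on_differentiable[OF _ z], rule smooth_on_W(1)[where f = ?E], intro smooth_intros I.M.op smooth_l1)
        (rule smooth_on_differentiable[OF _ z], rule smooth_on_W(2)[where h = "?N b c"], intro smooth_intros,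
         rule smooth_on_differentiable[OF _ z], rule smooth_on_W(1)[where f = "\<lambda>y. ip G1 y _ _"], intro smooth_intros)
    have dp: "(\<lambda>z. ?E (pr1 z) * ?N b c (pr2 z)) differentiable (at z)"
      using dEz by (intro differentiable_mult)
    have "P.dG z a b c = Der (\<lambda>z. ip G z b c) z a"
      unfolding ip_def by (rule const[OF P.diff_G[OF z]]) simp
    also have "\<dots> = Der (\<lambda>z. ip G1 (pr1 z) (pr1 b) (pr1 c) + ?E (pr1 z) * ?N b c (pr2 z)) z a"
      by (rule Der_cong_open[OF open_W z]) (rule ip_G)
    also have "\<dots> = Der (\<lambda>z. ip G1 (pr1 z) (pr1 b) (pr1 c)) z a + Der (\<lambda>z. ?E (pr1 z) * ?N b c (pr2 z)) z a"
      by (rule Der_add[OF dEz(3) dp])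
    also have "Der (\<lambda>z. ?E (pr1 z) * ?N b c (pr2 z)) z a =
        ?E (pr1 z) * Der (\<lambda>z. ?N b c (pr2 z)) z a + Der (\<lambda>z. ?E (pr1 z)) z a * ?N b c (pr2 z)"
      by (rule Der_bilinear[OF bounded_bilinear_mult dEz(1,2)])
    also have "Der (\<lambda>z. ?E (pr1 z)) z a = 2 * Der l1 (pr1 z) (pr1 a) * ?E (pr1 z)"
      using Der_compose[OF differentiable_pr(1) dE, of a] by (simp add: DE)
    also have "Der (\<lambda>z. ?N b c (pr2 z)) z a = Der (?N b c) (pr2 z) (pr2 a)"
      using Der_compose[OF differentiable_pr(2) dN, of b c a] by simp
    also have "Der (\<lambda>z. ip G1 (pr1 z) (pr1 b) (pr1 c)) z a = Der (\<lambda>x. ip G1 x (pr1 b) (pr1 c)) (pr1 z) (pr1 a)"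
      using Der_compose[OF differentiable_pr(1) dM, of "pr1 b" "pr1 c" a] by simp
    also have "\<dots> = I.M.dG (pr1 z) (pr1 a) (pr1 b) (pr1 c)"
      unfolding ip_def by (rule const[OF I.M.diff_G[OF x], symmetric]) simp
    finally show ?thesis by simp
  qed
  have z0: "ip G2 y a 0 = 0" "ip G2 y 0 a = 0" for y a
    by (simp_all add: bilinear_rzero[OF bilinear_ip] bilinear_lzero[OF bilinear_ip])
  have "linear (Der (?N u v) (pr2 z))" using linear_frechet_derivative[OF dN] .
  note lin0 = linear_0[OF this]
  \<comment> \<open>Testing against \<open>in1 w\<close> removes the fibre part of the
    product.\<close>
  have "2 * ip G1 (pr1 z) (pr1 (christoffel_form G z u v)) w = 2 * ip G z (christoffel_form G z u v) (in1 w)"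
    by (simp add: ip_G z z0)
  also have "\<dots> = P.dG z u v (in1 w) + P.dG z v u (in1 w) - P.dG z (in1 w) u v"
    by (rule P.koszul[OF z])
  also have "\<dots> = 2 * ip G1 (pr1 z) (christoffel_form G1 (pr1 z) (pr1 u) (pr1 v)) w
      - 2 * (?E (pr1 z) * ?N u v (pr2 z)) * Der l1 (pr1 z) w"
    unfolding D I.M.koszul[OF x] by (simp add: z0 lin0)
  finally show "ip G1 (pr1 z) (pr1 (christoffel_form G z u v)) w =
     ip G1 (pr1 z) (christoffel_form G1 (pr1 z) (pr1 u) (pr1 v)
    - (?E (pr1 z) * ?N u v (pr2 z)) *\<^sub>R loc_grad G1 l1 (pr1 z)) w"
    by (simp add: ip_simps I.M.ip_grad[OF x dl])
qed

context
  fixes f :: "real^('m + 'n) \<Rightarrow> real^'m"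
  assumes f: "\<And>z. z \<in> W \<Longrightarrow> f z = \<psi> (pr1 z)"
begin

lemma Der_f:
  assumes z: "z \<in> W"
  shows "Der f z u = Der \<psi> (pr1 z) (pr1 u)"
proof -
  have "Der f z u = Der (\<lambda>z. \<psi> (pr1 z)) z u" by (rule Der_cong_open[OF open_W z f])
  then show ?thesis
    using Der_compose[OF differentiable_pr(1) smooth_on_differentiable[OF I.smooth_\<psi>], of z u] z W by simp
qed

lemma smooth_f: "smooth_on W f"
  by (rule smooth_on_cong[OF open_W _ smooth_on_W(1)[OF I.smooth_\<psi>]]) (simp add: f)

lemma f_into: "f ` W \<subseteq> V"
  using f I.\<psi>_into W by auto

text \<open>By \<open>christoffel_transform\<close> the base part of the second fundamental form
  vanishes. The remainder is the fibre part of the warped metric times grad \<lambda>, that is,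
  minus the differential of \<open>f\<close> applied to the vertical correction in
  \<open>christoffel_pr1\<close>.\<close>

lemma tension_f:
  assumes z: "z \<in> W"
  shows "loc_tension G H f z = real CARD('n) *\<^sub>R loc_grad H l (f z)"
proof -
  have x: "pr1 z \<in> S1" and y: "pr2 z \<in> S2" using z W by auto
  have lin: "linear (Der \<psi> (pr1 z))" by (rule I.linear_D\<psi>[OF x])
  have D2: "Der (\<lambda>y. Der f y v) z u = I.D2\<psi> (pr1 z) (pr1 u) (pr1 v)" for u v
  proof -
    have "Der (\<lambda>y. Der f y v) z u = Der (\<lambda>z. Der \<psi> (pr1 z) (pr1 v)) z u"
      by (rule Der_cong_open[OF open_W z Der_f])
    also have "\<dots> = I.D2\<psi> (pr1 z) (Der pr1 z u) (pr1 v)"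
      by (rule Der_compose[OF differentiable_pr(1)], rule smooth_on_differentiable[OF _ x])
        (intro smooth_intros I.M.op I.smooth_\<psi>)
    finally show ?thesis by simp
  qed
  have "Der (\<lambda>y. Der f y v) z u + christoffel_form H (f z) (Der f z u) (Der f z v)
      - Der f z (christoffel_form G z u v) = ip G z (in2 (pr2 u)) v *\<^sub>R loc_grad H l (f z)" for u v
  proof -
    have "Der f z (christoffel_form G z u v) =
        Der \<psi> (pr1 z) (christoffel_form G1 (pr1 z) (pr1 u) (pr1 v)) - ip G z (in2 (pr2 u)) v *\<^sub>R Der \<psi> (pr1 z) (loc_grad G1 l1 (pr1 z))"
      by (simp add: Der_f z christoffel_pr1 linear_diff[OF lin] linear_scale[OF lin] ip_G bilinear_lzero[OF bilinear_ip])
    also have "Der \<psi> (pr1 z) (loc_grad G1 l1 (pr1 z)) = loc_grad H l (f z)"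
      using I.grad_transform[OF x smooth_on_differentiable[OF smooth_l]] I.\<psi>_into x f z by auto
    finally show ?thesis
      unfolding I.christoffel_transform[OF x, symmetric] by (simp add: D2 Der_f z f)
  qed
  then have "loc_tension G H f z = mtr G z (\<lambda>u v. ip G z (in2 (pr2 u)) v *\<^sub>R loc_grad H l (f z))"
    by (simp add: loc_tension_eq)
  also have "\<dots> = mtr G z (\<lambda>u v. ip G z (in2 (pr2 u)) v) *\<^sub>R loc_grad H l (f z)"
    by (rule mtr_linear[of "\<lambda>r. r *\<^sub>R loc_grad H l (f z)", symmetric]) (simp add: linear_iff scaleR_add_left)
  \<comment> \<open>The fibre part of the metric belongs to the vertical projection, so its trace is
    the fibre dimension.\<close>
  also have "mtr G z (\<lambda>u v. ip G z (in2 (pr2 u)) v) = (\<Sum>k\<in>UNIV. in2 (pr2 (axis k 1 :: real^('m + 'n))) $ k)"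
    by (rule P.mtr_ip[OF z])
  also have "\<dots> = real CARD('n)"
    by (simp add: sum_UNIV_Plus in2_def pr2_def axis_def)
  finally show ?thesis .
qed

text \<open>With V = nX and X = grad \<lambda>, the rough Laplacian and the curvature term scale by
  n and \<nabla>_V V by n^2. Extracting one n leaves n \<nabla>_X X, half of n times the gradient of
  |X|^2; the rough Laplacian and the curvature trace give one Ricci term each.\<close>

lemma bitension_f:
  assumes z: "z \<in> W"
  shows "loc_bitension G H f z = real CARD('n) *\<^sub>R (loc_grad H (loc_laplacian H l) (f z)
    + 2 *\<^sub>R loc_ricci_op H (f z) (loc_grad H l (f z))
    + (real CARD('n) / 2) *\<^sub>R loc_grad H (\<lambda>y. ip H y (loc_grad H l y) (loc_grad H l y)) (f z))"
proof -
  let ?n = "real CARD('n)" and ?X = "loc_grad H l"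
  have y: "f z \<in> V" using f_into z by auto
  have X: "smooth_on V ?X" by (intro smooth_intros smooth_l)
  have trace: "mtr G z (\<lambda>u v. B (Der f z u) (Der f z v)) = mtr H (f z) B"
    if z: "z \<in> W" and B: "bilinear B" for z and B :: "real^'m \<Rightarrow> real^'m \<Rightarrow> real^'m"
  proof (rule mtr_submersion[OF P.local_metric_axioms z I.T.local_metric_axioms _ B])
    show "f z \<in> V" using f_into z by auto
    have x: "pr1 z \<in> S1" using z W by auto
    show "\<exists>c. Der f z c = a \<and> (\<forall>u. ip G z c u = ip H (f z) a (Der f z u))" for a
    proof -
      \<comment> \<open>\<open>in1 b\<close> is the horizontal lift of \<open>a\<close>: it has no
        fibre component, and \<psi> is isometric.\<close>
      obtain b where b: "Der \<psi> (pr1 z) b = a" using I.surj_D\<psi>[OF x] by metis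
      show ?thesis
        by (rule exI[of _ "in1 b"])
          (simp add: Der_f z ip_G b[symmetric] f I.isometry x bilinear_lzero[OF bilinear_ip])
    qed
  qed
  have scale_cov: "cov H (\<lambda>y. c *\<^sub>R Y y) y u = c *\<^sub>R cov H Y y u" if "smooth_on V Y" "y \<in> V" for Y y c u
    using smooth_on_differentiable[OF that]
    by (simp add: cov_def Der_scaleR christoffel_form_simps scaleR_add_right)
  have "cov H (\<lambda>y. cov H (\<lambda>y. ?n *\<^sub>R ?X y) y v) (f z) u = ?n *\<^sub>R cov H (\<lambda>y. cov H ?X y v) (f z) u" for u v
  proof -
    have "Der (\<lambda>y. cov H (\<lambda>y. ?n *\<^sub>R ?X y) y v) (f z) u = Der (\<lambda>y. ?n *\<^sub>R cov H ?X y v) (f z) u"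
      by (rule Der_cong_open[OF I.T.op y]) (rule scale_cov[OF X])
    then have "cov H (\<lambda>y. cov H (\<lambda>y. ?n *\<^sub>R ?X y) y v) (f z) u = cov H (\<lambda>y. ?n *\<^sub>R cov H ?X y v) (f z) u"
      by (simp add: cov_def[of H "\<lambda>y. cov H _ y v"] cov_def[of H "\<lambda>y. ?n *\<^sub>R cov H _ y v"] scale_cov[OF X y])
    also have "\<dots> = ?n *\<^sub>R cov H (\<lambda>y. cov H ?X y v) (f z) u"
      by (rule scale_cov[OF _ y]) (intro smooth_intros X)
    finally show ?thesis .
  qed
  then have cov2: "cov2 H (\<lambda>y. ?n *\<^sub>R ?X y) (f z) = (\<lambda>u v. ?n *\<^sub>R cov2 H ?X (f z) u v)"
    by (simp add: cov2_def fun_eq_iff scale_cov[OF X y] scaleR_diff_right)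
  \<comment> \<open>Linearity was shown for the first slot; antisymmetry carries it to the
    second.\<close>
  have R: "loc_curv_at H (f z) a (?n *\<^sub>R ?X (f z)) b = ?n *\<^sub>R loc_curv_at H (f z) a (?X (f z)) b" for a b
    using linear_scale[OF I.T.linear_R(1)[OF y], of ?n "?X (f z)" a b]
      I.T.R_antisym[of "f z" a] by simp
  have lin: "linear (\<lambda>v::real^'m. ?n *\<^sub>R v)" by (simp add: linear_iff scaleR_add_right)
  have "loc_bitension G H f z = mtr H (f z) (cov2 H (\<lambda>y. ?n *\<^sub>R ?X y) (f z))
      + cov H (\<lambda>y. ?n *\<^sub>R ?X y) (f z) (?n *\<^sub>R ?X (f z))
      - mtr H (f z) (\<lambda>a b. loc_curv_at H (f z) a (?n *\<^sub>R ?X (f z)) b)"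
    by (rule loc_bitension_submersion[OF I.T.local_metric_axioms open_W smooth_f f_into _ tension_f trace z])
      (intro smooth_intros X I.T.op)
  also have "\<dots> = ?n *\<^sub>R mtr H (f z) (cov2 H ?X (f z)) + (?n * ?n) *\<^sub>R cov H ?X (f z) (?X (f z))
      - ?n *\<^sub>R mtr H (f z) (\<lambda>a b. loc_curv_at H (f z) a (?X (f z)) b)"
    unfolding cov2 R scale_cov[OF X y] mtr_linear[OF lin, symmetric]
    by (simp add: linear_scale[OF I.T.linear_cov[OF X y]])
  also have "\<dots> = ?n *\<^sub>R (loc_grad H (loc_laplacian H l) (f z) + 2 *\<^sub>R loc_ricci_op H (f z) (?X (f z))
    + (?n / 2) *\<^sub>R loc_grad H (\<lambda>y. ip H y (?X y) (?X y)) (f z))"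
    unfolding I.T.rough_laplacian_grad[OF smooth_l y] I.T.cov_grad_grad[OF smooth_l y] I.T.mtr_curvature[OF y]
    by (simp add: algebra_simps scaleR_2)
  finally show ?thesis .
qed

end

end

section \<open>Global statements\<close>

locale atlas =
  fixes A :: "('a::{t2_space,second_countable_topology}, 'k::finite) chart set"
  assumes smooth_atlas: "smooth_atlas A"
begin

lemma cinv_cmap: "C \<in> A \<Longrightarrow> p \<in> cdom C \<Longrightarrow> cinv C (cmap C p) = p"
  using smooth_atlas unfolding smooth_atlas_def homeomorphism_def by blast

lemma cinv_in: "C \<in> A \<Longrightarrow> x \<in> cmap C ` cdom C \<Longrightarrow> cinv C x \<in> cdom C"
  and cmap_cinv: "C \<in> A \<Longrightarrow> x \<in> cmap C ` cdom C \<Longrightarrow> cmap C (cinv C x) = x"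
  using cinv_cmap[of C] by auto

lemma inj_on_cmap: "C \<in> A \<Longrightarrow> inj_on (cmap C) (cdom C)"
  by (rule inj_on_inverseI[of _ "cinv C"]) (rule cinv_cmap)

lemma open_cdom: "C \<in> A \<Longrightarrow> open (cdom C)"
  using smooth_atlas unfolding smooth_atlas_def by blast

lemma open_image:
  assumes C: "C \<in> A" and U: "open U"
  shows "open (cmap C ` (cdom C \<inter> U))"
proof -
  have "homeomorphism (cdom C) (cmap C ` cdom C) (cmap C) (cinv C)" "open (cmap C ` cdom C)"
    using smooth_atlas C unfolding smooth_atlas_def by blast+
  then have "open (cmap C ` cdom C \<inter> cinv C -` U)"
    by (intro continuous_open_preimage U) (auto simp: homeomorphism_def)
  moreover have "cmap C ` cdom C \<inter> cinv C -` U = cmap C ` (cdom C \<inter> U)"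
    using cinv_cmap[OF C] by (auto simp: image_iff)
  ultimately show ?thesis by simp
qed

lemma open_range: "C \<in> A \<Longrightarrow> open (cmap C ` cdom C)"
  using open_image[of C UNIV] by simp

lemma open_overlap: "C \<in> A \<Longrightarrow> D \<in> A \<Longrightarrow> open (cmap C ` (cdom C \<inter> cdom D))"
  using open_image open_cdom by blast

lemma smooth_transition:
  "C \<in> A \<Longrightarrow> D \<in> A \<Longrightarrow> smooth_on (cmap C ` (cdom C \<inter> cdom D)) (\<lambda>x. cmap D (cinv C x))"
  using smooth_atlas unfolding smooth_atlas_def o_def by blast

lemma chart_at_in: "chart_at A p \<in> charts_at A p"
proof -
  have "\<exists>C. C \<in> charts_at A p"
    using smooth_atlas unfolding smooth_atlas_def charts_at_def by blast
  then show ?thesis unfolding chart_at_def by (rule someI_ex)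
qed

lemma charts_atD: "C \<in> charts_at A p \<Longrightarrow> C \<in> A" "C \<in> charts_at A p \<Longrightarrow> p \<in> cdom C"
  by (auto simp: charts_at_def)

lemma in_overlap: "C \<in> charts_at A p \<Longrightarrow> D \<in> charts_at A p \<Longrightarrow> cmap C p \<in> cmap C ` (cdom C \<inter> cdom D)"
  by (auto simp: charts_at_def)

definition jac where "jac C D p = Der (\<lambda>x. cmap D (cinv C x)) (cmap C p)"

lemma jac_linear: "C \<in> charts_at A p \<Longrightarrow> D \<in> charts_at A p \<Longrightarrow> linear (jac C D p)"
  unfolding jac_def by (rule smooth_on_linear_derivative[OF smooth_transition in_overlap]) (auto dest: charts_atD)

text \<open>Stated for any map \<phi> on the manifold: a chart map as \<phi> gives the cocycle rule
  for Jacobians, and a coordinate expression of a smooth map gives independence of the differential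
  from the chart.\<close>

lemma Der_transition_chain:
  fixes F :: "real^'k \<Rightarrow> 'b::real_normed_vector"
  assumes C: "C \<in> charts_at A p" and D: "D \<in> charts_at A p" and F: "(\<lambda>y. \<phi> (cinv D y)) differentiable (at (cmap D p))"
  shows "Der (\<lambda>x. \<phi> (cinv C x)) (cmap C p) u = Der (\<lambda>y. \<phi> (cinv D y)) (cmap D p) (jac C D p u)"
proof -
  let ?S = "cmap C ` (cdom C \<inter> cdom D)"
  have *: "C \<in> A" "D \<in> A" using C D charts_atD by auto
  have e: "cmap D (cinv C (cmap C p)) = cmap D p" using cinv_cmap C by (simp add: charts_at_def)
  have "Der (\<lambda>x. \<phi> (cinv C x)) (cmap C p) u = Der (\<lambda>x. \<phi> (cinv D (cmap D (cinv C x)))) (cmap C p) u"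
    by (rule Der_cong_open[OF open_overlap in_overlap[OF C D]]) (use * cinv_cmap[OF *(1)] cinv_cmap[OF *(2)] in auto)
  also have "\<dots> = Der (\<lambda>y. \<phi> (cinv D y)) (cmap D (cinv C (cmap C p))) (jac C D p u)"
    unfolding jac_def
    by (rule Der_compose[OF smooth_on_differentiable[OF smooth_transition in_overlap[OF C D]]])
      (use * F e in auto)
  finally show ?thesis by (simp add: e)
qed

lemma jac_chain:
  assumes "C \<in> charts_at A p" "D \<in> charts_at A p" "E \<in> charts_at A p"
  shows "jac C E p u = jac D E p (jac C D p u)"
proof -
  have "(\<lambda>y. cmap E (cinv D y)) differentiable (at (cmap D p))"
    by (rule smooth_on_differentiable[OF smooth_transition in_overlap]) (use assms charts_atD in auto)
  then show ?thesis
    unfolding jac_def[of C E] jac_def[of D E] by (rule Der_transition_chain[OF assms(1,2)])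
qed

lemma jac_self: "C \<in> charts_at A p \<Longrightarrow> jac C C p u = u"
proof -
  assume C: "C \<in> charts_at A p"
  have "Der (\<lambda>x. cmap C (cinv C x)) (cmap C p) u = Der (\<lambda>x. x) (cmap C p) u"
    by (rule Der_cong_open[OF open_range])
      (use C cinv_cmap[of C] in \<open>auto simp: charts_at_def\<close>)
  then show ?thesis by (simp add: jac_def)
qed

text \<open>The tangent vector at \<open>p\<close> with coordinates \<open>u\<close> in the chart
  \<open>C\<close>, as a family over all charts; the entry 0 elsewhere follows the convention of
  \<open>tangent_space\<close>.\<close>

definition tv where "tv C p u = (\<lambda>D. if D \<in> charts_at A p then jac C D p u else 0)"

lemma coord_vec_eq: "coord_vec A C p i = tv C p (axis i 1)"
  by (auto simp: coord_vec_def tv_def jac_def o_def)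

lemma tv_chart: "C \<in> charts_at A p \<Longrightarrow> tv C p u C = u"
  by (simp add: tv_def jac_self)

lemma tv_tangent: "C \<in> charts_at A p \<Longrightarrow> tv C p u \<in> tangent_space A p"
  by (auto simp: tangent_space_def tv_def o_def jac_def[symmetric] jac_chain[symmetric])

lemma tv_transform: "C \<in> charts_at A p \<Longrightarrow> D \<in> charts_at A p \<Longrightarrow> tv D p (jac C D p u) = tv C p u"
  by (auto simp: tv_def jac_chain[symmetric])

lemma tv_linear:
  assumes C: "C \<in> charts_at A p"
  shows "tv C p (a *\<^sub>R u + b *\<^sub>R v) = (\<lambda>D. a *\<^sub>R tv C p u D + b *\<^sub>R tv C p v D)"
  using linear_add[OF jac_linear[OF C]] linear_scale[OF jac_linear[OF C]] by (auto simp: tv_def)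

end

text \<open>The chain rule moves the computation from the chosen chart to the chart in which the
  vector is given.\<close>

lemma differential_eq:
  assumes P: "smooth_atlas P" and \<phi>: "smooth_map P Q \<phi>" and Q: "smooth_atlas Q"
    and C: "C \<in> charts_at P p"
  shows "differential P Q \<phi> p (atlas.tv P C p u) =
    (\<lambda>D. if D \<in> charts_at Q (\<phi> p) then Der (\<lambda>x. cmap D (\<phi> (cinv C x))) (cmap C p) u else 0)"
proof
  fix D
  interpret P: atlas P using P by unfold_locales
  interpret Q: atlas Q using Q by unfold_locales
  let ?C = "chart_at P p"
  show "differential P Q \<phi> p (atlas.tv P C p u) D =
    (if D \<in> charts_at Q (\<phi> p) then Der (\<lambda>x. cmap D (\<phi> (cinv C x))) (cmap C p) u else 0)"
  proof (cases "D \<in> charts_at Q (\<phi> p)")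
    case True
    have "smooth_on (cmap ?C ` (cdom ?C \<inter> \<phi> -` cdom D)) (\<lambda>x. cmap D (\<phi> (cinv ?C x)))"
      using \<phi> True P.chart_at_in P.charts_atD Q.charts_atD unfolding smooth_map_def o_def by metis
    moreover have "cmap ?C p \<in> cmap ?C ` (cdom ?C \<inter> \<phi> -` cdom D)"
      using True P.chart_at_in[of p] by (auto simp: charts_at_def)
    ultimately have "(\<lambda>x. cmap D (\<phi> (cinv ?C x))) differentiable (at (cmap ?C p))"
      by (rule smooth_on_differentiable)
    from P.Der_transition_chain[OF C P.chart_at_in, where \<phi> = "\<lambda>q. cmap D (\<phi> q)", OF this, of u]
    show ?thesis
      using True P.chart_at_in[of p] by (simp add: differential_def Let_def o_def P.tv_def)
  qed (simp add: differential_def)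
qed

lemma loc_grad_cong:
  assumes "open S" "x \<in> S" "\<And>y. y \<in> S \<Longrightarrow> f y = f' y"
  shows "loc_grad G f x = loc_grad G f' x"
  using Der_cong_open[OF assms] by (simp add: loc_grad_def)

lemma loc_laplacian_cong:
  assumes "open S" "x \<in> S" "\<And>y. y \<in> S \<Longrightarrow> f y = f' y"
  shows "loc_laplacian G f x = loc_laplacian G f' x"
proof -
  have "Der (\<lambda>y. Der f y v) x u = Der (\<lambda>y. Der f' y v) x u" for u v
    by (rule Der_cong_open[OF assms(1,2)]) (rule Der_cong_open[OF assms(1) _ assms(3)])
  then show ?thesis
    using Der_cong_open[OF assms] by (simp add: loc_laplacian_def loc_trace_eq_mtr loc_hessian_def)
qed

section \<open>Riemannian manifolds in charts\<close>

locale riem_manifold = atlas A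
  for A :: "('a::{t2_space,second_countable_topology}, 'k::finite) chart set" +
  fixes g :: "('a, 'k) rmetric"
  assumes metric: "riemannian_metric A g"
begin

abbreviation "gm C \<equiv> metric_in A g C"

lemma g_sym: "u \<in> tangent_space A p \<Longrightarrow> v \<in> tangent_space A p \<Longrightarrow> g p u v = g p v u"
  using metric unfolding riemannian_metric_def by blast

lemma g_linear: "u \<in> tangent_space A p \<Longrightarrow> v \<in> tangent_space A p \<Longrightarrow> w \<in> tangent_space A p \<Longrightarrow>
  g p (\<lambda>C. a *\<^sub>R u C + b *\<^sub>R v C) w = a * g p u w + b * g p v w"
  using metric unfolding riemannian_metric_def by blast

text \<open>Both sides are bilinear, the second slot of \<open>g\<close> by symmetry, and they agree
  on coordinate vectors by the definition of \<open>metric_in\<close>.\<close>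

lemma g_tv:
  assumes C: "C \<in> charts_at A p"
  shows "g p (tv C p u) (tv C p v) = ip (gm C) (cmap C p) u v"
proof -
  have lin1: "g p (tv C p (a *\<^sub>R u + b *\<^sub>R v)) (tv C p w) = a * g p (tv C p u) (tv C p w) + b * g p (tv C p v) (tv C p w)"
    for a b u v w
    unfolding tv_linear[OF C] by (rule g_linear) (rule tv_tangent[OF C])+
  have sym: "g p (tv C p u) (tv C p v) = g p (tv C p v) (tv C p u)" for u v
    by (rule g_sym) (rule tv_tangent[OF C])+
  have bil: "bilinear (\<lambda>u v. g p (tv C p u) (tv C p v))"
    unfolding bilinear_def linear_iff
    using lin1[of 1 _ 1] lin1[of _ _ 0 0] sym by simp
  have "cinv C (cmap C p) = p" using C cinv_cmap by (simp add: charts_at_def)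
  then have "ip (gm C) (cmap C p) (axis i 1) (axis j 1) = g p (tv C p (axis i 1)) (tv C p (axis j 1))" for i j
    by (simp add: ip_def inner_axis' matrix_vector_mult_basis column_def metric_in_def coord_vec_eq)
  then show ?thesis
    unfolding bilinear_eq_sum_axis[OF bil, of u v] bilinear_eq_sum_axis[OF bilinear_ip, of "gm C" _ u v] by simp
qed

text \<open>A nonzero vector orthogonal to everything would have length zero, against positivity.
  \<open>T\<close> is left free because coordinate changes live on overlaps.\<close>

lemma local_metric_chart:
  assumes C: "C \<in> A" and T: "open T" "T \<subseteq> cmap C ` cdom C"
  shows "local_metric T (gm C)"
proof (rule local_metricI[OF T(1)])
  show "smooth_on T (gm C)"
    using metric C smooth_on_subset[OF _ T(2)] unfolding riemannian_metric_def by blast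
  fix x u assume "x \<in> T"
  then obtain p where p: "C \<in> charts_at A p" "x = cmap C p" using T C by (auto simp: charts_at_def)
  show "ip (gm C) x u v = ip (gm C) x v u" for v
    unfolding p(2) g_tv[OF p(1), symmetric] by (rule g_sym) (rule tv_tangent[OF p(1)])+
  show "u = 0" if "\<And>v. ip (gm C) x u v = 0"
  proof (rule ccontr)
    assume "u \<noteq> 0"
    then have "tv C p u \<noteq> (\<lambda>_. 0)" using tv_chart[OF p(1), of u] by auto
    then have "g p (tv C p u) (tv C p u) > 0"
      using metric tv_tangent[OF p(1)] unfolding riemannian_metric_def by blast
    then show False using that[of u] by (simp add: g_tv p)
  qed
qed

text \<open>Both products are values of \<open>g\<close> on the same tangent vectors, read off in
  two charts.\<close>

lemma local_isometry_transition:
  assumes C: "C \<in> A" and D: "D \<in> A"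
  shows "local_isometry (cmap C ` (cdom C \<inter> cdom D)) (gm C) (cmap D ` cdom D) (gm D) (\<lambda>x. cmap D (cinv C x))"
proof (intro local_isometry.intro local_isometry_axioms.intro local_metric_chart smooth_transition C D
    open_overlap open_range)
  show "(\<lambda>x. cmap D (cinv C x)) ` cmap C ` (cdom C \<inter> cdom D) \<subseteq> cmap D ` cdom D"
    using cinv_cmap[OF C] by auto
  fix x u v assume "x \<in> cmap C ` (cdom C \<inter> cdom D)"
  then obtain p where p: "C \<in> charts_at A p" "D \<in> charts_at A p" "x = cmap C p"
    using C D by (auto simp: charts_at_def)
  have "cmap D (cinv C x) = cmap D p" using p C cinv_cmap by (simp add: charts_at_def)
  then show "ip (gm D) (cmap D (cinv C x)) (Der (\<lambda>x. cmap D (cinv C x)) x u) (Der (\<lambda>x. cmap D (cinv C x)) x v) = ip (gm C) x u v"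
    by (simp add: p(3) jac_def[symmetric] g_tv[OF p(1), symmetric] g_tv[OF p(2), symmetric] tv_transform[OF p(1,2)])
qed auto

context
  fixes f :: "'a \<Rightarrow> real" assumes f: "smooth_function A f"
begin

lemma smooth_chart: "C \<in> A \<Longrightarrow> smooth_on (cmap C ` cdom C) (f \<circ> cinv C)"
  using f unfolding smooth_function_def by blast

text \<open>The gradient is defined chart by chart; that its components form one tangent vector is
  what lets \<open>g_tv\<close> compute its length.\<close>

lemma grad_eq_tv:
  assumes C: "C \<in> charts_at A p"
  shows "grad A g f p = tv C p (loc_grad (gm C) (f \<circ> cinv C) (cmap C p))"
proof
  fix D
  show "grad A g f p D = tv C p (loc_grad (gm C) (f \<circ> cinv C) (cmap C p)) D"
  proof (cases "D \<in> charts_at A p")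
    case D: True
    have *: "C \<in> A" "D \<in> A" using C D charts_atD by auto
    interpret I: local_isometry "cmap C ` (cdom C \<inter> cdom D)" "gm C" "cmap D ` cdom D" "gm D" "\<lambda>x. cmap D (cinv C x)"
      by (rule local_isometry_transition[OF *])
    have e: "cmap D (cinv C (cmap C p)) = cmap D p" using C cinv_cmap by (simp add: charts_at_def)
    have d: "(f \<circ> cinv D) differentiable (at (cmap D (cinv C (cmap C p))))"
      unfolding e by (rule smooth_on_differentiable[OF smooth_chart[OF *(2)]]) (use D charts_atD in auto)
    have "loc_grad (gm C) (f \<circ> cinv C) (cmap C p) = loc_grad (gm C) (\<lambda>x. (f \<circ> cinv D) (cmap D (cinv C x))) (cmap C p)"
      by (rule loc_grad_cong[OF I.M.op in_overlap[OF C D]]) (use * cinv_cmap[OF *(1)] cinv_cmap[OF *(2)] in auto)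
    then show ?thesis
      using I.grad_transform[OF in_overlap[OF C D] d] D by (simp add: grad_def tv_def jac_def e)
  qed (simp add: grad_def tv_def)
qed

lemma laplacian_chart:
  assumes D: "D \<in> charts_at A p"
  shows "laplacian A g f p = loc_laplacian (gm D) (f \<circ> cinv D) (cmap D p)"
proof -
  define C where "C = chart_at A p"
  have C: "C \<in> charts_at A p" unfolding C_def by (rule chart_at_in)
  have *: "C \<in> A" "D \<in> A" using C D charts_atD by auto
  interpret I: local_isometry "cmap C ` (cdom C \<inter> cdom D)" "gm C" "cmap D ` cdom D" "gm D" "\<lambda>x. cmap D (cinv C x)"
    by (rule local_isometry_transition[OF *])
  have e: "cmap D (cinv C (cmap C p)) = cmap D p" using C cinv_cmap by (simp add: charts_at_def)
  have "loc_laplacian (gm C) (f \<circ> cinv C) (cmap C p) = loc_laplacian (gm C) (\<lambda>x. (f \<circ> cinv D) (cmap D (cinv C x))) (cmap C p)"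
    by (rule loc_laplacian_cong[OF I.M.op in_overlap[OF C D]]) (use * cinv_cmap[OF *(1)] cinv_cmap[OF *(2)] in auto)
  then show ?thesis
    using I.laplacian_transform[OF in_overlap[OF C D] smooth_chart[OF *(2)]]
    by (simp add: laplacian_def C_def[symmetric] e)
qed

text \<open>The asserted equation's left-hand side in the chart \<open>D\<close>, with
  \<open>c\<close> in place of n/2. It has the shape in which \<open>bitension_f\<close> delivers
  its result.\<close>

definition bih where
  "bih c D y = loc_grad (gm D) (loc_laplacian (gm D) (f \<circ> cinv D)) y
    + 2 *\<^sub>R loc_ricci_op (gm D) y (loc_grad (gm D) (f \<circ> cinv D) y)
    + c *\<^sub>R loc_grad (gm D) (\<lambda>x. ip (gm D) x (loc_grad (gm D) (f \<circ> cinv D) x) (loc_grad (gm D) (f \<circ> cinv D) x)) y"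

text \<open>A gradient depends only on a germ, so the global Laplacian and squared length may be
  replaced by their expressions in \<open>D\<close>, valid on its whole range, before
  differentiating.\<close>

lemma bih_chart:
  "grad A g (laplacian A g f) p D + 2 *\<^sub>R ricci_op A g p (grad A g f p) D
    + c *\<^sub>R grad A g (\<lambda>q. g q (grad A g f q) (grad A g f q)) p D =
   (if D \<in> charts_at A p then bih c D (cmap D p) else 0)"
proof (cases "D \<in> charts_at A p")
  case D: True
  then have *: "D \<in> A" "cmap D p \<in> cmap D ` cdom D" using charts_atD by auto
  have D': "D \<in> charts_at A (cinv D y)" "cmap D (cinv D y) = y" if "y \<in> cmap D ` cdom D" for y
    using that cinv_in[OF *(1)] cmap_cinv[OF *(1)] *(1) by (auto simp: charts_at_def)
  have "loc_grad (gm D) (laplacian A g f \<circ> cinv D) (cmap D p) = loc_grad (gm D) (loc_laplacian (gm D) (f \<circ> cinv D)) (cmap D p)"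
    by (rule loc_grad_cong[OF open_range[OF *(1)] *(2)]) (use laplacian_chart[OF D'(1)] D'(2) in auto)
  moreover have "loc_grad (gm D) ((\<lambda>q. g q (grad A g f q) (grad A g f q)) \<circ> cinv D) (cmap D p) =
     loc_grad (gm D) (\<lambda>x. ip (gm D) x (loc_grad (gm D) (f \<circ> cinv D) x) (loc_grad (gm D) (f \<circ> cinv D) x)) (cmap D p)"
    by (rule loc_grad_cong[OF open_range[OF *(1)] *(2)]) (use D' in \<open>simp add: grad_eq_tv[OF D'(1)] g_tv[OF D'(1)]\<close>)
  moreover have "grad A g F p D = loc_grad (gm D) (F \<circ> cinv D) (cmap D p)" for F
    using D by (simp add: grad_def)
  ultimately show ?thesis
    using D by (simp add: ricci_op_def bih_def)
qed (simp add: grad_def ricci_op_def)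

end

end

section \<open>The product atlas\<close>

lemma cdom_prod_chart [simp]: "cdom (prod_chart C D) = cdom C \<times> cdom D"
  by (simp add: prod_chart_def)

lemma cmap_prod_chart: "cmap (prod_chart C D) q = in1 (cmap C (fst q)) + in2 (cmap D (snd q))"
  by (auto simp: prod_chart_def in1_def in2_def vec_eq_iff split: prod.split sum.split)

lemma linear_in: "linear in1" "linear in2"
  by (auto simp: linear_iff in1_def in2_def vec_eq_iff split: sum.split)

lemma bounded_linear_in: "bounded_linear in1" "bounded_linear in2"
  using linear_in by (auto simp: linear_conv_bounded_linear)

lemma linear_pr: "linear pr1" "linear pr2"
  using bounded_linear_pr1 bounded_linear_pr2 bounded_linear.linear by auto

lemma pr_cmap_prod_chart [simp]:
  "pr1 (cmap (prod_chart C D) q) = cmap C (fst q)" "pr2 (cmap (prod_chart C D) q) = cmap D (snd q)"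
  by (simp_all add: cmap_prod_chart linear_add[OF linear_pr(1)] linear_add[OF linear_pr(2)])

lemma image_prod_chart:
  "cmap (prod_chart C D) ` (S \<times> T) = {z. pr1 z \<in> cmap C ` S \<and> pr2 z \<in> cmap D ` T}"
proof (intro set_eqI iffI)
  fix z assume "z \<in> {z. pr1 z \<in> cmap C ` S \<and> pr2 z \<in> cmap D ` T}"
  then obtain p q where "p \<in> S" "q \<in> T" "pr1 z = cmap C p" "pr2 z = cmap D q" by auto
  then show "z \<in> cmap (prod_chart C D) ` (S \<times> T)"
    by (intro image_eqI[of _ _ "(p, q)"] pr_eqI) auto
qed auto

lemma open_pr: "open S \<Longrightarrow> open T \<Longrightarrow> open {z. pr1 z \<in> S \<and> pr2 z \<in> T}"
proof -
  assume "open S" "open T"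
  then have "open (pr1 -` S \<inter> pr2 -` T)"
    by (intro open_Int open_vimage bounded_linear.continuous_on[OF bounded_linear_pr1]
        bounded_linear.continuous_on[OF bounded_linear_pr2] continuous_on_id) auto
  then show ?thesis by (simp add: vimage_def Collect_conj_eq)
qed

lemma continuous_on_pr: "continuous_on S pr1" "continuous_on S pr2"
  using linear_continuous_on bounded_linear_pr1 bounded_linear_pr2 by auto

locale two_atlases = A: atlas A + B: atlas B
  for A :: "('a::{t2_space,second_countable_topology}, 'm::finite) chart set"
    and B :: "('b::{t2_space,second_countable_topology}, 'n::finite) chart set"
begin

abbreviation "P \<equiv> prod_atlas A B"

lemma cinv_prod:
  assumes "C \<in> A" "D \<in> B" "pr1 z \<in> cmap C ` cdom C" "pr2 z \<in> cmap D ` cdom D"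
  shows "cinv (prod_chart C D) z = (cinv C (pr1 z), cinv D (pr2 z))"
proof -
  let ?E = "prod_chart C D"
  have "inj_on (cmap ?E) (cdom ?E)"
    using A.inj_on_cmap[OF assms(1)] B.inj_on_cmap[OF assms(2)]
    by (auto simp: inj_on_def) (metis fst_conv pr_cmap_prod_chart(1), metis snd_conv pr_cmap_prod_chart(2))
  moreover have "(cinv C (pr1 z), cinv D (pr2 z)) \<in> cdom ?E"
    using A.cinv_in[OF assms(1,3)] B.cinv_in[OF assms(2,4)] by simp
  moreover have "cmap ?E (cinv C (pr1 z), cinv D (pr2 z)) = z"
    using A.cmap_cinv[OF assms(1,3)] B.cmap_cinv[OF assms(2,4)] by (intro pr_eqI) simp_all
  ultimately show ?thesis unfolding cinv_def[of ?E] by (metis inv_into_f_f)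
qed

lemma smooth_pr:
  assumes "open S" "open T"
  shows "smooth_on S f \<Longrightarrow> smooth_on {z. pr1 z \<in> S \<and> pr2 z \<in> T} (\<lambda>z. f (pr1 z))"
    and "smooth_on T h \<Longrightarrow> smooth_on {z. pr1 z \<in> S \<and> pr2 z \<in> T} (\<lambda>z. h (pr2 z))"
proof -
  note op = open_pr[OF assms]
  show "smooth_on {z. pr1 z \<in> S \<and> pr2 z \<in> T} (\<lambda>z. f (pr1 z))" if "smooth_on S f"
    by (rule smooth_on_compose[OF op assms(1) _ that smooth_on_pr1[OF op]]) auto
  show "smooth_on {z. pr1 z \<in> S \<and> pr2 z \<in> T} (\<lambda>z. h (pr2 z))" if "smooth_on T h"
    by (rule smooth_on_compose[OF op assms(2) _ that smooth_on_pr2[OF op]]) auto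
qed

lemma prod_atlas_cases:
  assumes "E \<in> P" obtains C D where "E = prod_chart C D" "C \<in> A" "D \<in> B"
  using assms unfolding prod_atlas_def by blast

lemma smooth_atlas_prod: "smooth_atlas P"
  unfolding smooth_atlas_def
proof (intro conjI ballI)
  have "(p, q) \<in> (\<Union>E\<in>P. cdom E)" for p q
  proof (rule UN_I)
    show "prod_chart (chart_at A p) (chart_at B q) \<in> P"
      using A.charts_atD(1)[OF A.chart_at_in] B.charts_atD(1)[OF B.chart_at_in]
      unfolding prod_atlas_def by blast
    show "(p, q) \<in> cdom (prod_chart (chart_at A p) (chart_at B q))"
      using A.charts_atD(2)[OF A.chart_at_in] B.charts_atD(2)[OF B.chart_at_in] by simp
  qed
  then show "(\<Union>E\<in>P. cdom E) = UNIV" by auto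
next
  fix E assume "E \<in> P"
  then obtain C D where E: "E = prod_chart C D" and C: "C \<in> A" and D: "D \<in> B" by (rule prod_atlas_cases)
  have im: "cmap E ` cdom E = {z. pr1 z \<in> cmap C ` cdom C \<and> pr2 z \<in> cmap D ` cdom D}"
    by (simp add: E image_prod_chart)
  show "open (cdom E)" using A.open_cdom[OF C] B.open_cdom[OF D] by (simp add: E open_Times)
  show "open (cmap E ` cdom E)" unfolding im by (rule open_pr[OF A.open_range[OF C] B.open_range[OF D]])
  have hC: "homeomorphism (cdom C) (cmap C ` cdom C) (cmap C) (cinv C)"
    and hD: "homeomorphism (cdom D) (cmap D ` cdom D) (cmap D) (cinv D)"
    using A.smooth_atlas B.smooth_atlas C D unfolding smooth_atlas_def by blast+
  show "homeomorphism (cdom E) (cmap E ` cdom E) (cmap E) (cinv E)"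
  proof (rule homeomorphismI)
    have "continuous_on (cdom E) (\<lambda>q. in1 (cmap C (fst q)) + in2 (cmap D (snd q)))"
      using hC hD
      by (intro continuous_on_add bounded_linear.continuous_on[OF bounded_linear_in(1)]
        bounded_linear.continuous_on[OF bounded_linear_in(2)])
       (auto simp: E homeomorphism_def intro: continuous_on_compose2[OF _ continuous_on_fst[OF continuous_on_id]]
        continuous_on_compose2[OF _ continuous_on_snd[OF continuous_on_id]])
    then show "continuous_on (cdom E) (cmap E)" by (simp add: E cmap_prod_chart[abs_def])
    have "continuous_on (cmap E ` cdom E) (\<lambda>z. (cinv C (pr1 z), cinv D (pr2 z)))"
      using hC hD unfolding im
      by (intro continuous_on_Pair) (auto simp: homeomorphism_def intro: continuous_on_compose2[OF _ continuous_on_pr(1)]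
        continuous_on_compose2[OF _ continuous_on_pr(2)])
    then show "continuous_on (cmap E ` cdom E) (cinv E)"
      by (rule continuous_on_eq) (use cinv_prod[OF C D] in \<open>auto simp: im E[symmetric]\<close>)
    show "cinv E ` cmap E ` cdom E \<subseteq> cdom E"
      using C D A.cinv_cmap[OF C] B.cinv_cmap[OF D] by (auto simp: E cinv_prod)
    show "cinv E (cmap E p) = p" if "p \<in> cdom E" for p
      using that C D A.cinv_cmap[OF C] B.cinv_cmap[OF D] by (auto simp: E cinv_prod)
    show "cmap E (cinv E z) = z" if "z \<in> cmap E ` cdom E" for z
      using that C D A.cmap_cinv[OF C] B.cmap_cinv[OF D] unfolding im by (intro pr_eqI) (auto simp: E cinv_prod)
  qed auto
next
  fix E E' assume "E \<in> P" "E' \<in> P"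
  then obtain C D C' D' where E: "E = prod_chart C D" "E' = prod_chart C' D'" and
      C: "C \<in> A" "C' \<in> A" and D: "D \<in> B" "D' \<in> B" by (metis prod_atlas_cases)
  let ?W = "{z. pr1 z \<in> cmap C ` (cdom C \<inter> cdom C') \<and> pr2 z \<in> cmap D ` (cdom D \<inter> cdom D')}"
  have im: "cmap E ` (cdom E \<inter> cdom E') = ?W"
    by (simp add: E Times_Int_Times image_prod_chart)
  have op: "open ?W"
    using A.open_overlap[OF C] B.open_overlap[OF D] by (rule open_pr)
  have "smooth_on ?W (\<lambda>z. in1 (cmap C' (cinv C (pr1 z))) + in2 (cmap D' (cinv D (pr2 z))))"
    by (intro smooth_intros op smooth_on_bounded_linear[OF op bounded_linear_in(1)]
      smooth_on_bounded_linear[OF op bounded_linear_in(2)]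
      smooth_pr(1)[OF A.open_overlap[OF C] B.open_overlap[OF D] A.smooth_transition[OF C]]
      smooth_pr(2)[OF A.open_overlap[OF C] B.open_overlap[OF D] B.smooth_transition[OF D]])
  then show "smooth_on (cmap E ` (cdom E \<inter> cdom E')) (cmap E' \<circ> cinv E)"
    unfolding im
    by (rule smooth_on_cong[OF op, rotated]) (auto simp: E cmap_prod_chart cinv_prod C D)
qed

sublocale P: atlas P
  by unfold_locales (rule smooth_atlas_prod)

lemma smooth_map_fst: "smooth_map P A fst"
  unfolding smooth_map_def
proof (intro conjI ballI)
  fix E C' assume "E \<in> P" and C': "C' \<in> A"
  then obtain C D where E: "E = prod_chart C D" and C: "C \<in> A" and D: "D \<in> B" by (metis prod_atlas_cases)
  let ?W = "{z. pr1 z \<in> cmap C ` (cdom C \<inter> cdom C') \<and> pr2 z \<in> cmap D ` cdom D}"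
  have "cdom E \<inter> fst -` cdom C' = (cdom C \<inter> cdom C') \<times> cdom D" by (auto simp: E)
  then have im: "cmap E ` (cdom E \<inter> fst -` cdom C') = ?W" by (simp add: E image_prod_chart)
  have "smooth_on ?W (\<lambda>z. cmap C' (cinv C (pr1 z)))"
    by (rule smooth_pr(1)[OF A.open_overlap[OF C C'] B.open_range[OF D] A.smooth_transition[OF C C']])
  then show "smooth_on (cmap E ` (cdom E \<inter> fst -` cdom C')) (cmap C' \<circ> fst \<circ> cinv E)"
    unfolding im
    by (rule smooth_on_cong[OF open_pr[OF A.open_overlap[OF C C'] B.open_range[OF D]], rotated])
      (auto simp: E cinv_prod C D)
qed (rule continuous_on_fst[OF continuous_on_id])

lemma smooth_map_snd: "smooth_map P B snd"
  unfolding smooth_map_def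
proof (intro conjI ballI)
  fix E D' assume "E \<in> P" and D': "D' \<in> B"
  then obtain C D where E: "E = prod_chart C D" and C: "C \<in> A" and D: "D \<in> B" by (metis prod_atlas_cases)
  let ?W = "{z. pr1 z \<in> cmap C ` cdom C \<and> pr2 z \<in> cmap D ` (cdom D \<inter> cdom D')}"
  have "cdom E \<inter> snd -` cdom D' = cdom C \<times> (cdom D \<inter> cdom D')" by (auto simp: E)
  then have im: "cmap E ` (cdom E \<inter> snd -` cdom D') = ?W" by (simp add: E image_prod_chart)
  have "smooth_on ?W (\<lambda>z. cmap D' (cinv D (pr2 z)))"
    by (rule smooth_pr(2)[OF A.open_range[OF C] B.open_overlap[OF D D'] B.smooth_transition[OF D D']])
  then show "smooth_on (cmap E ` (cdom E \<inter> snd -` cdom D')) (cmap D' \<circ> snd \<circ> cinv E)"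
    unfolding im
    by (rule smooth_on_cong[OF open_pr[OF A.open_range[OF C] B.open_overlap[OF D D']], rotated])
      (auto simp: E cinv_prod C D)
qed (rule continuous_on_snd[OF continuous_on_id])

context
  fixes C D p q
  assumes C: "C \<in> charts_at A p" and D: "D \<in> charts_at B q"
begin

lemma prod_chart_at: "prod_chart C D \<in> charts_at P (p, q)"
proof -
  have "prod_chart C D \<in> P"
    using A.charts_atD(1)[OF C] B.charts_atD(1)[OF D] unfolding prod_atlas_def by blast
  then show ?thesis
    using A.charts_atD(2)[OF C] B.charts_atD(2)[OF D] by (simp add: charts_at_def)
qed

text \<open>In a product chart the projections are \<open>pr1\<close> and \<open>pr2\<close>
  followed by a chart change of the factor; the Jacobian of the latter is built into
  \<open>A.tv\<close> and \<open>B.tv\<close>.\<close>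

lemma differential_tv:
  "differential P A fst (p, q) (P.tv (prod_chart C D) (p, q) u) = A.tv C p (pr1 u)"
  "differential P B snd (p, q) (P.tv (prod_chart C D) (p, q) u) = B.tv D q (pr2 u)"
proof -
  let ?E = "prod_chart C D"
  have *: "C \<in> A" "p \<in> cdom C" "D \<in> B" "q \<in> cdom D" using C D by (auto simp: charts_at_def)
  have z: "cmap ?E (p, q) \<in> {z. pr1 z \<in> cmap C ` cdom C \<and> pr2 z \<in> cmap D ` cdom D}" using * by auto
  note op = open_pr[OF A.open_range[OF *(1)] B.open_range[OF *(3)]]
  have "Der (\<lambda>x. cmap C' (fst (cinv ?E x))) (cmap ?E (p, q)) u = A.jac C C' p (pr1 u)"
    if C': "C' \<in> charts_at A p" for C'
  proof -
    have "Der (\<lambda>x. cmap C' (fst (cinv ?E x))) (cmap ?E (p, q)) u = Der (\<lambda>z. cmap C' (cinv C (pr1 z))) (cmap ?E (p, q)) u"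
      by (rule Der_cong_open[OF op z]) (simp add: cinv_prod *)
    also have "\<dots> = A.jac C C' p (pr1 u)"
      using Der_compose[OF differentiable_pr(1), of "\<lambda>x. cmap C' (cinv C x)" "cmap ?E (p, q)" u]
        smooth_on_differentiable[OF A.smooth_transition A.in_overlap[OF C C']] * A.charts_atD[OF C']
      by (simp add: A.jac_def)
    finally show ?thesis .
  qed
  then show "differential P A fst (p, q) (P.tv ?E (p, q) u) = A.tv C p (pr1 u)"
    using differential_eq[OF smooth_atlas_prod smooth_map_fst A.smooth_atlas prod_chart_at] by (auto simp: A.tv_def)
  have "Der (\<lambda>x. cmap D' (snd (cinv ?E x))) (cmap ?E (p, q)) u = B.jac D D' q (pr2 u)"
    if D': "D' \<in> charts_at B q" for D'
  proof -
    have "Der (\<lambda>x. cmap D' (snd (cinv ?E x))) (cmap ?E (p, q)) u = Der (\<lambda>z. cmap D' (cinv D (pr2 z))) (cmap ?E (p, q)) u"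
      by (rule Der_cong_open[OF op z]) (simp add: cinv_prod *)
    also have "\<dots> = B.jac D D' q (pr2 u)"
      using Der_compose[OF differentiable_pr(2), of "\<lambda>x. cmap D' (cinv D x)" "cmap ?E (p, q)" u]
        smooth_on_differentiable[OF B.smooth_transition B.in_overlap[OF D D']] * B.charts_atD[OF D']
      by (simp add: B.jac_def)
    finally show ?thesis .
  qed
  then show "differential P B snd (p, q) (P.tv ?E (p, q) u) = B.tv D q (pr2 u)"
    using differential_eq[OF smooth_atlas_prod smooth_map_snd B.smooth_atlas prod_chart_at] by (auto simp: B.tv_def)
qed

end

end

section \<open>The projection of the warped product\<close>

locale warped_product = M: riem_manifold A g + N: riem_manifold B h
  for A :: "('a::{t2_space,second_countable_topology}, 'm::finite) chart set" and g
    and B :: "('b::{t2_space,second_countable_topology}, 'n::finite) chart set" and h +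
  fixes lam :: "'a \<Rightarrow> real"
  assumes lam: "smooth_function A lam"
begin

sublocale two_atlases A B ..

abbreviation "G \<equiv> warped_metric A g B h lam"

text \<open>\<open>metric_in\<close> is determined by coordinate vectors, so the formula is checked
  on the axes and extended by bilinearity. Symmetry, nondegeneracy and smoothness of the warped
  metric in the chart are then read off from it in \<open>local_warped\<close>.\<close>

lemma ip_warped:
  assumes C: "C \<in> A" and D: "D \<in> B" and z: "pr1 z \<in> cmap C ` cdom C" "pr2 z \<in> cmap D ` cdom D"
  shows "ip (metric_in P G (prod_chart C D)) z u v = ip (M.gm C) (pr1 z) (pr1 u) (pr1 v)
    + exp (2 * lam (cinv C (pr1 z))) * ip (N.gm D) (pr2 z) (pr2 u) (pr2 v)"
proof -
  obtain p q where pq: "C \<in> charts_at A p" "D \<in> charts_at B q" "pr1 z = cmap C p" "pr2 z = cmap D q"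
    using z C D by (auto simp: charts_at_def)
  then have inv: "cinv C (pr1 z) = p" "cinv (prod_chart C D) z = (p, q)"
    using C D z M.cinv_cmap[OF C] N.cinv_cmap[OF D] by (auto simp: charts_at_def cinv_prod)
  let ?R = "\<lambda>u v. ip (M.gm C) (pr1 z) (pr1 u) (pr1 v)
    + exp (2 * lam (cinv C (pr1 z))) * ip (N.gm D) (pr2 z) (pr2 u) (pr2 v)"
  have "ip (metric_in P G (prod_chart C D)) z (axis i 1) (axis j 1) = ?R (axis i 1) (axis j 1)" for i j
    by (simp add: ip_def[of "metric_in P G _"] inner_axis' matrix_vector_mult_basis column_def metric_in_def[of P]
      P.coord_vec_eq inv warped_metric_def differential_tv[OF pq(1,2)] M.g_tv[OF pq(1)] N.g_tv[OF pq(2)] pq(3,4) M.cinv_cmap[OF M.charts_atD[OF pq(1)]])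
  moreover have "bilinear ?R"
    by (auto simp: bilinear_def linear_iff linear_add[OF linear_pr(1)] linear_add[OF linear_pr(2)]
      linear_scale[OF linear_pr(1)] linear_scale[OF linear_pr(2)] ip_simps algebra_simps)
  ultimately show ?thesis
    using bilinear_eq_sum_axis[OF bilinear_ip, of "metric_in P G (prod_chart C D)" z u v]
      bilinear_eq_sum_axis[of ?R u v] by simp
qed

text \<open>The first factor of the chosen product chart and the target chart \<open>D\<close> both
  contain \<open>fst p\<close>; over their overlap the projection has the form required by
  \<open>local_warped\<close>.\<close>

lemma bitension_chart:
  assumes D: "D \<in> charts_at A (fst p)"
  shows "bitension_field P G A g fst p D = real CARD('n) *\<^sub>R M.bih lam (real CARD('n) / 2) D (cmap D (fst p))"
proof -
  define E where "E = chart_at P p"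
  have E: "E \<in> charts_at P p" unfolding E_def by (rule P.chart_at_in)
  then obtain C1 C2 where EC: "E = prod_chart C1 C2" and C: "C1 \<in> A" "C2 \<in> B"
    using P.charts_atD by (metis prod_atlas_cases)
  have p: "fst p \<in> cdom C1" "snd p \<in> cdom C2" using E by (auto simp: EC charts_at_def)
  have DA: "D \<in> A" "fst p \<in> cdom D" using D by (auto simp: charts_at_def)
  let ?S1 = "cmap C1 ` (cdom C1 \<inter> cdom D)" and ?S2 = "cmap C2 ` cdom C2" and ?\<psi> = "\<lambda>x. cmap D (cinv C1 x)"
  interpret L: local_warped ?S1 "M.gm C1" "cmap D ` cdom D" "M.gm D" ?\<psi> ?S2 "N.gm C2"
    "lam \<circ> cinv D" "metric_in P G E" "{z. pr1 z \<in> ?S1 \<and> pr2 z \<in> ?S2}"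
  proof (intro local_warped.intro local_warped_axioms.intro)
    show "local_isometry ?S1 (M.gm C1) (cmap D ` cdom D) (M.gm D) ?\<psi>"
      by (rule M.local_isometry_transition[OF C(1) DA(1)])
    show "local_metric ?S2 (N.gm C2)" by (intro N.local_metric_chart C N.open_range) auto
    show "smooth_on (cmap D ` cdom D) (lam \<circ> cinv D)" by (rule M.smooth_chart[OF lam DA(1)])
    fix z u v assume z: "z \<in> {z. pr1 z \<in> ?S1 \<and> pr2 z \<in> ?S2}"
    then have "cinv D (cmap D (cinv C1 (pr1 z))) = cinv C1 (pr1 z)"
      using M.cinv_cmap[OF C(1)] M.cinv_cmap[OF DA(1)] by auto
    then show "ip (metric_in P G E) z u v = ip (M.gm C1) (pr1 z) (pr1 u) (pr1 v)
       + exp (2 * (lam \<circ> cinv D) (?\<psi> (pr1 z))) * ip (N.gm C2) (pr2 z) (pr2 u) (pr2 v)"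
      using z ip_warped[OF C, of z u v] by (auto simp: EC)
  qed simp
  let ?f = "cmap D \<circ> fst \<circ> cinv E"
  have f: "?f z = ?\<psi> (pr1 z)" if "z \<in> {z. pr1 z \<in> ?S1 \<and> pr2 z \<in> ?S2}" for z
    using that by (auto simp: EC cinv_prod C)
  have "cmap E p \<in> {z. pr1 z \<in> ?S1 \<and> pr2 z \<in> ?S2}"
    using p DA by (auto simp: EC)
  from L.bitension_f[of ?f, OF f this] show ?thesis
    using D P.cinv_cmap[OF P.charts_atD[OF E]]
    by (simp add: bitension_field_def Let_def E_def[symmetric] M.bih_def[OF lam])
qed

text \<open>Types are inhabited, which is used twice: \<open>CARD('n)\<close> is nonzero and can be
  cancelled, and \<open>fst\<close> is onto, so that points of the product may be replaced by points
  of the base.\<close>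

lemma biharmonic_iff:
  "biharmonic P G A g fst \<longleftrightarrow> (\<forall>p. \<forall>D\<in>charts_at A p. M.bih lam (real CARD('n) / 2) D (cmap D p) = 0)"
proof -
  have "bitension_field P G A g fst p = (\<lambda>_. 0) \<longleftrightarrow>
      (\<forall>D\<in>charts_at A (fst p). M.bih lam (real CARD('n) / 2) D (cmap D (fst p)) = 0)" for p
  proof -
    have "bitension_field P G A g fst p D = 0" if "D \<notin> charts_at A (fst p)" for D
      using that by (simp add: bitension_field_def)
    moreover have "bitension_field P G A g fst p D = 0 \<longleftrightarrow> M.bih lam (real CARD('n) / 2) D (cmap D (fst p)) = 0"
      if "D \<in> charts_at A (fst p)" for D
      by (simp add: bitension_chart[OF that])
    ultimately show ?thesis unfolding fun_eq_iff by metis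
  qed
  then show ?thesis using smooth_map_fst by (simp add: biharmonic_def)
qed

end

theorem theorem2p4:
  fixes A :: "('a::{t2_space,second_countable_topology}, 'm::finite) chart set"
    and g :: "('a, 'm) rmetric"
    and B :: "('b::{t2_space,second_countable_topology}, 'n::finite) chart set"
    and h :: "('b, 'n) rmetric"
    and lam :: "'a \<Rightarrow> real"
  assumes "riemannian_manifold A g"
    and "riemannian_manifold B h"
    and "smooth_function A lam"
  shows "biharmonic (prod_atlas A B) (warped_metric A g B h lam) A g fst \<longleftrightarrow>
    (\<forall>p. (\<lambda>C. grad A g (laplacian A g lam) p C
             + 2 *\<^sub>R ricci_op A g p (grad A g lam p) C
             + (real CARD('n) / 2) *\<^sub>R
                 grad A g (\<lambda>q. g q (grad A g lam q) (grad A g lam q)) p C)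
         = (\<lambda>_. 0))"
proof -
  interpret warped_product A g B h lam
    using assms by unfold_locales (auto simp: riemannian_manifold_def)
  show ?thesis
    unfolding biharmonic_iff M.bih_chart[OF assms(3)] fun_eq_iff by (metis (no_types, lifting))
qed

end
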